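(* Let $N\ge 2$ be an integer, let $p>1$ and $\sigma\in(-1,0)$ be real numbers. Assume $w\in C_0^\alpha(\mathbb{R}^N)\cap L^1(\mathbb{R}^N)$ for some $\alpha\in(0,1)$, with $w\not\equiv 0$. Consider the integral equation $$u(t)=e^{t\Delta}u_0+\int_0^t e^{(t-s)\Delta}\left(|u(s)|^p+s^\sigma w\right)ds. \qquad (\ast)$$ Then the following holds. (i) Assume $$1<p<\frac{N-2\sigma}{N-2-2\sigma}$$ and $\int_{\mathbb{R}^N}w(x)\,dx>0$. Then for any $u_0\in C_0(\mathbb{R}^N)$, the solution of $(\ast)$ blows up in finite time. (ii) Assume $$p\ge\frac{N-2\sigma}{N-2-2\sigma},$$ and put $$d=\frac{N(p-1)}{2},\qquad k=\frac{d}{p(\sigma+1)-\sigma}.$$ Then, for any $u_0\in C_0(\mathbb{R}^N)\cap L^d(\mathbb{R}^N)$ and any such $w$ for which $\|u_0\|_{L^d(\mathbb{R}^N)}+\|w\|_{L^k(\mathbb{R}^N)}$ is sufficiently small (that is, smaller than some $\varepsilon>0$ depending only on $N,p,\sigma$), the solution $u$ of $(\ast)$ exists globally.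
   Context: All functions are real-valued (no sign condition is imposed on $u_0$ or $w$). $C_0(\mathbb{R}^N)$ is the space of continuous functions on $\mathbb{R}^N$ vanishing at infinity, equipped with the supremum norm. For $\alpha\in(0,1)$, $C_0^\alpha(\mathbb{R}^N)=C^\alpha(\mathbb{R}^N)\cap C_0(\mathbb{R}^N)$, where $C^\alpha(\mathbb{R}^N)$ is the space of Hölder continuous functions with exponent $\alpha$. $e^{t\Delta}$ denotes the heat semigroup on $\mathbb{R}^N$: $(e^{t\Delta}\varphi)(x)=(4\pi t)^{-N/2}\int_{\mathbb{R}^N}e^{-|x-y|^2/(4t)}\varphi(y)\,dy$ for $t>0$, and $e^{0\Delta}\varphi=\varphi$. A solution of $(\ast)$ on $[0,T]$ is a function $u\in C([0,T],C_0(\mathbb{R}^N))$ satisfying $(\ast)$ for all $0\le t\le T$; such solutions are unique. ($(\ast)$ is the integral form of $\partial_t u=\Delta u+|u|^p+t^\sigma w(x)$, $u(0,x)=u_0(x)$.) Put $T_{\max}=\sup\{t>0:\ (\ast)\text{ admits a solution in }C([0,t],C_0(\mathbb{R}^N))\}\in(0,\infty]$; the solution of $(\ast)$ means the unique maximal solution $u\in C([0,T_{\max}),C_0(\mathbb{R}^N))$. The solution blows up in finite time if $T_{\max}<\infty$ and $\lim_{t\to T_{\max}^-}\|u(t)\|_{L^\infty}=\infty$. The solution exists globally if $T_{\max}=\infty$. *)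

theory Defs
  imports "HOL-Analysis.Analysis"
begin

text \<open>
  A continuous function vanishing at infinity is bounded, so the space of such functions is
  rendered as a subset of the library type of bounded continuous functions, whose norm, distance
  and topology are those of the supremum norm.
\<close>

definition C0 :: "((real ^ 'n) \<Rightarrow>\<^sub>C real) set" where
  "C0 = {f. (apply_bcontfun f \<longlongrightarrow> 0) at_infinity}"

definition C0_holder :: "real \<Rightarrow> ((real ^ 'n) \<Rightarrow>\<^sub>C real) set" where
  "C0_holder \<alpha> = {f \<in> C0. \<exists>H. \<forall>x y. \<bar>f x - f y\<bar> \<le> H * norm (x - y) powr \<alpha>}"

definition Lp :: "real \<Rightarrow> ((real ^ 'n) \<Rightarrow> real) set" where
  "Lp q = {f \<in> borel_measurable lborel. integrable lborel (\<lambda>x. \<bar>f x\<bar> powr q)}"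

text \<open>Only meaningful for members of \<open>Lp q\<close>: the Bochner integral of a non-integrable function is 0.\<close>

definition Lp_norm :: "real \<Rightarrow> ((real ^ 'n) \<Rightarrow> real) \<Rightarrow> real" where
  "Lp_norm q f = (\<integral>x. \<bar>f x\<bar> powr q \<partial>lborel) powr (1 / q)"

definition heat :: "real \<Rightarrow> ((real ^ 'n) \<Rightarrow> real) \<Rightarrow> (real ^ 'n) \<Rightarrow> real" where
  "heat t \<phi> x =
     (if t = 0 then \<phi> x
      else (4 * pi * t) powr (- real CARD('n) / 2) *
           (\<integral>y. exp (- (norm (x - y))\<^sup>2 / (4 * t)) * \<phi> y \<partial>lborel))"

text \<open>
  The integral equation is read pointwise in \<open>x\<close>. For \<open>\<sigma> > -1\<close> and \<open>u\<close> continuous into \<open>C0\<close> the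
  \<open>s\<close>-integrand is continuous on \<open>(0, t]\<close> and bounded by a constant multiple of \<open>1 + s powr \<sigma>\<close>,
  hence integrable. The convention \<open>0 powr \<sigma> = 0\<close> matters only at the single point \<open>s = 0\<close>.
\<close>

definition mild_solution ::
  "real \<Rightarrow> real \<Rightarrow> ((real ^ 'n) \<Rightarrow>\<^sub>C real) \<Rightarrow> ((real ^ 'n) \<Rightarrow>\<^sub>C real) \<Rightarrow> real \<Rightarrow>
    (real \<Rightarrow> (real ^ 'n) \<Rightarrow>\<^sub>C real) \<Rightarrow> bool" where
  "mild_solution p \<sigma> w u0 T u \<longleftrightarrow>
     continuous_on {0..T} u \<and>
     (\<forall>t\<in>{0..T}. u t \<in> C0) \<and>
     (\<forall>t\<in>{0..T}. \<forall>x.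
        u t x = heat t u0 x +
          (LINT s:{0..t}|lborel. heat (t - s) (\<lambda>y. \<bar>u s y\<bar> powr p + s powr \<sigma> * w y) x))"

definition T_max ::
  "real \<Rightarrow> real \<Rightarrow> ((real ^ 'n) \<Rightarrow>\<^sub>C real) \<Rightarrow> ((real ^ 'n) \<Rightarrow>\<^sub>C real) \<Rightarrow> ereal" where
  "T_max p \<sigma> w u0 = Sup {ereal t |t. 0 < t \<and> (\<exists>u. mild_solution p \<sigma> w u0 t u)}"

text \<open>The values \<open>u t\<close> for \<open>t\<close> outside \<open>[0, T_max)\<close> are unconstrained.\<close>

definition maximal_solution ::
  "real \<Rightarrow> real \<Rightarrow> ((real ^ 'n) \<Rightarrow>\<^sub>C real) \<Rightarrow> ((real ^ 'n) \<Rightarrow>\<^sub>C real) \<Rightarrow>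
    (real \<Rightarrow> (real ^ 'n) \<Rightarrow>\<^sub>C real) \<Rightarrow> bool" where
  "maximal_solution p \<sigma> w u0 u \<longleftrightarrow>
     0 < T_max p \<sigma> w u0 \<and>
     (\<forall>T. 0 < T \<and> ereal T < T_max p \<sigma> w u0 \<longrightarrow> mild_solution p \<sigma> w u0 T u)"

text \<open>
  The existence conjunct keeps the statement about the maximal solution from holding vacuously,
  and makes \<open>T_max\<close> positive, so that under \<open>T_max < \<infinity>\<close> it is a real number.
\<close>

definition blows_up_in_finite_time ::
  "real \<Rightarrow> real \<Rightarrow> ((real ^ 'n) \<Rightarrow>\<^sub>C real) \<Rightarrow> ((real ^ 'n) \<Rightarrow>\<^sub>C real) \<Rightarrow> bool" where
  "blows_up_in_finite_time p \<sigma> w u0 \<longleftrightarrow>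
     T_max p \<sigma> w u0 < \<infinity> \<and>
     (\<exists>u. maximal_solution p \<sigma> w u0 u) \<and>
     (\<forall>u. maximal_solution p \<sigma> w u0 u \<longrightarrow>
        filterlim (\<lambda>t. norm (u t)) at_top (at_left (real_of_ereal (T_max p \<sigma> w u0))))"

definition exists_globally ::
  "real \<Rightarrow> real \<Rightarrow> ((real ^ 'n) \<Rightarrow>\<^sub>C real) \<Rightarrow> ((real ^ 'n) \<Rightarrow>\<^sub>C real) \<Rightarrow> bool" where
  "exists_globally p \<sigma> w u0 \<longleftrightarrow>
     T_max p \<sigma> w u0 = \<infinity> \<and> (\<exists>u. maximal_solution p \<sigma> w u0 u)"

end

theory Submission
  imports Defs "HOL-Probability.Distributions"
begin

text \<open>
  Write \<open>e\<^sup>t\<^sup>\<Delta>\<close> for the heat semigroup. Since the map \<open>z \<mapsto> |z|\<^sup>p\<close> is locally Lipschitz, the integral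
  equation has a local theory in the space of continuous functions vanishing at infinity: it is
  solved by a contraction on a time interval whose length depends only on a bound for the data
  (\<open>local_existence\<close>), solutions are unique, and a solution can be restarted at any time by the
  semigroup property. Hence a maximal solution exists, and its norm tends to infinity if its
  lifespan is finite (\<open>norm_tendsto_infinity_at_T_max\<close>). The theorem is thereby reduced to two
  statements: below the critical exponent no solution lives on a long interval, and from the
  critical exponent on, small data give a bound on every bounded interval.

  Nonexistence (\<open>heat_average_lifespan\<close>). For a solution \<open>u\<close> on \<open>[0, T]\<close> let \<open>m t\<close> be the heat flow
  for the time \<open>2 * T - t\<close> applied to \<open>u t\<close> and evaluated at the origin. The semigroup property
  turns the integral equation into a formula for the derivative of \<open>m\<close>, and Jensen's inequality gives \<open>m' \<ge> |m|\<^sup>p + a\<close>, where \<open>a\<close> is a lower bound for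
  \<open>t powr \<sigma>\<close> times the average of \<open>w\<close>. For large \<open>T\<close> that average is at least a constant times
  \<open>T powr (- N/2)\<close>, because \<open>w\<close> has positive integral, so \<open>a\<close> is of order \<open>T powr (\<sigma> - N/2)\<close>. The equation
  \<open>m' = |m|\<^sup>p + a\<close> runs from minus infinity to infinity in a time proportional to
  \<open>a powr ((1 - p) / p)\<close>; this bounds \<open>T\<close> whatever the initial value is, which is why no sign or
  decay of the initial datum matters. Comparing powers of \<open>T\<close>, the bound
  \<open>T \<le> const * T powr ((N/2 - \<sigma>) (p - 1) / p)\<close> fails for large \<open>T\<close> exactly when
  \<open>p (N - 2 - 2\<sigma>) < N - 2\<sigma>\<close>.

  Global existence (\<open>global_existence_small_data\<close>). The smoothing estimate
  \<open>\<parallel>e\<^sup>t\<^sup>\<Delta> f\<parallel>\<^sub>q \<le> t powr (- N/2 (1/r - 1/q)) \<parallel>f\<parallel>\<^sub>r\<close> (\<open>heat_flow_Lq\<close>) is applied along the Picard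
  iterates \<open>u\<^sub>n\<close>. With \<open>\<beta> = 1/(p - 1) - N/(2q)\<close> the contributions of \<open>u0\<close>, of \<open>w\<close> and of \<open>|u\<^sub>n|\<^sup>p\<close> to
  \<open>\<parallel>u\<^sub>n\<^sub>+\<^sub>1 t\<parallel>\<^sub>q\<close> all scale like \<open>t powr (- \<beta>)\<close>; the exponents \<open>d\<close> and \<open>k\<close> are the ones for which this
  is so. Small norms therefore keep \<open>\<parallel>u\<^sub>n t\<parallel>\<^sub>q \<le> K * t powr (- \<beta>)\<close> with a small constant \<open>K\<close>, uniformly in
  \<open>n\<close> and \<open>t\<close>. Writing \<open>|u\<^sub>n|\<^sup>p\<close> as \<open>|u\<^sub>n|\<close> times \<open>|u\<^sub>n| powr (p - 1)\<close> and estimating only the second factor by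
  this bound shows that \<open>u\<^sub>n\<close> enters the supremum norm of \<open>u\<^sub>n\<^sub>+\<^sub>1\<close> with a factor at most \<open>1/2\<close>
  (\<open>picard_sup_bound\<close>). So the iterates, and with them the solution to which they converge, stay
  bounded on every bounded time interval.
\<close>

section \<open>The Gaussian measure and the heat kernel\<close>

text \<open>
  The Henstock-Kurzweil integral of functions with values in this space is used throughout; its
  existence theorems are stated for Banach spaces.
\<close>

instance bcontfun :: (metric_space, banach) banach ..

text \<open>
  The source of all convexity arguments below: integrated, it gives Jensen's inequality and
  Minkowski's integral inequality; with \<open>y\<close> and \<open>z\<close> exchanged, the Lipschitz bound for powers.
\<close>

lemma powr_above_tangent:
  fixes y z q :: real
  assumes "1 \<le> q" "0 \<le> y" "0 \<le> z"
  shows "z powr q + q * z powr (q - 1) * (y - z) \<le> y powr q"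
proof (cases "z = 0")
  case False
  then have z: "z > 0" using assms by simp
  show ?thesis
  proof (cases "y = 0")
    case True
    have "z powr (q - 1) * z = z powr q"
      using z by (simp add: powr_mult_base mult.commute)
    then show ?thesis
      using True assms mult_right_mono[of 1 q "z powr q"] by (simp add: algebra_simps)
  next
    case False
    then have y: "y > 0" using assms by simp
    have "y powr q - z powr q \<ge> (q * z powr (q - 1)) * (y - z)"
    proof (rule convex_on_imp_above_tangent[where A = "{0<..}" and f = "\<lambda>x. x powr q" and x = y and c = z])
      show "((\<lambda>x. x powr q) has_real_derivative q * z powr (q - 1)) (at z within {0<..})"
        using has_field_derivative_at_within[OF has_real_derivative_powr[OF z]] .
    qed (use y z assms powr_convex in \<open>auto simp: interior_open\<close>)
    then show ?thesis by simp
  qed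
qed (use assms in auto)

definition heat_kernel :: "real \<Rightarrow> real ^ 'n::finite \<Rightarrow> real ^ 'n \<Rightarrow> real" where
  "heat_kernel t x y = (4 * pi * t) powr (- real CARD('n) / 2) * exp (- (norm (x - y))\<^sup>2 / (4 * t))"

lemma heat_kernel_nonneg [simp]: "0 \<le> heat_kernel t x y"
  by (simp add: heat_kernel_def)

lemma measurable_heat_kernel [measurable (raw)]:
  "f \<in> borel_measurable M \<Longrightarrow> g \<in> borel_measurable M \<Longrightarrow> (\<lambda>w. heat_kernel t (f w) (g w)) \<in> borel_measurable M"
  unfolding heat_kernel_def by simp

text \<open>
  The kernel is the product over the coordinates of normal densities of variance \<open>2 * t\<close>.
\<close>

lemma nn_integral_heat_kernel:
  fixes x :: "real ^ 'n::finite"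
  assumes t: "t > 0"
  shows "(\<integral>\<^sup>+ y. ennreal (heat_kernel t x y) \<partial>lborel) = 1"
proof -
  let ?s = "sqrt (2 * t)"
  have *: "(4 * pi * t) powr (- real CARD('n) / 2) * exp (- (norm (x - y))\<^sup>2 / (4 * t)) =
      (\<Prod>b\<in>Basis. normal_density (x \<bullet> b) ?s (y \<bullet> b))" for y
  proof -
    have c: "(4 * pi * t) powr (- real CARD('n) / 2) = (1 / sqrt (4 * pi * t)) ^ CARD('n)"
    proof -
      have "(4 * pi * t) powr (- real CARD('n) / 2) = ((4 * pi * t) powr (- 1 / 2)) powr real CARD('n)"
        by (simp add: powr_powr)
      also have "(4 * pi * t) powr (- 1 / 2) = 1 / sqrt (4 * pi * t)"
        using t by (simp add: powr_minus powr_half_sqrt divide_simps)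
      finally show ?thesis using t by (simp add: powr_realpow)
    qed
    have e: "- (norm (x - y))\<^sup>2 / (4 * t) = (\<Sum>b\<in>Basis. - (y \<bullet> b - x \<bullet> b)\<^sup>2 / (2 * ?s\<^sup>2))"
    proof -
      have "(norm (x - y))\<^sup>2 = (\<Sum>b\<in>Basis. (y \<bullet> b - x \<bullet> b)\<^sup>2)"
        unfolding power2_norm_eq_inner
        by (subst euclidean_inner) (simp add: inner_diff_left power2_eq_square[symmetric] power2_commute)
      then show ?thesis
        using t by (simp add: sum_divide_distrib sum_negf)
    qed
    show ?thesis
      unfolding e exp_sum[OF finite_Basis] c normal_density_def prod.distrib prod_constant
      using t by (simp add: mult.assoc)
  qed
  have "(\<integral>\<^sup>+ y. ennreal (\<Prod>b\<in>Basis. normal_density (x \<bullet> b) ?s (y \<bullet> b)) \<partial>lborel)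
      = (\<integral>\<^sup>+ y. (\<Prod>b\<in>Basis. ennreal (normal_density (x \<bullet> b) ?s (y \<bullet> b))) \<partial>lborel)"
    by (simp add: prod_ennreal)
  also have "\<dots> = (\<Prod>b\<in>(Basis :: (real ^ 'n) set). \<integral>\<^sup>+ y. ennreal (normal_density (x \<bullet> b) ?s y) \<partial>lborel)"
    by (rule nn_integral_lborel_prod) auto
  also have "\<dots> = 1"
  proof -
    have "0 < ?s" using t by simp
    then have "(\<integral>\<^sup>+ y. ennreal (normal_density \<mu> ?s y) \<partial>lborel) = 1" for \<mu>
      by (subst nn_integral_eq_integral) auto
    then show ?thesis by simp
  qed
  finally show ?thesis unfolding heat_kernel_def * .
qed

lemma integrable_heat_kernel: "0 < t \<Longrightarrow> integrable lborel (heat_kernel t x)"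
  by (rule integrableI_nonneg) (auto simp: nn_integral_heat_kernel)

lemma integral_heat_kernel: "0 < t \<Longrightarrow> (\<integral>y. heat_kernel t x y \<partial>lborel) = 1"
  using nn_integral_heat_kernel[of t x] integrable_heat_kernel[of t x]
  by (simp add: nn_integral_eq_integral)

text \<open>
  The law of the heat kernel at time 1. Scaling by \<open>sqrt t\<close> turns it into the law at time \<open>t\<close>, so one
  probability measure represents the semigroup at all times.
\<close>

definition gauss :: "(real ^ 'n::finite) measure" where
  "gauss = density lborel (\<lambda>z. ennreal ((4 * pi) powr (- real CARD('n) / 2) * exp (- (norm z)\<^sup>2 / 4)))"

lemma space_gauss [simp]: "space gauss = UNIV"
  and sets_gauss [simp, measurable_cong]: "sets gauss = sets borel"
  by (simp_all add: gauss_def)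

interpretation gauss: prob_space "gauss :: (real ^ 'n::finite) measure"
  by standard (use nn_integral_heat_kernel[of 1 "0 :: real ^ 'n"] in \<open>simp add: gauss_def emeasure_density heat_kernel_def\<close>)

lemma measure_gauss_UNIV [simp]: "measure gauss (UNIV :: (real ^ 'n::finite) set) = 1"
  using gauss.prob_space[where 'n = 'n] by simp

text \<open>
  In this form time 0 is no exception, and contractivity, positivity, Jensen's inequality and
  continuity in time are read off from averages over one probability space.
\<close>

lemma heat_eq_gauss:
  fixes f :: "real ^ 'n::finite \<Rightarrow> real"
  assumes [measurable]: "f \<in> borel_measurable borel" and t: "0 \<le> t"
  shows "heat t f x = (\<integral>z. f (x + sqrt t *\<^sub>R z) \<partial>gauss)"
proof (cases "t = 0")
  case True
  then show ?thesis by (simp add: heat_def)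
next
  case False
  with t have t: "t > 0" by simp
  have "(\<integral>y. exp (- (norm (x - y))\<^sup>2 / (4 * t)) * f y \<partial>lborel) =
      (\<integral>y. exp (- (norm (x - y))\<^sup>2 / (4 * t)) * f y
         \<partial>density (distr lborel borel (\<lambda>z. x + sqrt t *\<^sub>R z)) (\<lambda>_. \<bar>sqrt t\<bar> ^ DIM(real ^ 'n)))"
    using lborel_affine[of "sqrt t" x] t by simp
  also have "\<dots> = (\<integral>z. sqrt t ^ CARD('n) * (exp (- (norm z)\<^sup>2 / 4) * f (x + sqrt t *\<^sub>R z)) \<partial>lborel)"
  proof -
    have "(norm (x - (x + sqrt t *\<^sub>R z)))\<^sup>2 / (4 * t) = (norm z)\<^sup>2 / 4" for z :: "real ^ 'n"
      using t by (simp add: power_mult_distrib)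
    then have e: "(sqrt t * norm z)\<^sup>2 / (4 * t) = (norm z)\<^sup>2 / 4" for z :: "real ^ 'n"
      using t by simp
    show ?thesis
      using t by (simp add: integral_density integral_distr e)
  qed
  also have "\<dots> = sqrt t ^ CARD('n) * (\<integral>z. exp (- (norm z)\<^sup>2 / 4) * f (x + sqrt t *\<^sub>R z) \<partial>lborel)"
    by simp
  finally have 1: "heat t f x = (4 * pi * t) powr (- real CARD('n) / 2) * sqrt t ^ CARD('n) *
      (\<integral>z. exp (- (norm z)\<^sup>2 / 4) * f (x + sqrt t *\<^sub>R z) \<partial>lborel)"
    using t by (simp add: heat_def)
  have "sqrt t ^ CARD('n) = t powr (real CARD('n) / 2)"
    using t by (simp add: powr_half_sqrt[symmetric] powr_power)
  then have 2: "(4 * pi * t) powr (- real CARD('n) / 2) * sqrt t ^ CARD('n) = (4 * pi) powr (- real CARD('n) / 2)"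
    using t by (simp add: powr_mult powr_minus field_simps)
  show ?thesis
    unfolding 1 2 gauss_def
    by (subst integral_density) (auto simp: mult.assoc)
qed


section \<open>The heat semigroup on continuous functions vanishing at infinity\<close>

text \<open>
  Negative times act like time 0. The flow is then continuous in time on the whole line, and an
  integral whose upper limit is the time can be written over a fixed interval.
\<close>

definition heat_flow :: "real \<Rightarrow> ((real ^ 'n::finite) \<Rightarrow>\<^sub>C real) \<Rightarrow> ((real ^ 'n) \<Rightarrow>\<^sub>C real)" where
  "heat_flow t f = Bcontfun (heat (max 0 t) f)"

lemma measurable_bcontfun [measurable]:
  "apply_bcontfun (f :: (real ^ 'n::finite) \<Rightarrow>\<^sub>C real) \<in> borel_measurable borel"
  by (intro borel_measurable_continuous_onI) simp

lemma integrable_gauss_bcontfun [simp]: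
  "integrable gauss (\<lambda>z. apply_bcontfun f (x + a *\<^sub>R z :: real ^ 'n::finite) :: real)"
  by (rule gauss.integrable_const_bound[where B = "norm f"])
    (use norm_bounded[of f] in \<open>auto simp: measurable_compose[OF _ measurable_bcontfun]\<close>)

lemma continuous_gauss_average:
  "continuous_on UNIV (\<lambda>x. \<integral>z. apply_bcontfun f (x + a *\<^sub>R z :: real ^ 'n::finite) \<partial>gauss :: real)"
proof (rule continuous_on_sequentiallyI)
  fix X and x :: "real ^ 'n" assume X: "X \<longlonglongrightarrow> x"
  show "(\<lambda>n. \<integral>z. apply_bcontfun f (X n + a *\<^sub>R z) \<partial>gauss) \<longlonglongrightarrow> (\<integral>z. apply_bcontfun f (x + a *\<^sub>R z) \<partial>gauss)"
  proof (rule integral_dominated_convergence[where w = "\<lambda>_. norm f"])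
    have "isCont (apply_bcontfun f) y" for y
      using continuous_on_interior[OF continuous_on_apply_bcontfun[of UNIV f], of y] by simp
    then have "(\<lambda>n. apply_bcontfun f (X n + a *\<^sub>R z)) \<longlonglongrightarrow> apply_bcontfun f (x + a *\<^sub>R z)" for z
      by (rule isCont_tendsto_compose) (intro tendsto_intros X)
    then show "AE z in gauss. (\<lambda>n. apply_bcontfun f (X n + a *\<^sub>R z)) \<longlonglongrightarrow> apply_bcontfun f (x + a *\<^sub>R z)"
      by simp
  qed (use norm_bounded[of f] in \<open>auto simp: measurable_compose[OF _ measurable_bcontfun]\<close>)
qed

lemma abs_gauss_average_le:
  fixes f :: "(real ^ 'n::finite) \<Rightarrow>\<^sub>C real"
  shows "\<bar>\<integral>z. f (x + a *\<^sub>R z) \<partial>gauss\<bar> \<le> norm f"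
proof -
  have "\<bar>\<integral>z. f (x + a *\<^sub>R z) \<partial>gauss\<bar> \<le> (\<integral>z. \<bar>f (x + a *\<^sub>R z)\<bar> \<partial>gauss)"
    by (rule integral_abs_bound)
  also have "\<dots> \<le> norm f"
    by (rule gauss.integral_le_const) (use norm_bounded[of f] in auto)
  finally show ?thesis .
qed

lemma heat_flow_eq_gauss:
  "apply_bcontfun (heat_flow t f) x = (\<integral>z. apply_bcontfun f (x + sqrt (max 0 t) *\<^sub>R z) \<partial>gauss)"
proof -
  have eq: "heat (max 0 t) f = (\<lambda>x. \<integral>z. apply_bcontfun f (x + sqrt (max 0 t) *\<^sub>R z) \<partial>gauss)"
    by (intro ext heat_eq_gauss) auto
  have "heat (max 0 t) f \<in> bcontfun"
    unfolding eq real_norm_def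
    by (rule bcontfun_normI[OF continuous_gauss_average]) (use abs_gauss_average_le in auto)
  then show ?thesis
    by (simp add: heat_flow_def Bcontfun_inverse eq)
qed

lemma heat_flow_eq_heat:
  "0 \<le> t \<Longrightarrow> apply_bcontfun (heat_flow t f) x = heat t f x"
  by (simp add: heat_flow_eq_gauss heat_eq_gauss max_def)

lemma heat_flow_nonpos [simp]: "t \<le> 0 \<Longrightarrow> heat_flow t f = f"
  by (rule bcontfun_eqI) (simp add: heat_flow_eq_gauss)

lemma norm_heat_flow_le: "norm (heat_flow t f) \<le> norm f"
  by (rule norm_bound) (simp add: heat_flow_eq_gauss abs_gauss_average_le)

lemma bounded_linear_heat_flow: "bounded_linear (heat_flow t)"
proof (rule bounded_linear_intro)
  show "norm (heat_flow t f) \<le> norm f * 1" for f :: "(real ^ 'n::finite) \<Rightarrow>\<^sub>C real"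
    using norm_heat_flow_le by simp
qed (auto intro!: bcontfun_eqI simp: heat_flow_eq_gauss)

lemma heat_flow_diff: "heat_flow t (f - g) = heat_flow t f - heat_flow t g"
  by (rule linear_diff[OF bounded_linear.linear[OF bounded_linear_heat_flow]])

lemma heat_flow_add: "heat_flow t (f + g) = heat_flow t f + heat_flow t g"
  by (rule linear_add[OF bounded_linear.linear[OF bounded_linear_heat_flow]])

lemma heat_flow_scaleR: "heat_flow t (c *\<^sub>R f) = c *\<^sub>R heat_flow t f"
  by (rule linear_scale[OF bounded_linear.linear[OF bounded_linear_heat_flow]])

lemma heat_flow_mono:
  assumes "\<And>x. apply_bcontfun f x \<le> apply_bcontfun g x"
  shows "apply_bcontfun (heat_flow t f) x \<le> apply_bcontfun (heat_flow t g) x"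
  unfolding heat_flow_eq_gauss by (intro integral_mono) (auto simp: assms)

text \<open>
  For \<open>p > 0\<close> this is the function \<open>x \<mapsto> |f x| powr p\<close>; for other exponents that function need not be
  continuous where \<open>f\<close> vanishes.
\<close>

definition abs_powr :: "real \<Rightarrow> ((real ^ 'n::finite) \<Rightarrow>\<^sub>C real) \<Rightarrow> ((real ^ 'n) \<Rightarrow>\<^sub>C real)" where
  "abs_powr p f = Bcontfun (\<lambda>x. \<bar>apply_bcontfun f x\<bar> powr p)"

lemma abs_powr_apply [simp]:
  assumes "0 < p"
  shows "apply_bcontfun (abs_powr p f) x = \<bar>apply_bcontfun f x\<bar> powr p"
proof -
  have "(\<lambda>x. \<bar>apply_bcontfun f x\<bar> powr p) \<in> bcontfun"
  proof (rule bcontfun_normI)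
    show "continuous_on UNIV (\<lambda>x. \<bar>apply_bcontfun f x\<bar> powr p)"
      using assms by (intro continuous_on_powr' continuous_intros) auto
    show "norm (\<bar>apply_bcontfun f x\<bar> powr p) \<le> norm f powr p" for x
      using assms norm_bounded[of f x] by (simp add: powr_mono2)
  qed
  then show ?thesis by (simp add: abs_powr_def Bcontfun_inverse)
qed

lemma abs_heat_flow_le:
  "\<bar>apply_bcontfun (heat_flow t f) x\<bar> \<le> apply_bcontfun (heat_flow t (abs_powr 1 f)) x"
  unfolding heat_flow_eq_gauss using integral_abs_bound[of gauss "\<lambda>z. apply_bcontfun f (x + sqrt (max 0 t) *\<^sub>R z)"] by simp

lemma heat_flow_abs_powr_nonneg:
  "0 < p \<Longrightarrow> 0 \<le> apply_bcontfun (heat_flow t (abs_powr p f)) x"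
  unfolding heat_flow_eq_gauss by (intro integral_nonneg_AE) simp

text \<open>
  Jensen's inequality for the Gaussian average: integrate the tangent inequality at the mean.
\<close>

lemma heat_flow_Jensen:
  assumes "0 < a" "1 \<le> r"
  shows "apply_bcontfun (heat_flow t (abs_powr a f)) x powr r \<le> apply_bcontfun (heat_flow t (abs_powr (a * r) f)) x"
proof -
  define Y where "Y = (\<lambda>z. apply_bcontfun (abs_powr a f) (x + sqrt (max 0 t) *\<^sub>R z))"
  define m where "m = (\<integral>z. Y z \<partial>gauss)"
  have Y: "integrable gauss Y" "\<And>z. Y z \<ge> 0"
    using assms unfolding Y_def by (auto simp del: abs_powr_apply) simp
  have Yr: "Y z powr r = apply_bcontfun (abs_powr (a * r) f) (x + sqrt (max 0 t) *\<^sub>R z)" for z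
    using assms by (simp add: Y_def powr_powr)
  have m: "m \<ge> 0" using Y unfolding m_def by (intro integral_nonneg_AE) auto
  have "m powr r = (\<integral>z. m powr r + r * m powr (r - 1) * (Y z - m) \<partial>gauss)"
    using Y by (simp add: m_def[symmetric])
  also have "\<dots> \<le> (\<integral>z. Y z powr r \<partial>gauss)"
  proof (rule integral_mono)
    show "integrable gauss (\<lambda>z. Y z powr r)" unfolding Yr by simp
  qed (use Y m assms powr_above_tangent in auto)
  finally show ?thesis
    unfolding m_def heat_flow_eq_gauss Y_def[symmetric] Yr .
qed

lemma C0_tendsto: "f \<in> C0 \<Longrightarrow> (apply_bcontfun f \<longlongrightarrow> 0) at_infinity"
  by (simp add: C0_def)

lemma C0_iff: "f \<in> C0 \<longleftrightarrow> (\<forall>e>0. \<exists>R. \<forall>x. R \<le> norm x \<longrightarrow> \<bar>apply_bcontfun f x\<bar> < e)"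
  by (simp add: C0_def tendsto_iff eventually_at_infinity)

lemma C0_zero [simp, intro]: "0 \<in> C0"
  by (simp add: C0_def)

lemma C0_add [intro]: "f \<in> C0 \<Longrightarrow> g \<in> C0 \<Longrightarrow> f + g \<in> C0"
  using tendsto_add[of "apply_bcontfun f" 0 at_infinity "apply_bcontfun g" 0] by (simp add: C0_def plus_bcontfun.rep_eq[abs_def])

lemma C0_scaleR [intro]: "f \<in> C0 \<Longrightarrow> c *\<^sub>R f \<in> C0"
  using tendsto_mult_right_zero[of "apply_bcontfun f" at_infinity c] by (simp add: C0_def scaleR_bcontfun.rep_eq[abs_def])

lemma C0_diff [intro]: "f \<in> C0 \<Longrightarrow> g \<in> C0 \<Longrightarrow> f - g \<in> C0"
  using tendsto_diff[of "apply_bcontfun f" 0 at_infinity "apply_bcontfun g" 0] by (simp add: C0_def minus_bcontfun.rep_eq[abs_def])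

lemma closed_C0: "closed (C0 :: ((real ^ 'n::finite) \<Rightarrow>\<^sub>C real) set)"
proof -
  have "f \<in> C0" if "f \<in> closure C0" for f :: "(real ^ 'n) \<Rightarrow>\<^sub>C real"
    unfolding C0_iff
  proof (intro allI impI)
    fix e :: real assume "e > 0"
    then have e: "e / 2 > 0" by simp
    with that obtain g where g: "g \<in> C0" "dist g f < e / 2"
      unfolding closure_approachable by blast
    then obtain R where R: "\<And>x. R \<le> norm x \<Longrightarrow> \<bar>apply_bcontfun g x\<bar> < e / 2"
      using e unfolding C0_iff by blast
    have "\<bar>apply_bcontfun f x\<bar> < e" if "R \<le> norm x" for x
      using R[OF that] g(2) dist_bounded[of g x f] by (simp add: dist_real_def)
    then show "\<exists>R. \<forall>x. R \<le> norm x \<longrightarrow> \<bar>apply_bcontfun f x\<bar> < e" by blast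
  qed
  then show ?thesis
    using closure_subset_eq[of "C0 :: ((real ^ 'n) \<Rightarrow>\<^sub>C real) set"] by blast
qed

lemma C0_abs_powr [intro]: "f \<in> C0 \<Longrightarrow> 0 < p \<Longrightarrow> abs_powr p f \<in> C0"
proof -
  assume f: "f \<in> C0" and p: "0 < p"
  have "((\<lambda>x. \<bar>apply_bcontfun f x\<bar> powr p) \<longlongrightarrow> 0) at_infinity"
  proof (rule tendsto_zero_powrI)
    show "((\<lambda>x. \<bar>apply_bcontfun f x\<bar>) \<longlongrightarrow> 0) at_infinity"
      using C0_tendsto[OF f] by (rule tendsto_rabs_zero)
  qed (use p in auto)
  moreover have "apply_bcontfun (abs_powr p f) = (\<lambda>x. \<bar>apply_bcontfun f x\<bar> powr p)"
    using p by auto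
  ultimately show ?thesis by (simp add: C0_def)
qed

text \<open>
  Along a sequence of points tending to infinity the integrand of the Gaussian average tends to 0
  for every fixed \<open>z\<close> and is dominated by the norm of \<open>f\<close>.
\<close>

lemma C0_heat_flow [intro]:
  fixes f :: "(real ^ 'n::finite) \<Rightarrow>\<^sub>C real"
  assumes f: "f \<in> C0"
  shows "heat_flow t f \<in> C0"
  unfolding C0_iff
proof (intro allI impI, rule ccontr)
  fix e :: real assume e: "e > 0" and "\<not> (\<exists>R. \<forall>x. R \<le> norm x \<longrightarrow> \<bar>apply_bcontfun (heat_flow t f) x\<bar> < e)"
  then have "\<forall>n::nat. \<exists>x. real n \<le> norm x \<and> e \<le> \<bar>apply_bcontfun (heat_flow t f) x\<bar>"
    by (meson not_less)
  then obtain X where X: "\<And>n::nat. real n \<le> norm (X n)" "\<And>n. e \<le> \<bar>apply_bcontfun (heat_flow t f) (X n)\<bar>"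
    by metis
  have lim: "filterlim X at_infinity sequentially"
    unfolding filterlim_at_infinity_conv_norm_at_top
    by (rule filterlim_at_top_mono[OF filterlim_real_sequentially]) (simp add: X)
  have "(\<lambda>n. \<integral>z. apply_bcontfun f (X n + sqrt (max 0 t) *\<^sub>R z) \<partial>gauss) \<longlonglongrightarrow> (\<integral>z. 0 \<partial>(gauss :: (real ^ 'n) measure))"
  proof (rule integral_dominated_convergence[where w = "\<lambda>_. norm f"])
    have "(\<lambda>n. apply_bcontfun f (X n + sqrt (max 0 t) *\<^sub>R z)) \<longlonglongrightarrow> 0" for z
      by (rule filterlim_compose[OF C0_tendsto[OF f]], rule tendsto_add_filterlim_at_infinity'[OF lim tendsto_const])
    then show "AE z in gauss. (\<lambda>n. apply_bcontfun f (X n + sqrt (max 0 t) *\<^sub>R z)) \<longlonglongrightarrow> 0" by simp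
  qed (use norm_bounded[of f] in \<open>auto simp: measurable_compose[OF _ measurable_bcontfun]\<close>)
  then have "(\<lambda>n. apply_bcontfun (heat_flow t f) (X n)) \<longlonglongrightarrow> 0"
    by (simp add: heat_flow_eq_gauss)
  then have "\<forall>\<^sub>F n in sequentially. \<bar>apply_bcontfun (heat_flow t f) (X n)\<bar> < e"
    using e by (auto simp: tendsto_iff)
  then show False
    using X(2) by (auto simp: eventually_sequentially) (meson not_less order_refl)
qed

lemma C0_uniformly_continuous:
  fixes f :: "(real ^ 'n::finite) \<Rightarrow>\<^sub>C real"
  assumes f: "f \<in> C0" and e: "e > 0"
  obtains \<delta> where "\<delta> > 0" "\<And>x y. dist x y < \<delta> \<Longrightarrow> \<bar>apply_bcontfun f x - apply_bcontfun f y\<bar> < e"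
proof -
  from f e obtain R where R: "\<And>x. R \<le> norm x \<Longrightarrow> \<bar>apply_bcontfun f x\<bar> < e / 2"
    unfolding C0_iff by (meson half_gt_zero)
  have "uniformly_continuous_on (cball 0 (R + 1)) (apply_bcontfun f)"
    by (intro compact_uniformly_continuous) auto
  then obtain d where d: "d > 0" "\<And>x y. x \<in> cball 0 (R + 1) \<Longrightarrow> y \<in> cball 0 (R + 1) \<Longrightarrow> dist y x < d \<Longrightarrow>
      dist (apply_bcontfun f y) (apply_bcontfun f x) < e"
    using e unfolding uniformly_continuous_on_def by metis
  show ?thesis
  proof (rule that[of "min d 1"])
    fix x y :: "real ^ 'n" assume xy: "dist x y < min d 1"
    show "\<bar>apply_bcontfun f x - apply_bcontfun f y\<bar> < e"
    proof (cases "norm x \<le> R \<or> norm y \<le> R")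
      case True
      then have "norm x \<le> R + 1" "norm y \<le> R + 1"
        using xy norm_triangle_ineq2[of x y] norm_triangle_ineq2[of y x] by (auto simp: dist_norm norm_minus_commute)
      then show ?thesis using d(2)[of y x] xy by (auto simp: dist_real_def)
    next
      case False
      then show ?thesis using R[of x] R[of y] by linarith
    qed
  qed (use d in auto)
qed

text \<open>
  The second moment controls how far the Gaussian average reaches, which is needed for continuity
  in time.
\<close>

lemma integrable_gauss_norm_square: "integrable gauss (\<lambda>z :: real ^ 'n::finite. (norm z)\<^sup>2)"
proof -
  let ?c = "(4 * pi) powr (- real CARD('n) / 2)"
  have k: "integrable lborel (\<lambda>z. exp (- (norm (z :: real ^ 'n))\<^sup>2 / 8))"
    using integrable_heat_kernel[of 2 "0 :: real ^ 'n"] by (simp add: heat_kernel_def[abs_def])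
  have "integrable lborel (\<lambda>z :: real ^ 'n. exp (- (norm z)\<^sup>2 / 4) * (norm z)\<^sup>2)"
  proof (rule Bochner_Integration.integrable_bound[OF integrable_mult_right[OF k, of 8]])
    have "exp (- (norm z)\<^sup>2 / 4) * (norm z)\<^sup>2 \<le> 8 * exp (- (norm z)\<^sup>2 / 8)" for z :: "real ^ 'n"
    proof -
      define a where "a = (norm z)\<^sup>2 / 8"
      have "a * exp (- a) \<le> 1"
      proof -
        have "a \<le> exp a" using exp_ge_add_one_self[of a] by linarith
        then show ?thesis by (simp add: exp_minus field_simps)
      qed
      then have "8 * exp (- a) * (a * exp (- a)) \<le> 8 * exp (- a) * 1"
        by (intro mult_left_mono) auto
      moreover have "exp (- (norm z)\<^sup>2 / 4) = exp (- a) * exp (- a)"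
        by (simp add: exp_add[symmetric] a_def)
      ultimately show ?thesis
        by (simp add: a_def algebra_simps)
    qed
    then show "AE z in lborel. norm (exp (- (norm z)\<^sup>2 / 4) * (norm z)\<^sup>2) \<le> norm (8 * exp (- (norm (z :: real ^ 'n))\<^sup>2 / 8))"
      by auto
  qed simp
  then have "integrable lborel (\<lambda>z :: real ^ 'n. ?c * (exp (- (norm z)\<^sup>2 / 4) * (norm z)\<^sup>2))"
    by (rule integrable_mult_right)
  then show ?thesis
    unfolding gauss_def by (subst integrable_density) (auto simp: mult.assoc)
qed

text \<open>
  The difference of the flows at times \<open>t\<close> and \<open>s\<close> averages the difference of \<open>f\<close> at two points at
  distance \<open>|sqrt t - sqrt s| * norm z\<close>. Uniform continuity of \<open>f\<close> handles distances below \<open>d\<close>; for larger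
  ones the trivial bound \<open>2 * norm f\<close> is multiplied by the square of the distance divided by \<open>d\<close>,
  whose average is a multiple of the second moment.
\<close>

lemma heat_flow_strongly_continuous:
  fixes f :: "(real ^ 'n::finite) \<Rightarrow>\<^sub>C real"
  assumes f: "f \<in> C0"
  shows "continuous_on UNIV (\<lambda>t. heat_flow t f)"
proof (unfold continuous_on_def, intro ballI)
  fix s :: real
  let ?r = "\<lambda>t::real. sqrt (max 0 t)"
  define M where "M = (\<integral>z. (norm (z :: real ^ 'n))\<^sup>2 \<partial>gauss)"
  have "((\<lambda>t. heat_flow t f) \<longlongrightarrow> heat_flow s f) (at s)"
  proof (rule tendstoI)
    fix e :: real assume e: "e > 0"
    obtain d where d: "d > 0" "\<And>x y. dist x y < d \<Longrightarrow> \<bar>apply_bcontfun f x - apply_bcontfun f y\<bar> < e / 2"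
      using C0_uniformly_continuous[OF f, of "e / 2"] e by (metis half_gt_zero)
    have bound: "dist (heat_flow t f) (heat_flow s f) \<le> e / 2 + 2 * norm f / d\<^sup>2 * M * (?r t - ?r s)\<^sup>2" for t
      unfolding dist_norm
    proof (rule norm_bound)
      fix x
      let ?q = "\<lambda>z :: real ^ 'n. e / 2 + 2 * norm f / d\<^sup>2 * (?r t - ?r s)\<^sup>2 * (norm z)\<^sup>2"
      have pt: "\<bar>apply_bcontfun f (x + ?r t *\<^sub>R z) - apply_bcontfun f (x + ?r s *\<^sub>R z)\<bar> \<le> ?q z" for z
      proof (cases "\<bar>?r t - ?r s\<bar> * norm z < d")
        case True
        then have "dist (x + ?r t *\<^sub>R z) (x + ?r s *\<^sub>R z) < d"
          by (simp add: dist_norm scaleR_diff_left[symmetric])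
        then have "\<bar>apply_bcontfun f (x + ?r t *\<^sub>R z) - apply_bcontfun f (x + ?r s *\<^sub>R z)\<bar> < e / 2"
          by (rule d(2))
        moreover have "0 \<le> 2 * norm f / d\<^sup>2 * (?r t - ?r s)\<^sup>2 * (norm z)\<^sup>2" by simp
        ultimately show ?thesis by linarith
      next
        case False
        then have "d\<^sup>2 \<le> (\<bar>?r t - ?r s\<bar> * norm z)\<^sup>2"
          using d(1) by (intro power_mono) auto
        then have "1 \<le> (?r t - ?r s)\<^sup>2 * (norm z)\<^sup>2 / d\<^sup>2"
          using d(1) by (simp add: power_mult_distrib)
        then have "2 * norm f * 1 \<le> 2 * norm f * ((?r t - ?r s)\<^sup>2 * (norm z)\<^sup>2 / d\<^sup>2)"
          by (intro mult_left_mono) auto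
        moreover have "\<bar>apply_bcontfun f (x + ?r t *\<^sub>R z) - apply_bcontfun f (x + ?r s *\<^sub>R z)\<bar> \<le> 2 * norm f"
          using norm_bounded[of f "x + ?r t *\<^sub>R z"] norm_bounded[of f "x + ?r s *\<^sub>R z"] by simp
        moreover have "2 * norm f * ((?r t - ?r s)\<^sup>2 * (norm z)\<^sup>2 / d\<^sup>2) = 2 * norm f / d\<^sup>2 * (?r t - ?r s)\<^sup>2 * (norm z)\<^sup>2"
          by simp
        ultimately show ?thesis using e by linarith
      qed
      have "\<bar>\<integral>z. apply_bcontfun f (x + ?r t *\<^sub>R z) - apply_bcontfun f (x + ?r s *\<^sub>R z) \<partial>gauss\<bar>
          \<le> (\<integral>z. \<bar>apply_bcontfun f (x + ?r t *\<^sub>R z) - apply_bcontfun f (x + ?r s *\<^sub>R z)\<bar> \<partial>gauss)"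
        by (rule integral_abs_bound)
      also have "\<dots> \<le> (\<integral>z. ?q z \<partial>gauss)"
      proof (rule integral_mono)
        show "integrable gauss ?q"
          by (intro Bochner_Integration.integrable_add gauss.integrable_const integrable_mult_right integrable_gauss_norm_square)
      qed (use pt in auto)
      also have "\<dots> = e / 2 + 2 * norm f / d\<^sup>2 * M * (?r t - ?r s)\<^sup>2"
        using integrable_gauss_norm_square[where 'n = 'n] by (simp add: M_def)
      finally show "norm (apply_bcontfun (heat_flow t f - heat_flow s f) x)
          \<le> e / 2 + 2 * norm f / d\<^sup>2 * M * (?r t - ?r s)\<^sup>2"
        by (simp add: heat_flow_eq_gauss)
    qed
    have "((\<lambda>t. e / 2 + 2 * norm f / d\<^sup>2 * M * (?r t - ?r s)\<^sup>2) \<longlongrightarrow> e / 2 + 2 * norm f / d\<^sup>2 * M * (?r s - ?r s)\<^sup>2) (at s)"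
      by (intro tendsto_intros)
    then have "\<forall>\<^sub>F t in at s. e / 2 + 2 * norm f / d\<^sup>2 * M * (?r t - ?r s)\<^sup>2 < e"
      by (rule order_tendstoD(2)) (use e in simp)
    then show "\<forall>\<^sub>F t in at s. dist (heat_flow t f) (heat_flow s f) < e"
      by (rule eventually_mono) (use bound in \<open>meson le_less_trans\<close>)
  qed
  then show "((\<lambda>t. heat_flow t f) \<longlongrightarrow> heat_flow s f) (at s within UNIV)" by simp
qed

text \<open>
  Joint continuity in time and function: contractivity makes the continuity in the function
  uniform in time.
\<close>

lemma continuous_on_heat_flow [continuous_intros]:
  fixes F :: "'a::topological_space \<Rightarrow> (real ^ 'n::finite) \<Rightarrow>\<^sub>C real"
  assumes t: "continuous_on S t" and F: "continuous_on S F" and C0: "\<And>s. s \<in> S \<Longrightarrow> F s \<in> C0"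
  shows "continuous_on S (\<lambda>s. heat_flow (t s) (F s))"
  unfolding continuous_on_def
proof
  fix s assume s: "s \<in> S"
  have "isCont (\<lambda>r. heat_flow r (F s)) (t s)"
    using heat_flow_strongly_continuous[OF C0[OF s]] continuous_on_eq_continuous_at[OF open_UNIV] by blast
  then have 1: "((\<lambda>r. heat_flow (t r) (F s)) \<longlongrightarrow> heat_flow (t s) (F s)) (at s within S)"
    using t s by (auto simp: continuous_on_def intro: isCont_tendsto_compose)
  have "((\<lambda>r. heat_flow (t r) (F r - F s)) \<longlongrightarrow> 0) (at s within S)"
  proof (rule Lim_null_comparison)
    show "\<forall>\<^sub>F r in at s within S. norm (heat_flow (t r) (F r - F s)) \<le> norm (F r - F s)"
      by (simp add: norm_heat_flow_le)
    show "((\<lambda>r. norm (F r - F s)) \<longlongrightarrow> 0) (at s within S)"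
      using F s by (simp add: continuous_on_def LIM_zero tendsto_norm_zero)
  qed
  then have "((\<lambda>r. heat_flow (t r) (F r - F s) + heat_flow (t r) (F s)) \<longlongrightarrow> 0 + heat_flow (t s) (F s)) (at s within S)"
    using 1 by (rule tendsto_add)
  then show "((\<lambda>r. heat_flow (t r) (F r)) \<longlongrightarrow> heat_flow (t s) (F s)) (at s within S)"
    by (simp add: heat_flow_diff)
qed

lemma nn_integral_lborel_shift:
  fixes c :: "real ^ 'n::finite"
  assumes [measurable]: "g \<in> borel_measurable borel"
  shows "(\<integral>\<^sup>+ x. g (x + c) \<partial>lborel) = (\<integral>\<^sup>+ x. g x \<partial>lborel)"
proof -
  have "(\<integral>\<^sup>+ x. g x \<partial>lborel) = (\<integral>\<^sup>+ x. g x \<partial>(distr lborel borel ((+) c)))"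
    by (simp add: lborel_distr_plus)
  also have "\<dots> = (\<integral>\<^sup>+ x. g (x + c) \<partial>lborel)"
    by (subst nn_integral_distr) (auto simp: add.commute)
  finally show ?thesis by simp
qed

text \<open>
  Mass is preserved, by Tonelli and translation invariance of Lebesgue measure.
\<close>

lemma nn_integral_heat_flow:
  fixes f :: "(real ^ 'n::finite) \<Rightarrow>\<^sub>C real"
  assumes f: "\<And>x. 0 \<le> apply_bcontfun f x"
  shows "(\<integral>\<^sup>+ x. ennreal (apply_bcontfun (heat_flow t f) x) \<partial>lborel) = (\<integral>\<^sup>+ x. ennreal (apply_bcontfun f x) \<partial>lborel)"
proof -
  interpret pair_sigma_finite lborel "gauss :: (real ^ 'n) measure" ..
  let ?a = "sqrt (max 0 t)"
  have "(\<integral>\<^sup>+ x. ennreal (apply_bcontfun (heat_flow t f) x) \<partial>lborel)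
      = (\<integral>\<^sup>+ x. (\<integral>\<^sup>+ z. ennreal (apply_bcontfun f (x + ?a *\<^sub>R z)) \<partial>gauss) \<partial>lborel)"
    unfolding heat_flow_eq_gauss using f by (intro nn_integral_cong, subst nn_integral_eq_integral) auto
  also have "\<dots> = (\<integral>\<^sup>+ z. (\<integral>\<^sup>+ x. ennreal (apply_bcontfun f (x + ?a *\<^sub>R z)) \<partial>lborel) \<partial>gauss)"
    by (rule Fubini'[symmetric]) (simp add: measurable_compose[OF _ measurable_bcontfun] split_beta')
  also have "\<dots> = (\<integral>\<^sup>+ z. (\<integral>\<^sup>+ x. ennreal (apply_bcontfun f x) \<partial>lborel) \<partial>(gauss :: (real ^ 'n) measure))"
    by (intro nn_integral_cong nn_integral_lborel_shift[where g = "\<lambda>x. ennreal (apply_bcontfun f x)"]) simp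
  also have "\<dots> = (\<integral>\<^sup>+ x. ennreal (apply_bcontfun f x) \<partial>lborel)"
    using gauss.emeasure_space_1[where 'n = 'n] by simp
  finally show ?thesis .
qed

text \<open>
  The heat kernel at time \<open>t\<close> is bounded by its value on the diagonal.
\<close>

lemma heat_flow_le_integral:
  fixes f :: "(real ^ 'n::finite) \<Rightarrow>\<^sub>C real"
  assumes t: "0 < t" and f: "\<And>x. 0 \<le> apply_bcontfun f x"
    and c: "(\<integral>\<^sup>+ x. ennreal (apply_bcontfun f x) \<partial>lborel) \<le> ennreal c" and "0 \<le> c"
  shows "apply_bcontfun (heat_flow t f) x \<le> (4 * pi * t) powr (- real CARD('n) / 2) * c"
proof -
  have f_int: "integrable lborel (apply_bcontfun f)"
    using c f by (intro integrableI_nonneg) (auto simp: order_le_less_trans)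
  have "(\<integral>y. apply_bcontfun f y \<partial>lborel) \<le> c"
    using c f f_int \<open>0 \<le> c\<close> by (subst (asm) nn_integral_eq_integral) auto
  moreover have "(\<integral>y. exp (- (norm (x - y))\<^sup>2 / (4 * t)) * apply_bcontfun f y \<partial>lborel) \<le> (\<integral>y. apply_bcontfun f y \<partial>lborel)"
  proof (rule integral_mono)
    show "exp (- (norm (x - y))\<^sup>2 / (4 * t)) * apply_bcontfun f y \<le> apply_bcontfun f y" for y
      using t f[of y] by (intro mult_left_le_one_le) auto
    then show "integrable lborel (\<lambda>y. exp (- (norm (x - y))\<^sup>2 / (4 * t)) * apply_bcontfun f y)"
      using f by (intro Bochner_Integration.integrable_bound[OF f_int]) auto
  qed (rule f_int)
  ultimately show ?thesis
    using t by (simp add: heat_flow_eq_heat heat_def mult_left_mono)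
qed


lemma heat_kernel_integrable_times:
  assumes "0 < t" and [measurable]: "g \<in> borel_measurable borel" and "\<And>y. \<bar>g y\<bar> \<le> B"
  shows "integrable lborel (\<lambda>y. heat_kernel t x y * g y)"
proof (rule Bochner_Integration.integrable_bound[OF integrable_mult_left[OF integrable_heat_kernel[OF assms(1), of x], of B]])
  show "AE y in lborel. norm (heat_kernel t x y * g y) \<le> norm (heat_kernel t x y * B)"
    using assms(3) by (auto simp: abs_mult intro!: mult_left_mono AE_I2 order_trans[OF assms(3)])
qed measurable

lemma heat_eq_kernel: "0 < t \<Longrightarrow> heat t f x = (\<integral>y. heat_kernel t x y * f y \<partial>lborel)"
  by (simp add: heat_def heat_kernel_def mult.assoc)

text \<open>
  Completing the square in \<open>z\<close>: the product of two kernels is the kernel at the sum of the times,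
  multiplied by a probability density in \<open>z\<close>.
\<close>

lemma heat_kernel_mult:
  fixes x y z :: "real ^ 'n::finite"
  assumes a: "0 < a" and b: "0 < b"
  shows "heat_kernel a x z * heat_kernel b z y =
    heat_kernel (a + b) x y * heat_kernel (a * b / (a + b)) ((b / (a + b)) *\<^sub>R x + (a / (a + b)) *\<^sub>R y) z"
proof -
  define u v where "u = x - z" and "v = z - y"
  have xy: "x - y = u + v" by (simp add: u_def v_def)
  have z0: "(b / (a + b)) *\<^sub>R x + (a / (a + b)) *\<^sub>R y - z = (1 / (a + b)) *\<^sub>R (b *\<^sub>R u - a *\<^sub>R v)"
  proof -
    have "z = (1 / (a + b)) *\<^sub>R ((a + b) *\<^sub>R z)" using a b by simp
    then show ?thesis
      by (simp add: u_def v_def algebra_simps divide_inverse)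
  qed
  have 1: "(norm u)\<^sup>2 / (4 * a) + (norm v)\<^sup>2 / (4 * b) =
      (norm (u + v))\<^sup>2 / (4 * (a + b)) + (norm ((1 / (a + b)) *\<^sub>R (b *\<^sub>R u - a *\<^sub>R v)))\<^sup>2 / (4 * (a * b / (a + b)))"
  proof -
    have e1: "(norm (u + v))\<^sup>2 = (norm u)\<^sup>2 + 2 * (u \<bullet> v) + (norm v)\<^sup>2"
      by (simp add: power2_norm_eq_inner inner_add_left inner_add_right inner_commute)
    have e2: "(norm ((1 / (a + b)) *\<^sub>R (b *\<^sub>R u - a *\<^sub>R v)))\<^sup>2 = (1 / (a + b))\<^sup>2 * (b\<^sup>2 * (norm u)\<^sup>2 - 2 * a * b * (u \<bullet> v) + a\<^sup>2 * (norm v)\<^sup>2)"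
    proof -
      have "(norm (b *\<^sub>R u - a *\<^sub>R v))\<^sup>2 = b\<^sup>2 * (norm u)\<^sup>2 - 2 * a * b * (u \<bullet> v) + a\<^sup>2 * (norm v)\<^sup>2"
        unfolding power2_norm_eq_inner inner_diff_left inner_diff_right inner_scaleR_left inner_scaleR_right
        by (simp add: inner_commute[of v u] power2_eq_square algebra_simps)
      then show ?thesis
        by (simp only: norm_scaleR power_mult_distrib power2_abs)
    qed
    have ring: "(b * U + a * V) * (a + b) = a * b * (U + 2 * W + V) + (b\<^sup>2 * U - 2 * a * b * W + a\<^sup>2 * V)" for U V W :: real
      by algebra
    have pos: "0 < a + b" "0 < a * b" using a b by auto
    have "(norm u)\<^sup>2 / (4 * a) + (norm v)\<^sup>2 / (4 * b) = ((b * (norm u)\<^sup>2 + a * (norm v)\<^sup>2) * (a + b)) / (4 * (a * b) * (a + b))"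
    proof -
      have "(norm u)\<^sup>2 / (4 * a) + (norm v)\<^sup>2 / (4 * b) = (b * (norm u)\<^sup>2 + a * (norm v)\<^sup>2) / (4 * (a * b))"
        using a b by (simp add: field_simps)
      then show ?thesis using pos by simp
    qed
    also have "\<dots> = (norm (u + v))\<^sup>2 / (4 * (a + b)) + (1 / (a + b))\<^sup>2 * (b\<^sup>2 * (norm u)\<^sup>2 - 2 * a * b * (u \<bullet> v) + a\<^sup>2 * (norm v)\<^sup>2) / (4 * (a * b / (a + b)))"
    proof -
      have r: "a * b * S / (4 * (a * b) * (a + b)) = S / (4 * (a + b))"
        "D / (4 * (a * b) * (a + b)) = (1 / (a + b))\<^sup>2 * D / (4 * (a * b / (a + b)))" for S D
        using pos a b by (simp_all add: power2_eq_square)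
      show ?thesis
        unfolding ring[of _ _ "u \<bullet> v"] e1[symmetric] add_divide_distrib[of "a * b * (norm (u + v))\<^sup>2"] r(1)
        by (simp only: r(2))
    qed
    finally show ?thesis unfolding e2 .
  qed
  have 2: "(4 * pi * a) powr (- real CARD('n) / 2) * (4 * pi * b) powr (- real CARD('n) / 2) =
      (4 * pi * (a + b)) powr (- real CARD('n) / 2) * (4 * pi * (a * b / (a + b))) powr (- real CARD('n) / 2)"
  proof -
    have "4 * pi * a * (4 * pi * b) = 4 * pi * (a + b) * (4 * pi * (a * b / (a + b)))"
      using a b by simp
    then show ?thesis
      using a b by (simp only: powr_mult[symmetric])
  qed
  have "heat_kernel a x z * heat_kernel b z y = ((4 * pi * a) powr (- real CARD('n) / 2) * (4 * pi * b) powr (- real CARD('n) / 2)) *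
      exp (- ((norm u)\<^sup>2 / (4 * a) + (norm v)\<^sup>2 / (4 * b)))"
    unfolding heat_kernel_def u_def[symmetric] v_def[symmetric] minus_add_distrib exp_add by simp
  also have "\<dots> = heat_kernel (a + b) x y * heat_kernel (a * b / (a + b)) ((b / (a + b)) *\<^sub>R x + (a / (a + b)) *\<^sub>R y) z"
    unfolding 1 2 heat_kernel_def xy z0 minus_add_distrib exp_add by simp
  finally show ?thesis .
qed

text \<open>
  Fubini moves the integral over the intermediate point inside, where \<open>heat_kernel_mult\<close>
  evaluates it.
\<close>

lemma heat_flow_semigroup:
  fixes f :: "(real ^ 'n::finite) \<Rightarrow>\<^sub>C real"
  assumes "0 \<le> a" "0 \<le> b"
  shows "heat_flow a (heat_flow b f) = heat_flow (a + b) f"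
proof (cases "a = 0 \<or> b = 0")
  case True
  then show ?thesis using assms by auto
next
  case False
  with assms have a: "0 < a" and b: "0 < b" by auto
  have fb: "\<bar>apply_bcontfun f y\<bar> \<le> norm f" for y using norm_bounded[of f y] by simp
  show ?thesis
  proof (rule bcontfun_eqI)
    fix x
    let ?g = "\<lambda>z y. heat_kernel a x z * (heat_kernel b z y * apply_bcontfun f y)"
    have inner: "(\<integral>y. norm (?g z y) \<partial>lborel) = heat_kernel a x z * heat b (\<lambda>y. \<bar>apply_bcontfun f y\<bar>) z" for z
      using b by (simp add: abs_mult heat_eq_kernel)
    have abs: "heat b (\<lambda>y. \<bar>apply_bcontfun f y\<bar>) = apply_bcontfun (heat_flow b (abs_powr 1 f))"
    proof -
      have "apply_bcontfun (abs_powr 1 f) = (\<lambda>y. \<bar>apply_bcontfun f y\<bar>)" by auto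
      then show ?thesis using b by (intro ext) (simp add: heat_flow_eq_heat)
    qed
    have int: "integrable (lborel \<Otimes>\<^sub>M lborel) (case_prod ?g)"
    proof (rule lborel_pair.Fubini_integrable)
      show "case_prod ?g \<in> borel_measurable (lborel \<Otimes>\<^sub>M lborel)"
        by (simp add: split_beta' measurable_compose[OF _ measurable_bcontfun])
      show "integrable lborel (\<lambda>z. \<integral>y. norm (case (z, y) of (z, y) \<Rightarrow> ?g z y) \<partial>lborel)"
        unfolding prod.case inner abs
        by (rule heat_kernel_integrable_times[OF a, where B = "norm (heat_flow b (abs_powr 1 f))"])
          (use norm_bounded in \<open>auto simp: real_norm_def[symmetric] simp del: real_norm_def\<close>)
      show "AE z in lborel. integrable lborel (\<lambda>y. case (z, y) of (z, y) \<Rightarrow> ?g z y)"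
        by (intro AE_I2, unfold prod.case, intro integrable_mult_right heat_kernel_integrable_times[OF b _ fb]) simp
    qed
    have "apply_bcontfun (heat_flow a (heat_flow b f)) x = (\<integral>z. (\<integral>y. ?g z y \<partial>lborel) \<partial>lborel)"
      using a b by (simp add: heat_flow_eq_heat heat_eq_kernel)
    also have "\<dots> = (\<integral>y. (\<integral>z. ?g z y \<partial>lborel) \<partial>lborel)"
      by (rule lborel_pair.Fubini_integral[symmetric, OF int])
    also have "\<dots> = (\<integral>y. heat_kernel (a + b) x y * apply_bcontfun f y \<partial>lborel)"
    proof (rule Bochner_Integration.integral_cong[OF refl])
      fix y
      have "(\<integral>z. ?g z y \<partial>lborel) = (\<integral>z. (heat_kernel (a + b) x y * apply_bcontfun f y) *
          heat_kernel (a * b / (a + b)) ((b / (a + b)) *\<^sub>R x + (a / (a + b)) *\<^sub>R y) z \<partial>lborel)"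
        by (intro Bochner_Integration.integral_cong refl, unfold mult.assoc[symmetric] heat_kernel_mult[OF a b])
          (simp only: mult_ac)
      then show "(\<integral>z. ?g z y \<partial>lborel) = heat_kernel (a + b) x y * apply_bcontfun f y"
        using a b by (simp add: integral_heat_kernel)
    qed
    also have "\<dots> = apply_bcontfun (heat_flow (a + b) f) x"
      using a b by (simp add: heat_flow_eq_heat heat_eq_kernel)
    finally show "apply_bcontfun (heat_flow a (heat_flow b f)) x = apply_bcontfun (heat_flow (a + b) f) x" .
  qed
qed

section \<open>The Duhamel operator\<close>

lemma bounded_linear_bcontfun_apply:
  "bounded_linear (\<lambda>f :: 'a::topological_space \<Rightarrow>\<^sub>C 'b::real_normed_vector. f x)"
  by (rule bounded_linear_intro[where K = 1]) (use norm_bounded in auto)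

lemma bcontfun_integral_apply:
  fixes F :: "real \<Rightarrow> (real ^ 'n::finite) \<Rightarrow>\<^sub>C real"
  assumes "F integrable_on S"
  shows "(\<lambda>s. F s x) integrable_on S" and "(integral S F) x = integral S (\<lambda>s. F s x)"
  using integrable_linear[OF assms bounded_linear_bcontfun_apply[of x]]
    integral_linear[OF assms bounded_linear_bcontfun_apply[of x]] by (simp_all add: o_def)

lemma C0_sum: "(\<And>i. i \<in> I \<Longrightarrow> f i \<in> C0) \<Longrightarrow> sum f I \<in> C0"
  by (induction I rule: infinite_finite_induct) auto

text \<open>
  The integral is a limit of Riemann sums, which lie in the closed subspace.
\<close>

lemma C0_integral:
  fixes F :: "real \<Rightarrow> (real ^ 'n::finite) \<Rightarrow>\<^sub>C real"
  assumes F: "F integrable_on {a..b}" and C0: "\<And>s. s \<in> {a..b} \<Longrightarrow> F s \<in> C0"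
  shows "integral {a..b} F \<in> C0"
proof -
  have "integral {a..b} F \<in> closure C0"
    unfolding closure_approachable
  proof (intro allI impI)
    fix e :: real assume "e > 0"
    have I: "(F has_integral integral {a..b} F) (cbox a b)"
      using F by (simp add: has_integral_integral)
    obtain \<gamma> where \<gamma>: "gauge \<gamma>" "\<And>D. D tagged_division_of (cbox a b) \<Longrightarrow> \<gamma> fine D \<Longrightarrow>
        norm ((\<Sum>(x, k)\<in>D. measure lborel k *\<^sub>R F x) - integral {a..b} F) < e"
      by (rule has_integralD[OF I \<open>e > 0\<close>]) blast
    obtain D where D: "D tagged_division_of {a..b}" "\<gamma> fine D"
      using fine_division_exists_real[OF \<gamma>(1)] by blast
    have "(\<Sum>(x, k)\<in>D. measure lborel k *\<^sub>R F x) \<in> C0"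
    proof (rule C0_sum)
      fix xk assume "xk \<in> D"
      then have "fst xk \<in> {a..b}"
        using tag_in_interval[OF D(1), of "fst xk" "snd xk"] by simp
      then show "(case xk of (x, k) \<Rightarrow> measure lborel k *\<^sub>R F x) \<in> C0"
        using C0 by (auto simp: split_beta)
    qed
    then show "\<exists>y\<in>C0. dist y (integral {a..b} F) < e"
      using \<gamma>(2)[of D] D by (intro bexI) (simp_all add: dist_norm)
  qed
  then show ?thesis unfolding closure_closed[OF closed_C0] .
qed

definition duhamel :: "(real \<Rightarrow> (real ^ 'n::finite) \<Rightarrow>\<^sub>C real) \<Rightarrow> real \<Rightarrow> (real ^ 'n) \<Rightarrow>\<^sub>C real" where
  "duhamel f t = integral {0..t} (\<lambda>s. heat_flow (t - s) (f s))"

lemma duhamel_0 [simp]: "duhamel f 0 = 0"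
  by (simp add: duhamel_def)

context
  fixes f :: "real \<Rightarrow> (real ^ 'n::finite) \<Rightarrow>\<^sub>C real" and T :: real
  assumes cont: "continuous_on {0..T} f" and C0: "\<And>s. s \<in> {0..T} \<Longrightarrow> f s \<in> C0"
begin

lemma continuous_on_duhamel_integrand:
  "S \<subseteq> {0..T} \<Longrightarrow> continuous_on S (\<lambda>s. heat_flow (t - s) (f s))"
  using continuous_on_subset[OF cont] C0 by (intro continuous_intros) auto

lemma duhamel_integrand_integrable:
  "0 \<le> a \<Longrightarrow> b \<le> T \<Longrightarrow> (\<lambda>s. heat_flow (t - s) (f s)) integrable_on {a..b}"
  by (intro integrable_continuous_real continuous_on_duhamel_integrand) auto

lemma C0_duhamel: "t \<le> T \<Longrightarrow> duhamel f t \<in> C0"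
  unfolding duhamel_def using C0 by (intro C0_integral duhamel_integrand_integrable) auto

text \<open>
  For \<open>s > t\<close> the flow at the negative time \<open>t - s\<close> is the identity. Hence the integral over \<open>{0..t}\<close> is
  an integral over the fixed interval \<open>{0..T}\<close> with a jointly continuous integrand, minus the integral
  of \<open>f\<close> over \<open>{t..T}\<close>, and both are continuous in \<open>t\<close>.
\<close>

lemma continuous_on_duhamel: "continuous_on {0..T} (duhamel f)"
proof -
  have "continuous_on {0..T} (\<lambda>t. integral {0..T} (\<lambda>s. heat_flow (t - s) (f s)) - (integral {0..T} f - integral {0..t} f))"
  proof (intro continuous_on_diff continuous_on_const)
    have "continuous_on ({0..T} \<times> cbox 0 T) (\<lambda>(t, s). heat_flow (t - s) (f s))"
      unfolding split_beta using C0
      by (intro continuous_intros continuous_on_compose2[OF cont]) auto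
    then show "continuous_on {0..T} (\<lambda>t. integral {0..T} (\<lambda>s. heat_flow (t - s) (f s)))"
      using integral_continuous_on_param by fastforce
    show "continuous_on {0..T} (\<lambda>t. integral {0..t} f)"
      by (intro indefinite_integral_continuous_1 integrable_continuous_real cont)
  qed
  moreover have "duhamel f t = integral {0..T} (\<lambda>s. heat_flow (t - s) (f s)) - (integral {0..T} f - integral {0..t} f)"
    if t: "t \<in> {0..T}" for t
  proof -
    have "integral {0..T} (\<lambda>s. heat_flow (t - s) (f s)) = duhamel f t + integral {t..T} (\<lambda>s. heat_flow (t - s) (f s))"
      unfolding duhamel_def using t
      by (intro Henstock_Kurzweil_Integration.integral_combine[symmetric] duhamel_integrand_integrable) auto
    also have "integral {t..T} (\<lambda>s. heat_flow (t - s) (f s)) = integral {t..T} f"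
      by (intro Henstock_Kurzweil_Integration.integral_cong) simp
    also have "integral {t..T} f = integral {0..T} f - integral {0..t} f"
      using t Henstock_Kurzweil_Integration.integral_combine[of 0 t T f] integrable_continuous_real[OF cont] by (simp add: algebra_simps)
    finally show ?thesis by simp
  qed
  ultimately show ?thesis by (elim continuous_on_eq) simp
qed

text \<open>
  The semigroup property lets the past up to time \<open>r\<close> enter only through the value at time \<open>r\<close>; this
  is what makes restarting a solution possible.
\<close>

lemma duhamel_restart:
  assumes "0 \<le> r" "0 \<le> t" "r + t \<le> T"
  shows "duhamel f (r + t) = heat_flow t (duhamel f r) + duhamel (\<lambda>s. f (r + s)) t"
proof -
  have "duhamel f (r + t) = integral {0..r} (\<lambda>s. heat_flow (r + t - s) (f s)) + integral {r..r + t} (\<lambda>s. heat_flow (r + t - s) (f s))"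
    unfolding duhamel_def using assms
    by (intro Henstock_Kurzweil_Integration.integral_combine[symmetric] duhamel_integrand_integrable) auto
  also have "integral {0..r} (\<lambda>s. heat_flow (r + t - s) (f s)) = heat_flow t (duhamel f r)"
  proof -
    have "integral {0..r} (\<lambda>s. heat_flow (r + t - s) (f s)) = integral {0..r} (heat_flow t \<circ> (\<lambda>s. heat_flow (r - s) (f s)))"
      using assms by (intro Henstock_Kurzweil_Integration.integral_cong) (simp add: heat_flow_semigroup algebra_simps)
    also have "\<dots> = heat_flow t (duhamel f r)"
      unfolding duhamel_def using assms
      by (intro integral_linear bounded_linear_heat_flow duhamel_integrand_integrable) auto
    finally show ?thesis .
  qed
  also have "integral {r..r + t} (\<lambda>s. heat_flow (r + t - s) (f s)) = duhamel (\<lambda>s. f (r + s)) t"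
  proof -
    let ?F = "\<lambda>s. heat_flow (r + t - s) (f s)"
    have "(?F has_integral integral {r..r + t} ?F) (cbox r (r + t))"
      using assms duhamel_integrand_integrable[of r "r + t" "r + t"] by (simp add: has_integral_integral)
    from has_integral_affinity[OF this, of 1 r] show ?thesis
      unfolding duhamel_def by (simp add: integral_unique algebra_simps)
  qed
  finally show ?thesis .
qed

end

text \<open>
  The majorant \<open>B\<close> is left free: it is constant in the contraction argument and a power of \<open>s\<close> in the
  comparison of iterates.
\<close>

lemma norm_duhamel_diff_le:
  assumes "continuous_on {0..T} f" "\<And>s. s \<in> {0..T} \<Longrightarrow> f s \<in> C0"
    "continuous_on {0..T} g" "\<And>s. s \<in> {0..T} \<Longrightarrow> g s \<in> C0" "t \<le> T"
    and B: "(B has_integral J) {0..t}" "\<And>s. s \<in> {0..t} \<Longrightarrow> norm (f s - g s) \<le> B s"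
  shows "norm (duhamel f t - duhamel g t) \<le> J"
proof -
  have int: "(\<lambda>s. heat_flow (t - s) (f s)) integrable_on {0..t}" "(\<lambda>s. heat_flow (t - s) (g s)) integrable_on {0..t}"
    using assms by (auto intro!: duhamel_integrand_integrable)
  have "norm (integral {0..t} (\<lambda>s. heat_flow (t - s) (f s) - heat_flow (t - s) (g s))) \<le> integral {0..t} B"
    using int B
    by (intro integral_norm_bound_integral Henstock_Kurzweil_Integration.integrable_diff)
      (auto simp: heat_flow_diff[symmetric] intro: order_trans[OF norm_heat_flow_le])
  then show ?thesis
    using B by (simp add: duhamel_def Henstock_Kurzweil_Integration.integral_diff[OF int, symmetric] integral_unique)
qed

lemma duhamel_zero [simp]: "duhamel (\<lambda>_. 0) t = 0"
  by (simp add: duhamel_def linear_0[OF bounded_linear.linear[OF bounded_linear_heat_flow]])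

lemma norm_duhamel_le:
  assumes "continuous_on {0..T} f" "\<And>s. s \<in> {0..T} \<Longrightarrow> f s \<in> C0" "t \<le> T"
    and "(B has_integral J) {0..t}" "\<And>s. s \<in> {0..t} \<Longrightarrow> norm (f s) \<le> B s"
  shows "norm (duhamel f t) \<le> J"
  using norm_duhamel_diff_le[of T f "\<lambda>_. 0" t B J] assms by simp

lemma norm_abs_powr_le: "0 < p \<Longrightarrow> norm (abs_powr p f) \<le> norm f powr p"
  using norm_bounded[of f] by (intro norm_bound) (auto simp: powr_mono2)

lemma powr_diff_le:
  fixes a b p :: real
  assumes "1 \<le> p" "0 \<le> a" "a \<le> M" "0 \<le> b" "b \<le> M"
  shows "\<bar>a powr p - b powr p\<bar> \<le> p * M powr (p - 1) * \<bar>a - b\<bar>"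
proof -
  have *: "x powr p - y powr p \<le> p * M powr (p - 1) * \<bar>x - y\<bar>" if "0 \<le> x" "x \<le> M" "0 \<le> y" for x y
  proof -
    have "x powr p - y powr p \<le> p * x powr (p - 1) * (x - y)"
      using powr_above_tangent[OF assms(1) that(3) that(1)] by (simp add: algebra_simps)
    also have "\<dots> \<le> p * x powr (p - 1) * \<bar>x - y\<bar>"
      using assms by (intro mult_left_mono) auto
    also have "\<dots> \<le> p * M powr (p - 1) * \<bar>x - y\<bar>"
      using assms that by (intro mult_right_mono mult_left_mono powr_mono2) auto
    finally show ?thesis .
  qed
  show ?thesis
    using *[of a b] *[of b a] assms by (auto simp: abs_le_iff abs_minus_commute)
qed

text \<open>
  The nonlinearity is Lipschitz on balls, with a constant depending only on the radius.
\<close>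

lemma norm_abs_powr_diff_le:
  assumes "1 \<le> p" "norm f \<le> M" "norm g \<le> M"
  shows "norm (abs_powr p f - abs_powr p g) \<le> p * M powr (p - 1) * norm (f - g)"
proof (rule norm_bound)
  fix x
  have "\<bar>\<bar>f x\<bar> powr p - \<bar>g x\<bar> powr p\<bar> \<le> p * M powr (p - 1) * \<bar>\<bar>f x\<bar> - \<bar>g x\<bar>\<bar>"
    using assms norm_bounded[of f x] norm_bounded[of g x] by (intro powr_diff_le) auto
  also have "\<dots> \<le> p * M powr (p - 1) * norm (f - g)"
    using assms norm_bounded[of "f - g" x] by (intro mult_left_mono) auto
  finally show "norm ((abs_powr p f - abs_powr p g) x) \<le> p * M powr (p - 1) * norm (f - g)"
    using assms by simp
qed

lemma continuous_on_abs_powr [continuous_intros]: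
  assumes p: "1 \<le> p" and F: "continuous_on S F"
  shows "continuous_on S (\<lambda>s. abs_powr p (F s))"
proof -
  have "isCont (abs_powr p) f" for f :: "(real ^ 'n::finite) \<Rightarrow>\<^sub>C real"
  proof -
    have "((\<lambda>g. abs_powr p g - abs_powr p f) \<longlongrightarrow> 0) (at f)"
    proof (rule Lim_null_comparison)
      have "((\<lambda>g. norm g) \<longlongrightarrow> norm f) (at f)" by (intro tendsto_intros)
      then have "\<forall>\<^sub>F g in at f. norm g < norm f + 1" by (rule order_tendstoD) simp
      then show "\<forall>\<^sub>F g in at f. norm (abs_powr p g - abs_powr p f) \<le> p * (norm f + 1) powr (p - 1) * norm (g - f)"
        by eventually_elim (use p in \<open>intro norm_abs_powr_diff_le, auto\<close>)
      have "((\<lambda>g. p * (norm f + 1) powr (p - 1) * norm (g - f)) \<longlongrightarrow> p * (norm f + 1) powr (p - 1) * norm (f - f)) (at f)"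
        by (intro tendsto_intros)
      then show "((\<lambda>g. p * (norm f + 1) powr (p - 1) * norm (g - f)) \<longlongrightarrow> 0) (at f)" by simp
    qed
    then show ?thesis by (simp add: isCont_def LIM_zero_iff)
  qed
  then show ?thesis
    using continuous_on_compose2[OF _ F, of UNIV "abs_powr p"] by (auto simp: continuous_on_eq_continuous_at)
qed

section \<open>Local existence, uniqueness and continuation\<close>

text \<open>
  The forcing \<open>G\<close> is an arbitrary function of time and not only the one of the integral equation,
  because restarting a solution at a later time leads to an equation of the same form with
  another \<open>G\<close>.
\<close>

definition solves :: "real \<Rightarrow> (real \<Rightarrow> (real ^ 'n::finite) \<Rightarrow>\<^sub>C real) \<Rightarrow> real \<Rightarrow> (real \<Rightarrow> (real ^ 'n) \<Rightarrow>\<^sub>C real) \<Rightarrow> bool" where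
  "solves p G T u \<longleftrightarrow> continuous_on {0..T} u \<and>
     (\<forall>t\<in>{0..T}. u t \<in> C0 \<and> u t = G t + duhamel (\<lambda>s. abs_powr p (u s)) t)"

lemma solvesD:
  assumes "solves p G T u"
  shows "continuous_on {0..T} u"
    and "t \<in> {0..T} \<Longrightarrow> u t \<in> C0"
    and "t \<in> {0..T} \<Longrightarrow> u t = G t + duhamel (\<lambda>s. abs_powr p (u s)) t"
  using assms unfolding solves_def by blast+

text \<open>
  The usual factorial bound: each application of the Lipschitz estimate integrates the previous
  bound once more. Constant sequences give uniqueness; a solution paired with the Picard iterates
  gives convergence of the iterates on the whole interval.
\<close>

lemma picard_difference:
  fixes a b :: "nat \<Rightarrow> real \<Rightarrow> (real ^ 'n::finite) \<Rightarrow>\<^sub>C real"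
  assumes p: "1 < p"
    and a: "\<And>n. continuous_on {0..T} (a n)" "\<And>n t. t \<in> {0..T} \<Longrightarrow> a n t \<in> C0 \<and> norm (a n t) \<le> M"
    and b: "\<And>n. continuous_on {0..T} (b n)" "\<And>n t. t \<in> {0..T} \<Longrightarrow> b n t \<in> C0 \<and> norm (b n t) \<le> M"
    and step: "\<And>n t. t \<in> {0..T} \<Longrightarrow> a (Suc n) t - b (Suc n) t =
      duhamel (\<lambda>s. abs_powr p (a n s)) t - duhamel (\<lambda>s. abs_powr p (b n s)) t"
    and t: "t \<in> {0..T}"
  shows "norm (a n t - b n t) \<le> 2 * M * ((p * M powr (p - 1) * t) ^ n / fact n)"
  using t
proof (induction n arbitrary: t)
  case 0
  then show ?case
    using a(2)[of t 0] b(2)[of t 0] norm_triangle_ineq4[of "a 0 t" "b 0 t"] by simp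
next
  case (Suc n)
  let ?L = "p * M powr (p - 1)"
  have "norm (a (Suc n) t - b (Suc n) t) = norm (duhamel (\<lambda>s. abs_powr p (a n s)) t - duhamel (\<lambda>s. abs_powr p (b n s)) t)"
    using Suc.prems by (simp add: step)
  also have "\<dots> \<le> 2 * M * ((?L * t) ^ Suc n / fact (Suc n))"
  proof (rule norm_duhamel_diff_le[where T = T])
    show "((\<lambda>s. ?L * (2 * M * ((?L * s) ^ n / fact n))) has_integral 2 * M * ((?L * t) ^ Suc n / fact (Suc n))) {0..t}"
    proof -
      have "((\<lambda>s. ?L * (2 * M * ((?L * s) ^ n / fact n))) has_integral
          2 * M * ((?L * t) ^ Suc n / fact (Suc n)) - 2 * M * ((?L * 0) ^ Suc n / fact (Suc n))) {0..t}"
      proof (rule fundamental_theorem_of_calculus)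
        show "((\<lambda>s. 2 * M * ((?L * s) ^ Suc n / fact (Suc n))) has_vector_derivative ?L * (2 * M * ((?L * x) ^ n / fact n))) (at x within {0..t})" for x
          unfolding has_real_derivative_iff_has_vector_derivative[symmetric]
          by (rule derivative_eq_intros refl | simp)+
      qed (use Suc.prems in auto)
      then show ?thesis by simp
    qed
    show "norm (abs_powr p (a n s) - abs_powr p (b n s)) \<le> ?L * (2 * M * ((?L * s) ^ n / fact n))" if "s \<in> {0..t}" for s
    proof -
      have s: "s \<in> {0..T}" using that Suc.prems by auto
      have "norm (abs_powr p (a n s) - abs_powr p (b n s)) \<le> ?L * norm (a n s - b n s)"
        using a(2)[OF s] b(2)[OF s] p by (intro norm_abs_powr_diff_le) auto
      also have "\<dots> \<le> ?L * (2 * M * ((?L * s) ^ n / fact n))"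
        using p Suc.IH[OF s] by (intro mult_left_mono) auto
      finally show ?thesis .
    qed
  qed (use a b p Suc.prems in \<open>auto intro!: continuous_intros\<close>)
  finally show ?case .
qed

lemma pow_over_fact_tendsto_0: "(\<lambda>n. c * (x ^ n / fact n)) \<longlonglongrightarrow> (0 :: real)"
  using tendsto_mult_right_zero[OF summable_LIMSEQ_zero[OF summable_exp[of x]], of c]
  by (simp add: field_simps)

lemma bounded_on_interval:
  assumes "continuous_on {0..T::real} (u :: real \<Rightarrow> 'a::real_normed_vector)"
  obtains M where "0 < M" "\<And>t. t \<in> {0..T} \<Longrightarrow> norm (u t) \<le> M"
proof -
  have "bounded (u ` {0..T})" by (intro compact_imp_bounded compact_continuous_image assms) auto
  then obtain M where "0 < M" "\<forall>x\<in>u ` {0..T}. norm x \<le> M" unfolding bounded_pos by blast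
  then show thesis using that by auto
qed

lemma solves_unique:
  assumes p: "1 < p" and u: "solves p G T u" and v: "solves p G T v" and t: "t \<in> {0..T}"
  shows "u t = v t"
proof -
  obtain M1 where M1: "0 < M1" "\<And>t. t \<in> {0..T} \<Longrightarrow> norm (u t) \<le> M1"
    using bounded_on_interval[OF solvesD(1)[OF u]] by metis
  obtain M2 where M2: "0 < M2" "\<And>t. t \<in> {0..T} \<Longrightarrow> norm (v t) \<le> M2"
    using bounded_on_interval[OF solvesD(1)[OF v]] by metis
  define M where "M = max M1 M2"
  have M: "norm (u t) \<le> M" "norm (v t) \<le> M" if "t \<in> {0..T}" for t
    using M1(2)[OF that] M2(2)[OF that] by (auto simp: M_def)
  have "norm (u t - v t) \<le> 2 * M * ((p * M powr (p - 1) * t) ^ n / fact n)" for n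
  proof (rule picard_difference[OF p, where a = "\<lambda>_. u" and b = "\<lambda>_. v" and T = T])
    fix t assume t: "t \<in> {0..T}"
    show "u t - v t = duhamel (\<lambda>s. abs_powr p (u s)) t - duhamel (\<lambda>s. abs_powr p (v s)) t"
      using solvesD(3)[OF u t] solvesD(3)[OF v t] by (metis add_diff_cancel_left)
  qed (use solvesD(1,2)[OF u] solvesD(1,2)[OF v] t M in blast)+
  then have "norm (u t - v t) \<le> 0"
    by (intro LIMSEQ_le_const[OF pow_over_fact_tendsto_0]) auto
  then show ?thesis by simp
qed

lemma solves_subinterval: "solves p G T u \<Longrightarrow> T' \<le> T \<Longrightarrow> solves p G T' u"
  unfolding solves_def using continuous_on_subset[of "{0..T}" u "{0..T'}"]
  by (meson atLeastAtMost_iff atLeastatMost_subset_iff order_refl order_trans)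

lemma solves_cong:
  assumes "\<And>t. t \<in> {0..T} \<Longrightarrow> u t = v t" "solves p G T u"
  shows "solves p G T v"
proof -
  have "duhamel (\<lambda>s. abs_powr p (u s)) t = duhamel (\<lambda>s. abs_powr p (v s)) t" if "t \<in> {0..T}" for t
    unfolding duhamel_def using assms(1) that by (intro Henstock_Kurzweil_Integration.integral_cong) auto
  moreover have "continuous_on {0..T} v"
    using continuous_on_eq[OF solvesD(1)[OF assms(2)], of v] assms(1) by blast
  ultimately show ?thesis
    using assms unfolding solves_def by metis
qed

text \<open>
  The map \<open>u \<mapsto> G + duhamel (|u|\<^sup>p)\<close> is a contraction by the factor \<open>1/2\<close> on the ball of radius \<open>2 * K\<close>. Only
  the bound \<open>K\<close> for the forcing restricts the length of the interval.
\<close>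

lemma local_existence:
  fixes G :: "real \<Rightarrow> (real ^ 'n::finite) \<Rightarrow>\<^sub>C real"
  assumes p: "1 < p" and K: "0 < K"
    and \<tau>: "0 \<le> \<tau>" "\<tau> * (2 * K) powr p \<le> K" "\<tau> * (p * (2 * K) powr (p - 1)) \<le> 1 / 2"
    and G: "continuous_on {0..\<tau>} G" "\<And>t. t \<in> {0..\<tau>} \<Longrightarrow> G t \<in> C0 \<and> norm (G t) \<le> K"
  shows "\<exists>u. solves p G \<tau> u"
proof -
  let ?F = "\<lambda>g :: real \<Rightarrow>\<^sub>C ((real ^ 'n) \<Rightarrow>\<^sub>C real). \<lambda>s. abs_powr p (g s)"
  \<comment> \<open>Functions on the interval are extended by their end values, so that the
    fixed point theorem applies in the space of bounded continuous functions on the line.\<close>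
  define clip where "clip = (\<lambda>t. max 0 (min \<tau> t))"
  have clip: "clip t \<in> {0..\<tau>}" "t \<in> {0..\<tau>} \<Longrightarrow> clip t = t" for t
    using \<tau>(1) by (auto simp: clip_def)
  define \<Phi> where "\<Phi> = (\<lambda>g :: real \<Rightarrow>\<^sub>C ((real ^ 'n) \<Rightarrow>\<^sub>C real). Bcontfun (\<lambda>t. G (clip t) + duhamel (?F g) (clip t)))"
  define S where "S = {g :: real \<Rightarrow>\<^sub>C ((real ^ 'n) \<Rightarrow>\<^sub>C real). \<forall>t. g t \<in> C0 \<inter> cball 0 (2 * K)}"
  have S: "g t \<in> C0" "norm (g t) \<le> 2 * K" if "g \<in> S" for g t
    using that unfolding S_def by (simp_all add: dist_norm)
  have F_cont: "continuous_on {0..\<tau>} (?F g)" for g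
    using p by (intro continuous_intros) auto
  have F_C0: "?F g t \<in> C0" if "g \<in> S" for g t
    using S[OF that] p by auto
  have \<Phi>_bound: "norm (G (clip t) + duhamel (?F g) (clip t)) \<le> 2 * K" if g: "g \<in> S" for g t
  proof -
    have "norm (duhamel (?F g) (clip t)) \<le> (2 * K) powr p * clip t"
    proof (rule norm_duhamel_le[OF F_cont F_C0[OF g]])
      show "((\<lambda>s. (2 * K) powr p) has_integral (2 * K) powr p * clip t) {0..clip t}"
        using has_integral_const_real[of "(2 * K) powr p" 0 "clip t"] clip(1)[of t] by (simp add: mult.commute)
      show "norm (abs_powr p (g s)) \<le> (2 * K) powr p" for s
        using order_trans[OF norm_abs_powr_le[of p "g s"] powr_mono2[of p "norm (g s)" "2 * K"]] S(2)[OF g, of s] p by simp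
    qed (use clip in auto)
    also have "\<dots> \<le> (2 * K) powr p * \<tau>"
      using clip[of t] by (intro mult_left_mono) auto
    also have "\<dots> \<le> K" using \<tau>(2) by (simp add: mult.commute)
    finally show ?thesis
      using G(2)[OF clip(1)[of t]] norm_triangle_ineq[of "G (clip t)" "duhamel (?F g) (clip t)"] by simp
  qed
  have \<Phi>_apply: "\<Phi> g t = G (clip t) + duhamel (?F g) (clip t)" if g: "g \<in> S" for g t
  proof -
    have c: "continuous_on UNIV clip" unfolding clip_def by (intro continuous_intros)
    have "continuous_on {0..\<tau>} (\<lambda>t. G t + duhamel (?F g) t)"
      by (intro continuous_on_add G(1) continuous_on_duhamel[OF F_cont F_C0[OF g]])
    then have "continuous_on UNIV (\<lambda>t. G (clip t) + duhamel (?F g) (clip t))"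
      using continuous_on_compose2[OF _ c] clip(1) by blast
    then have "(\<lambda>t. G (clip t) + duhamel (?F g) (clip t)) \<in> bcontfun"
      using \<Phi>_bound[OF g] by (rule bcontfun_normI)
    then show ?thesis by (simp add: \<Phi>_def Bcontfun_inverse)
  qed
  have "\<exists>!g. g \<in> S \<and> \<Phi> g = g"
  proof (rule Banach_fix[where c = "1 / 2"])
    have "S = PiC UNIV (\<lambda>_. C0 \<inter> cball 0 (2 * K))"
      unfolding S_def by (simp only: set_eq_iff mem_PiC_iff Pi_iff mem_Collect_eq UNIV_I ball_UNIV simp_thms)
    then show "complete S"
      using closed_PiC[of UNIV "\<lambda>_. C0 \<inter> cball 0 (2 * K)"] closed_C0
      by (auto simp: complete_eq_closed)
    have "0 \<in> S" using K by (simp add: S_def)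
    then show "S \<noteq> {}" by blast
    show "\<Phi> ` S \<subseteq> S"
    proof clarify
      fix g assume g: "g \<in> S"
      have "G (clip t) + duhamel (?F g) (clip t) \<in> C0" for t
        using G(2)[OF clip(1)[of t]] C0_duhamel[OF F_cont F_C0[OF g]] clip[of t] by auto
      then show "\<Phi> g \<in> S"
        using \<Phi>_bound[OF g] by (simp add: S_def \<Phi>_apply[OF g] dist_norm)
    qed
    show "dist (\<Phi> g) (\<Phi> h) \<le> 1 / 2 * dist g h" if g: "g \<in> S" and h: "h \<in> S" for g h
    proof (rule dist_bound)
      fix t
      let ?L = "p * (2 * K) powr (p - 1) * dist g h"
      have "dist (\<Phi> g t) (\<Phi> h t) = norm (duhamel (?F g) (clip t) - duhamel (?F h) (clip t))"
        by (simp add: \<Phi>_apply g h dist_norm)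
      also have "\<dots> \<le> ?L * clip t"
      proof (rule norm_duhamel_diff_le[OF F_cont F_C0[OF g] F_cont F_C0[OF h]])
        show "((\<lambda>s. ?L) has_integral ?L * clip t) {0..clip t}"
          using has_integral_const_real[of ?L 0 "clip t"] clip(1)[of t] by (simp add: mult.commute)
        show "norm (?F g s - ?F h s) \<le> ?L" for s
        proof -
          have "norm (?F g s - ?F h s) \<le> p * (2 * K) powr (p - 1) * norm (g s - h s)"
            using p S[OF g] S[OF h] by (intro norm_abs_powr_diff_le) auto
          also have "\<dots> \<le> ?L"
            using p dist_bounded[of g s h] by (intro mult_left_mono) (auto simp: dist_norm)
          finally show ?thesis .
        qed
      qed (use clip in auto)
      also have "\<dots> \<le> ?L * \<tau>"
        using clip[of t] p by (intro mult_left_mono) auto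
      also have "\<dots> = \<tau> * (p * (2 * K) powr (p - 1)) * dist g h" by simp
      also have "\<dots> \<le> 1 / 2 * dist g h"
        using \<tau>(3) by (intro mult_right_mono) auto
      finally show "dist (\<Phi> g t) (\<Phi> h t) \<le> 1 / 2 * dist g h" .
    qed
  qed auto
  then obtain g where g: "g \<in> S" "\<Phi> g = g" by blast
  have "solves p G \<tau> g"
    unfolding solves_def
  proof (intro conjI ballI)
    fix t assume t: "t \<in> {0..\<tau>}"
    have "g t = \<Phi> g t" by (simp only: g(2))
    also have "\<dots> = G t + duhamel (?F g) t" using \<Phi>_apply[OF g(1), of t] clip(2)[OF t] by simp
    finally show "g t = G t + duhamel (?F g) t" .
  qed (simp_all add: S(1)[OF g(1)])
  then show ?thesis by blast
qed

text \<open>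
  By \<open>duhamel_restart\<close>, continuing \<open>u\<close> beyond \<open>r\<close> means solving the equation for the shifted time, with
  the effect of the past, which is \<open>u r - G r\<close>, transported by the heat flow and added to the forcing.
\<close>

lemma solves_extend:
  assumes u: "solves p G r u" and p: "1 < p" and r: "0 \<le> r" and \<tau>: "0 \<le> \<tau>"
    and v: "solves p (\<lambda>t. G (r + t) + heat_flow t (u r - G r)) \<tau> v"
  shows "\<exists>u'. solves p G (r + \<tau>) u'"
proof -
  define w where "w = (\<lambda>t. if t \<le> r then u t else v (t - r))"
  have wv: "w (r + s) = v s" if "0 \<le> s" for s
  proof (cases "s = 0")
    case True
    have "v 0 = u r"
      using solvesD(3)[OF v, of 0] \<tau> by simp
    then show ?thesis using True by (simp add: w_def)
  qed (use that in \<open>simp add: w_def\<close>)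
  have cont: "continuous_on {0..r + \<tau>} w"
  proof -
    have 1: "continuous_on {r..r + \<tau>} w"
    proof (rule continuous_on_eq)
      show "continuous_on {r..r + \<tau>} (\<lambda>t. v (t - r))"
        by (rule continuous_on_compose2[OF solvesD(1)[OF v]]) (auto intro!: continuous_intros)
      show "v (t - r) = w t" if "t \<in> {r..r + \<tau>}" for t
        using wv[of "t - r"] that by simp
    qed
    have 2: "continuous_on {0..r} w"
      by (rule continuous_on_eq[OF solvesD(1)[OF u]]) (simp add: w_def)
    have "{0..r + \<tau>} = {0..r} \<union> {r..r + \<tau>}" using r \<tau> by auto
    then show ?thesis using continuous_on_closed_Un[OF _ _ 2 1] by simp
  qed
  have C0: "w t \<in> C0" if "t \<in> {0..r + \<tau>}" for t
    using solvesD(2)[OF u, of t] solvesD(2)[OF v, of "t - r"] that by (auto simp: w_def)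
  have Fc: "continuous_on {0..r + \<tau>} (\<lambda>s. abs_powr p (w s))"
    using p cont by (intro continuous_intros) auto
  have FC0: "abs_powr p (w s) \<in> C0" if "s \<in> {0..r + \<tau>}" for s
    using C0[OF that] p by auto
  have dw: "duhamel (\<lambda>s. abs_powr p (w s)) t = duhamel (\<lambda>s. abs_powr p (u s)) t" if "t \<le> r" for t
    unfolding duhamel_def using that by (intro Henstock_Kurzweil_Integration.integral_cong) (simp add: w_def)
  have dv: "duhamel (\<lambda>s. abs_powr p (w (r + s))) t = duhamel (\<lambda>s. abs_powr p (v s)) t" for t
    unfolding duhamel_def by (intro Henstock_Kurzweil_Integration.integral_cong) (simp add: wv)
  have "w t = G t + duhamel (\<lambda>s. abs_powr p (w s)) t" if t: "t \<in> {0..r + \<tau>}" for t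
  proof (cases "t \<le> r")
    case True
    then show ?thesis
      using solvesD(3)[OF u, of t] t dw[of t] by (simp add: w_def)
  next
    case False
    define s where "s = t - r"
    have s: "0 \<le> s" "s \<le> \<tau>" "t = r + s" using False t by (auto simp: s_def)
    have "duhamel (\<lambda>s. abs_powr p (w s)) t = heat_flow s (u r - G r) + duhamel (\<lambda>s. abs_powr p (v s)) s"
      unfolding s(3) using duhamel_restart[OF Fc FC0 r s(1)] s r solvesD(3)[OF u, of r] dw[of r]
      by (simp add: dv)
    moreover have "w t = G (r + s) + heat_flow s (u r - G r) + duhamel (\<lambda>s. abs_powr p (v s)) s"
      using wv[OF s(1)] solvesD(3)[OF v, of s] s by simp
    ultimately show ?thesis by (simp add: s(3))
  qed
  then show ?thesis using cont C0 unfolding solves_def by blast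
qed

section \<open>The inhomogeneous term and the integral equation\<close>

text \<open>
  This is the integral of \<open>s powr \<sigma> * heat_flow (t - s) w\<close> over \<open>s\<close> in \<open>{0..t}\<close>, after the substitution
  \<open>y = s powr (\<sigma> + 1)\<close>, which removes the singularity at \<open>s = 0\<close> and leaves a continuous integrand; see
  \<open>source_flow_has_integral\<close>.
\<close>

definition source_flow :: "real \<Rightarrow> ((real ^ 'n::finite) \<Rightarrow>\<^sub>C real) \<Rightarrow> real \<Rightarrow> (real ^ 'n) \<Rightarrow>\<^sub>C real" where
  "source_flow \<sigma> w t = (1 / (\<sigma> + 1)) *\<^sub>R
     integral {0..t powr (\<sigma> + 1)} (\<lambda>y. heat_flow (t - y powr (1 / (\<sigma> + 1))) w)"

context
  fixes \<sigma> :: real and w :: "(real ^ 'n::finite) \<Rightarrow>\<^sub>C real"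
  assumes \<sigma>: "-1 < \<sigma>" and w: "w \<in> C0"
begin

lemma continuous_on_source_integrand:
  "S \<subseteq> UNIV \<times> {0..} \<Longrightarrow> continuous_on S (\<lambda>(t, y). heat_flow (t - y powr (1 / (\<sigma> + 1))) w)"
  unfolding split_beta using \<sigma> w
  by (intro continuous_intros continuous_on_powr') auto

lemma source_integrand_integrable:
  "0 \<le> a \<Longrightarrow> (\<lambda>y. heat_flow (t - y powr (1 / (\<sigma> + 1))) w) integrable_on {a..b}"
proof -
  assume "0 \<le> a"
  then have "continuous_on ({t} \<times> {a..b}) (\<lambda>(t, y). heat_flow (t - y powr (1 / (\<sigma> + 1))) w)"
    by (intro continuous_on_source_integrand) auto
  then have "continuous_on {a..b} (\<lambda>y. (\<lambda>(t, y). heat_flow (t - y powr (1 / (\<sigma> + 1))) w) (t, y))"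
    by (rule continuous_on_compose2) (auto intro!: continuous_intros)
  then show ?thesis by (intro integrable_continuous_real) simp
qed

lemma C0_source_flow: "source_flow \<sigma> w t \<in> C0"
  unfolding source_flow_def using w by (intro C0_scaleR C0_integral source_integrand_integrable) auto

lemma source_flow_0 [simp]: "source_flow \<sigma> w 0 = 0"
  using \<sigma> by (simp add: source_flow_def)

lemma norm_source_flow_le:
  assumes "0 \<le> t"
  shows "norm (source_flow \<sigma> w t) \<le> t powr (\<sigma> + 1) / (\<sigma> + 1) * norm w"
proof -
  have "norm (integral {0..t powr (\<sigma> + 1)} (\<lambda>y. heat_flow (t - y powr (1 / (\<sigma> + 1))) w)) \<le>
      integral {0..t powr (\<sigma> + 1)} (\<lambda>y. norm w)"
    using norm_heat_flow_le by (intro integral_norm_bound_integral source_integrand_integrable) auto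
  also have "\<dots> = t powr (\<sigma> + 1) * norm w" by simp
  finally show ?thesis
    unfolding source_flow_def using \<sigma> by (simp add: divide_right_mono)
qed

text \<open>
  As for the Duhamel operator, the integral is written over a fixed interval, using that the flow
  is the identity at the negative times that occur.
\<close>

lemma continuous_on_source_flow: "continuous_on {0..T} (source_flow \<sigma> w)"
proof -
  define S where "S = T powr (\<sigma> + 1)"
  let ?F = "\<lambda>t y. heat_flow (t - y powr (1 / (\<sigma> + 1))) w"
  have "continuous_on {0..T} (\<lambda>t. (1 / (\<sigma> + 1)) *\<^sub>R (integral {0..S} (?F t) - (S - t powr (\<sigma> + 1)) *\<^sub>R w))"
  proof (intro continuous_on_scaleR continuous_on_diff continuous_on_const)
    have "continuous_on ({0..T} \<times> cbox 0 S) (\<lambda>(t, y). ?F t y)"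
      by (intro continuous_on_source_integrand) auto
    then show "continuous_on {0..T} (\<lambda>t. integral {0..S} (?F t))"
      using integral_continuous_on_param by fastforce
    show "continuous_on {0..T} (\<lambda>t. t powr (\<sigma> + 1))"
      using \<sigma> by (intro continuous_on_powr' continuous_intros) auto
  qed
  moreover have "source_flow \<sigma> w t = (1 / (\<sigma> + 1)) *\<^sub>R (integral {0..S} (?F t) - (S - t powr (\<sigma> + 1)) *\<^sub>R w)"
    if t: "t \<in> {0..T}" for t
  proof -
    have le: "t powr (\<sigma> + 1) \<le> S" using t \<sigma> unfolding S_def by (intro powr_mono2) auto
    have "integral {0..S} (?F t) = integral {0..t powr (\<sigma> + 1)} (?F t) + integral {t powr (\<sigma> + 1)..S} (?F t)"
      using le by (intro Henstock_Kurzweil_Integration.integral_combine[symmetric] source_integrand_integrable) auto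
    also have "integral {t powr (\<sigma> + 1)..S} (?F t) = integral {t powr (\<sigma> + 1)..S} (\<lambda>_. w)"
    proof (rule Henstock_Kurzweil_Integration.integral_cong)
      fix y assume y: "y \<in> {t powr (\<sigma> + 1)..S}"
      have "(t powr (\<sigma> + 1)) powr (1 / (\<sigma> + 1)) \<le> y powr (1 / (\<sigma> + 1))"
        using y \<sigma> by (intro powr_mono2) auto
      then show "?F t y = w" using t \<sigma> by (simp add: powr_powr)
    qed
    also have "\<dots> = (S - t powr (\<sigma> + 1)) *\<^sub>R w" using le by simp
    finally show ?thesis by (simp add: source_flow_def)
  qed
  ultimately show ?thesis by (elim continuous_on_eq) simp
qed

text \<open>
  Undoes the substitution. The additional flow for time \<open>r\<close> costs nothing, by the semigroup property,
  and is needed for the averages in the blow-up argument.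
\<close>

lemma heat_flow_source_has_integral:
  assumes r: "0 \<le> r" and t: "0 \<le> t"
  shows "((\<lambda>s. s powr \<sigma> * heat_flow (r + t - s) w x) has_integral heat_flow r (source_flow \<sigma> w t) x) {0..t}"
proof -
  let ?m = "1 / (\<sigma> + 1)" and ?Y = "t powr (\<sigma> + 1)"
  let ?f = "\<lambda>y. heat_flow r (heat_flow (t - y powr ?m) w) x"
  have fc: "continuous_on {0..?Y} ?f"
    using \<sigma> w by (intro bounded_linear.continuous_on[OF bounded_linear_bcontfun_apply] continuous_intros continuous_on_powr') auto
  have sub: "((\<lambda>s. ((\<sigma> + 1) * s powr \<sigma>) *\<^sub>R ?f (s powr (\<sigma> + 1))) has_integral integral {0 powr (\<sigma> + 1)..?Y} ?f) {0..t}"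
  proof (rule has_integral_substitution_strong[where s = "{0}" and c = 0 and d = ?Y])
    show "(\<lambda>s. s powr (\<sigma> + 1)) ` {0..t} \<subseteq> {0..?Y}"
      using \<sigma> by (auto intro!: powr_mono2)
    show "continuous_on {0..t} (\<lambda>s. s powr (\<sigma> + 1))"
      using \<sigma> by (intro continuous_on_powr' continuous_intros) auto
    \<comment> \<open>For negative \<open>\<sigma>\<close> the substitution is not differentiable at 0, so this point is excepted.\<close>
    show "((\<lambda>s. s powr (\<sigma> + 1)) has_real_derivative (\<sigma> + 1) * s powr \<sigma>) (at s within {0..t})" if "s \<in> {0..t} - {0}" for s
      using has_field_derivative_at_within[OF has_real_derivative_powr[of s "\<sigma> + 1"]] that by simp
  qed (use t fc in auto)
  have "integral {0 powr (\<sigma> + 1)..?Y} ?f = (\<sigma> + 1) * heat_flow r (source_flow \<sigma> w t) x"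
  proof -
    have i: "(\<lambda>y. heat_flow (t - y powr ?m) w) integrable_on {0..?Y}"
      by (rule source_integrand_integrable) simp
    have "heat_flow r (source_flow \<sigma> w t) x =
        ?m * (heat_flow r (integral {0..?Y} (\<lambda>y. heat_flow (t - y powr ?m) w))) x"
      by (simp add: source_flow_def heat_flow_scaleR)
    also have "heat_flow r (integral {0..?Y} (\<lambda>y. heat_flow (t - y powr ?m) w)) =
        integral {0..?Y} (heat_flow r \<circ> (\<lambda>y. heat_flow (t - y powr ?m) w))"
      by (rule integral_linear[OF i bounded_linear_heat_flow, symmetric])
    also have "(integral {0..?Y} (heat_flow r \<circ> (\<lambda>y. heat_flow (t - y powr ?m) w))) x = integral {0..?Y} ?f"
      using bcontfun_integral_apply(2)[OF integrable_linear[OF i bounded_linear_heat_flow[of r]], of x] by simp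
    finally show ?thesis using \<sigma> by simp
  qed
  with has_integral_mult_right[OF sub, of ?m]
  have "((\<lambda>s. ?m * (((\<sigma> + 1) * s powr \<sigma>) *\<^sub>R ?f (s powr (\<sigma> + 1)))) has_integral heat_flow r (source_flow \<sigma> w t) x) {0..t}"
    using \<sigma> by simp
  then show ?thesis
  proof (rule has_integral_eq[rotated])
    fix s assume s: "s \<in> {0..t}"
    have inv: "(s powr (\<sigma> + 1)) powr ?m = s" using s \<sigma> by (simp add: powr_powr)
    show "?m * (((\<sigma> + 1) * s powr \<sigma>) *\<^sub>R ?f (s powr (\<sigma> + 1))) = s powr \<sigma> * heat_flow (r + t - s) w x"
    proof -
      have "heat_flow r (heat_flow (t - s) w) = heat_flow (r + t - s) w"
        using s r by (simp add: heat_flow_semigroup add_diff_eq)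
      then show ?thesis using \<sigma> inv by simp
    qed
  qed
qed

lemma source_flow_has_integral:
  "0 \<le> t \<Longrightarrow> ((\<lambda>s. s powr \<sigma> * heat_flow (t - s) w x) has_integral source_flow \<sigma> w t x) {0..t}"
  using heat_flow_source_has_integral[of 0 t x] by simp

end

lemma absolutely_integrable_imp_set_integrable_lborel:
  fixes f :: "real \<Rightarrow> real"
  assumes "f \<in> borel_measurable borel" "f absolutely_integrable_on {a..b}"
  shows "set_integrable lborel {a..b} f"
  using assms unfolding set_integrable_def by (subst integrable_completion[symmetric]) auto

lemma measurable_heat_flow_time:
  "f \<in> C0 \<Longrightarrow> (\<lambda>s. heat_flow (t - s) f x) \<in> borel_measurable borel"
  by (intro borel_measurable_continuous_onI bounded_linear.continuous_on[OF bounded_linear_bcontfun_apply] continuous_intros) auto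

lemma heat_flow_duhamel_has_integral:
  assumes "continuous_on {0..T} f" "\<And>s. s \<in> {0..T} \<Longrightarrow> f s \<in> C0" "t \<le> T" and r: "0 \<le> r"
  shows "((\<lambda>s. heat_flow (r + t - s) (f s) x) has_integral heat_flow r (duhamel f t) x) {0..t}"
proof -
  have "(\<lambda>s. heat_flow (t - s) (f s)) integrable_on {0..t}"
    using assms by (intro duhamel_integrand_integrable) auto
  then have "((\<lambda>s. heat_flow (t - s) (f s)) has_integral duhamel f t) {0..t}"
    unfolding duhamel_def by (rule integrable_integral)
  from has_integral_linear[OF has_integral_linear[OF this bounded_linear_heat_flow[of r]] bounded_linear_bcontfun_apply[of x]]
  have "((\<lambda>s. heat_flow r (heat_flow (t - s) (f s)) x) has_integral heat_flow r (duhamel f t) x) {0..t}"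
    by (simp add: o_def)
  then show ?thesis
    by (rule has_integral_eq[rotated]) (use r in \<open>simp add: heat_flow_semigroup add_diff_eq\<close>)
qed

lemma duhamel_apply_has_integral:
  assumes "continuous_on {0..T} f" "\<And>s. s \<in> {0..T} \<Longrightarrow> f s \<in> C0" "t \<le> T"
  shows "((\<lambda>s. heat_flow (t - s) (f s) x) has_integral duhamel f t x) {0..t}"
  using heat_flow_duhamel_has_integral[OF assms, of 0 x] by simp

lemma continuous_on_duhamel_integrand_apply:
  assumes "continuous_on {0..T} f" "\<And>s. s \<in> {0..T} \<Longrightarrow> f s \<in> C0" "S \<subseteq> {0..T}"
  shows "continuous_on S (\<lambda>s. heat_flow (t - s) (f s) x)"
  by (intro bounded_linear.continuous_on[OF bounded_linear_bcontfun_apply] continuous_on_duhamel_integrand[OF assms]) auto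

text \<open>
  The Lebesgue integral in the definition of a mild solution splits into the source term and the
  Duhamel term. Both integrands are absolutely integrable: the first is bounded by a multiple of
  \<open>s powr \<sigma>\<close>, the second is continuous.
\<close>

lemma mild_integral_eq:
  fixes u :: "real \<Rightarrow> (real ^ 'n::finite) \<Rightarrow>\<^sub>C real"
  assumes \<sigma>: "-1 < \<sigma>" and p: "1 < p" and w: "w \<in> C0"
    and u: "continuous_on {0..T} u" "\<And>s. s \<in> {0..T} \<Longrightarrow> u s \<in> C0" and t: "t \<in> {0..T}"
  shows "(LINT s:{0..t}|lborel. heat (t - s) (\<lambda>y. \<bar>u s y\<bar> powr p + s powr \<sigma> * w y) x) =
    source_flow \<sigma> w t x + duhamel (\<lambda>s. abs_powr p (u s)) t x"
proof -
  let ?A = "\<lambda>s. heat_flow (t - s) (abs_powr p (u s)) x"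
  let ?B = "\<lambda>s. s powr \<sigma> * heat_flow (t - s) w x"
  have F: "continuous_on {0..T} (\<lambda>s. abs_powr p (u s))" "\<And>s. s \<in> {0..T} \<Longrightarrow> abs_powr p (u s) \<in> C0"
    using u p by (auto intro!: continuous_intros)
  have "heat (t - s) (\<lambda>y. \<bar>u s y\<bar> powr p + s powr \<sigma> * w y) x = ?B s + ?A s" if "s \<in> {0..t}" for s
  proof -
    have "(\<lambda>y. \<bar>u s y\<bar> powr p + s powr \<sigma> * w y) = apply_bcontfun (abs_powr p (u s) + s powr \<sigma> *\<^sub>R w)"
      using p by auto
    then have "heat (t - s) (\<lambda>y. \<bar>u s y\<bar> powr p + s powr \<sigma> * w y) x = heat_flow (t - s) (abs_powr p (u s) + s powr \<sigma> *\<^sub>R w) x"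
      using that by (simp only: heat_flow_eq_heat) (simp add: heat_flow_eq_heat)
    then show ?thesis by (simp add: heat_flow_add heat_flow_scaleR)
  qed
  then have "(LINT s:{0..t}|lborel. heat (t - s) (\<lambda>y. \<bar>u s y\<bar> powr p + s powr \<sigma> * w y) x) = (LINT s:{0..t}|lborel. ?B s + ?A s)"
    by (intro set_lebesgue_integral_cong) auto
  moreover have "(LINT s:{0..t}|lborel. ?B s + ?A s) = (LINT s:{0..t}|lborel. ?B s) + (LINT s:{0..t}|lborel. ?A s)"
  and "(LINT s:{0..t}|lborel. ?B s) = source_flow \<sigma> w t x"
  and "(LINT s:{0..t}|lborel. ?A s) = duhamel (\<lambda>s. abs_powr p (u s)) t x"
  proof -
    have A: "set_integrable lborel {0..t} ?A"
      using t by (intro borel_integrable_atLeastAtMost' continuous_on_duhamel_integrand_apply[OF F]) auto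
    have Bi: "(?B has_integral source_flow \<sigma> w t x) {0..t}"
      using t by (intro source_flow_has_integral \<sigma> w) auto
    have B: "set_integrable lborel {0..t} ?B"
    proof (rule absolutely_integrable_imp_set_integrable_lborel)
      show "?B \<in> borel_measurable borel" using measurable_heat_flow_time[OF w] by measurable
      show "?B absolutely_integrable_on {0..t}"
      proof (rule absolutely_integrable_integrable_bound)
        show "norm (?B s) \<le> s powr \<sigma> * norm w" for s
          using norm_bounded[of "heat_flow (t - s) w" x] norm_heat_flow_le[of "t - s" w]
          by (simp add: abs_mult mult_left_mono)
        show "(\<lambda>s. s powr \<sigma> * norm w) integrable_on {0..t}"
          using has_integral_mult_left[OF has_integral_powr_from_0[of \<sigma> t]] \<sigma> t
          by (auto simp: integrable_on_def)
      qed (use Bi in blast)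
    qed
    show "(LINT s:{0..t}|lborel. ?B s + ?A s) = (LINT s:{0..t}|lborel. ?B s) + (LINT s:{0..t}|lborel. ?A s)"
      by (rule set_integral_add[OF B A])
    show "(LINT s:{0..t}|lborel. ?B s) = source_flow \<sigma> w t x"
      using set_borel_integral_eq_integral(2)[OF B] Bi by (simp add: integral_unique)
    show "(LINT s:{0..t}|lborel. ?A s) = duhamel (\<lambda>s. abs_powr p (u s)) t x"
      using set_borel_integral_eq_integral(2)[OF A] duhamel_apply_has_integral[OF F, of t x] t by (simp add: integral_unique)
  qed
  ultimately show ?thesis by simp
qed

definition forcing :: "real \<Rightarrow> ((real ^ 'n::finite) \<Rightarrow>\<^sub>C real) \<Rightarrow> ((real ^ 'n) \<Rightarrow>\<^sub>C real) \<Rightarrow> real \<Rightarrow> (real ^ 'n) \<Rightarrow>\<^sub>C real" where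
  "forcing \<sigma> w u0 t = heat_flow t u0 + source_flow \<sigma> w t"

lemma mild_solution_iff_solves:
  fixes w :: "(real ^ 'n::finite) \<Rightarrow>\<^sub>C real"
  assumes \<sigma>: "-1 < \<sigma>" and p: "1 < p" and w: "w \<in> C0"
  shows "mild_solution p \<sigma> w u0 T u \<longleftrightarrow> solves p (forcing \<sigma> w u0) T u"
proof -
  have "(\<forall>x. u t x = heat t u0 x +
          (LINT s:{0..t}|lborel. heat (t - s) (\<lambda>y. \<bar>u s y\<bar> powr p + s powr \<sigma> * w y) x)) \<longleftrightarrow>
      u t = forcing \<sigma> w u0 t + duhamel (\<lambda>s. abs_powr p (u s)) t"
    if u: "continuous_on {0..T} u" "\<forall>s\<in>{0..T}. u s \<in> C0" and t: "t \<in> {0..T}" for t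
  proof -
    have "heat t u0 x + (LINT s:{0..t}|lborel. heat (t - s) (\<lambda>y. \<bar>u s y\<bar> powr p + s powr \<sigma> * w y) x) =
        (forcing \<sigma> w u0 t + duhamel (\<lambda>s. abs_powr p (u s)) t) x" for x
      using mild_integral_eq[OF \<sigma> p w u(1) _ t, of x] u(2) t by (simp add: forcing_def heat_flow_eq_heat)
    then show ?thesis by (auto intro: bcontfun_eqI)
  qed
  then show ?thesis unfolding mild_solution_def solves_def by blast
qed


section \<open>The maximal solution\<close>

context
  fixes \<sigma> p :: real and w u0 :: "(real ^ 'n::finite) \<Rightarrow>\<^sub>C real"
  assumes \<sigma>: "-1 < \<sigma>" and p: "1 < p" and w: "w \<in> C0" and u0: "u0 \<in> C0"
begin

lemma continuous_on_forcing: "continuous_on {0..T} (forcing \<sigma> w u0)"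
  unfolding forcing_def using u0 by (intro continuous_intros continuous_on_source_flow \<sigma> w)

lemma C0_forcing: "forcing \<sigma> w u0 t \<in> C0"
  unfolding forcing_def using u0 by (intro C0_add C0_heat_flow C0_source_flow \<sigma> w)

text \<open>
  The time \<open>\<delta>\<close> by which a solution can be continued depends only on a bound \<open>R\<close> for the starting time
  and a bound \<open>M\<close> for the norm there. Blow-up at a finite maximal time follows from this uniformity.
\<close>

lemma uniform_extension:
  assumes R: "0 \<le> R" and M: "0 \<le> M"
  obtains \<delta> where "0 < \<delta>" "\<And>r u. r \<in> {0..R} \<Longrightarrow> solves p (forcing \<sigma> w u0) r u \<Longrightarrow> norm (u r) \<le> M \<Longrightarrow>
      \<exists>u'. solves p (forcing \<sigma> w u0) (r + \<delta>) u'"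
proof -
  let ?G = "forcing \<sigma> w u0"
  obtain K0 where K0: "0 < K0" "\<And>t. t \<in> {0..R + 1} \<Longrightarrow> norm (?G t) \<le> K0"
    using bounded_on_interval[OF continuous_on_forcing] by metis
  \<comment> \<open>The restarted equation has forcing \<open>?G (r + t) + heat_flow t (u r - ?G r)\<close>,
    whose three terms are bounded by \<open>K0\<close>, \<open>M\<close> and \<open>K0\<close>.\<close>
  define K where "K = 2 * K0 + M"
  have K: "0 < K" using K0 M by (simp add: K_def)
  define \<delta> where "\<delta> = min 1 (min (K / (2 * K) powr p) (1 / (2 * (p * (2 * K) powr (p - 1)))))"
  have \<delta>: "0 < \<delta>" "\<delta> \<le> 1" using K p by (auto simp: \<delta>_def)
  show thesis
  proof (rule that[OF \<delta>(1)])
    fix r u assume r: "r \<in> {0..R}" and u: "solves p ?G r u" and ur: "norm (u r) \<le> M"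
    have "\<exists>v. solves p (\<lambda>t. ?G (r + t) + heat_flow t (u r - ?G r)) \<delta> v"
    proof (rule local_existence[OF p K])
      have "\<delta> \<le> K / (2 * K) powr p" by (simp add: \<delta>_def)
      then show "\<delta> * (2 * K) powr p \<le> K" using K by (simp add: field_simps)
      have "\<delta> \<le> 1 / (2 * (p * (2 * K) powr (p - 1)))" by (simp add: \<delta>_def)
      then have "\<delta> * (2 * (p * (2 * K) powr (p - 1))) \<le> 1"
        using K p by (subst (asm) pos_le_divide_eq) auto
      then show "\<delta> * (p * (2 * K) powr (p - 1)) \<le> 1 / 2" by simp
      have C0: "u r - ?G r \<in> C0" using solvesD(2)[OF u, of r] r C0_forcing by auto
      show "continuous_on {0..\<delta>} (\<lambda>t. ?G (r + t) + heat_flow t (u r - ?G r))"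
        using r \<delta> C0
        by (intro continuous_intros continuous_on_compose2[OF continuous_on_forcing[of "R + 1"]]) auto
      show "?G (r + t) + heat_flow t (u r - ?G r) \<in> C0 \<and> norm (?G (r + t) + heat_flow t (u r - ?G r)) \<le> K"
        if t: "t \<in> {0..\<delta>}" for t
      proof
        show "?G (r + t) + heat_flow t (u r - ?G r) \<in> C0" using C0 C0_forcing by auto
        have "norm (?G (r + t) + heat_flow t (u r - ?G r)) \<le> norm (?G (r + t)) + norm (u r - ?G r)"
          using norm_heat_flow_le[of t "u r - ?G r"] norm_triangle_ineq[of "?G (r + t)"] by (smt (verit))
        also have "\<dots> \<le> K0 + (M + K0)"
          using K0(2)[of "r + t"] K0(2)[of r] ur r t \<delta> norm_triangle_ineq4[of "u r" "?G r"] by auto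
        finally show "norm (?G (r + t) + heat_flow t (u r - ?G r)) \<le> K" by (simp add: K_def)
      qed
    qed (use \<delta> in auto)
    then show "\<exists>u'. solves p ?G (r + \<delta>) u'"
      using solves_extend[OF u p] r \<delta> by auto
  qed
qed

lemma T_max_eq: "T_max p \<sigma> w u0 = Sup {ereal t |t. 0 < t \<and> (\<exists>u. solves p (forcing \<sigma> w u0) t u)}"
  unfolding T_max_def mild_solution_iff_solves[OF \<sigma> p w] ..

lemma solves_le_T_max:
  assumes "0 < t" "solves p (forcing \<sigma> w u0) t u"
  shows "ereal t \<le> T_max p \<sigma> w u0"
  unfolding T_max_eq using assms by (intro Sup_upper) auto

lemma T_max_pos: "0 < T_max p \<sigma> w u0"
proof -
  have G0: "forcing \<sigma> w u0 0 = u0" using \<sigma> w by (simp add: forcing_def)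
  have "solves p (forcing \<sigma> w u0) 0 (\<lambda>_. u0)"
    unfolding solves_def using u0 by (simp add: G0)
  moreover obtain \<delta> where "0 < \<delta>" "\<And>r u. r \<in> {0..0} \<Longrightarrow> solves p (forcing \<sigma> w u0) r u \<Longrightarrow> norm (u r) \<le> norm u0 \<Longrightarrow>
      \<exists>u'. solves p (forcing \<sigma> w u0) (r + \<delta>) u'"
    using uniform_extension[of 0 "norm u0"] by auto
  ultimately obtain u where "solves p (forcing \<sigma> w u0) \<delta> u"
    by (metis add_0 atLeastAtMost_iff order_refl)
  then show ?thesis
    using solves_le_T_max[OF \<open>0 < \<delta>\<close>] \<open>0 < \<delta>\<close> by (metis ereal_less(2) less_le_trans)
qed

lemma maximal_solution_iff:
  "maximal_solution p \<sigma> w u0 u \<longleftrightarrow>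
    (\<forall>T. 0 < T \<and> ereal T < T_max p \<sigma> w u0 \<longrightarrow> solves p (forcing \<sigma> w u0) T u)"
  unfolding maximal_solution_def using mild_solution_iff_solves[OF \<sigma> p w] T_max_pos by simp

lemma solves_below_T_max:
  assumes "ereal T < T_max p \<sigma> w u0"
  shows "\<exists>u. solves p (forcing \<sigma> w u0) T u"
proof -
  obtain t u where "T < t" "solves p (forcing \<sigma> w u0) t u"
    using assms unfolding T_max_eq less_Sup_iff by auto
  then show ?thesis using solves_subinterval[of p "forcing \<sigma> w u0" t u T] by auto
qed

text \<open>
  By uniqueness it does not matter which solution on \<open>{0..t}\<close> is used to define the value at \<open>t\<close>.
\<close>

lemma maximal_solution_exists: "\<exists>u. maximal_solution p \<sigma> w u0 u"
proof -
  let ?G = "forcing \<sigma> w u0"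
  define u where "u t = (SOME v. solves p ?G t v) t" for t
  have "solves p ?G T u" if T: "ereal T < T_max p \<sigma> w u0" for T
  proof -
    obtain v where v: "solves p ?G T v" using solves_below_T_max[OF T] by blast
    have "v t = u t" if t: "t \<in> {0..T}" for t
    proof -
      have vt: "solves p ?G t v" using solves_subinterval[OF v] t by auto
      then have "solves p ?G t (SOME v. solves p ?G t v)" by (rule someI[of "solves p ?G t"])
      then show ?thesis unfolding u_def using solves_unique[OF p vt] t by auto
    qed
    then show ?thesis using solves_cong v by blast
  qed
  then show ?thesis using maximal_solution_iff by blast
qed

text \<open>
  If the norm stayed below \<open>Z\<close> at times arbitrarily close to the maximal time, then
  \<open>uniform_extension\<close> would continue the solution beyond it.
\<close>

lemma norm_tendsto_infinity_at_T_max: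
  assumes fin: "T_max p \<sigma> w u0 < \<infinity>" and u: "maximal_solution p \<sigma> w u0 u"
  shows "filterlim (\<lambda>t. norm (u t)) at_top (at_left (real_of_ereal (T_max p \<sigma> w u0)))"
proof -
  let ?G = "forcing \<sigma> w u0"
  define b where "b = real_of_ereal (T_max p \<sigma> w u0)"
  have b: "T_max p \<sigma> w u0 = ereal b" "0 < b"
    using fin T_max_pos unfolding b_def by (cases "T_max p \<sigma> w u0"; auto)+
  have "filterlim (\<lambda>t. norm (u t)) at_top (at_left b)"
    unfolding filterlim_at_top
  proof
    fix Z
    obtain \<delta> where \<delta>: "0 < \<delta>" "\<And>r u. r \<in> {0..b} \<Longrightarrow> solves p ?G r u \<Longrightarrow> norm (u r) \<le> max Z 0 \<Longrightarrow>
        \<exists>u'. solves p ?G (r + \<delta>) u'"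
      using uniform_extension[of b "max Z 0"] b by auto
    have "Z \<le> norm (u t)" if t: "max 0 (b - \<delta>) < t" "t < b" for t
    proof (rule ccontr)
      assume "\<not> Z \<le> norm (u t)"
      then have "norm (u t) \<le> max Z 0" by linarith
      moreover have "solves p ?G t u"
        using u t b unfolding maximal_solution_iff by auto
      ultimately obtain u' where "solves p ?G (t + \<delta>) u'"
        using \<delta>(2)[of t u] t by auto
      then have "ereal (t + \<delta>) \<le> ereal b"
        using solves_le_T_max[of "t + \<delta>" u'] t \<delta> b by auto
      then show False using t by simp
    qed
    moreover have "max 0 (b - \<delta>) < b" using \<delta> b by auto
    ultimately show "\<forall>\<^sub>F t in at_left b. Z \<le> norm (u t)"
      unfolding eventually_at_left_field by blast
  qed
  then show ?thesis by (simp add: b_def)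
qed

lemma blows_up_if_not_global:
  "T_max p \<sigma> w u0 < \<infinity> \<Longrightarrow> blows_up_in_finite_time p \<sigma> w u0"
  unfolding blows_up_in_finite_time_def
  using maximal_solution_exists norm_tendsto_infinity_at_T_max by blast

lemma exists_globally_if_bounded:
  assumes bound: "\<And>T. 0 < T \<Longrightarrow> \<exists>C. \<forall>r u. 0 < r \<and> r \<le> T \<and> solves p (forcing \<sigma> w u0) r u \<longrightarrow> norm (u r) \<le> C"
  shows "exists_globally p \<sigma> w u0"
proof -
  have "T_max p \<sigma> w u0 = \<infinity>"
  proof (rule ccontr)
    assume "T_max p \<sigma> w u0 \<noteq> \<infinity>"
    then have fin: "T_max p \<sigma> w u0 < \<infinity>" by (simp add: less_top)
    define b where "b = real_of_ereal (T_max p \<sigma> w u0)"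
    have b: "T_max p \<sigma> w u0 = ereal b" "0 < b"
      using fin T_max_pos unfolding b_def by (cases "T_max p \<sigma> w u0"; auto)+
    obtain u where u: "maximal_solution p \<sigma> w u0 u" using maximal_solution_exists by blast
    obtain C where C: "\<And>r u. 0 < r \<Longrightarrow> r \<le> b \<Longrightarrow> solves p (forcing \<sigma> w u0) r u \<Longrightarrow> norm (u r) \<le> C"
      using bound[OF b(2)] by blast
    have "\<forall>\<^sub>F t in at_left b. C + 1 \<le> norm (u t)"
      using norm_tendsto_infinity_at_T_max[OF fin u] unfolding filterlim_at_top b_def by blast
    then obtain a where a: "a < b" "\<And>t. a < t \<Longrightarrow> t < b \<Longrightarrow> C + 1 \<le> norm (u t)"
      unfolding eventually_at_left_field by blast
    obtain t where t: "max a 0 < t" "t < b" using dense[of "max a 0" b] a b by auto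
    have "solves p (forcing \<sigma> w u0) t u" using u t b unfolding maximal_solution_iff by auto
    then have "norm (u t) \<le> C" using C t by auto
    with a(2)[of t] t show False by auto
  qed
  then show ?thesis
    unfolding exists_globally_def using maximal_solution_exists by blast
qed

end

section \<open>Blow-up below the critical exponent\<close>

text \<open>
  With \<open>b\<^sup>p = a\<close> the sum \<open>y\<^sup>p + a\<close> dominates \<open>(y + b)\<^sup>p\<close> up to the factor \<open>2\<^sup>p\<close>, so \<open>(y + b) powr (1 - p)\<close>
  decreases at least at the rate \<open>c\<close>. It starts below \<open>b powr (1 - p)\<close> and stays nonnegative.
\<close>

lemma superlinear_lifespan_nonneg:
  fixes y D :: "real \<Rightarrow> real"
  assumes p: "1 < p" and a: "0 < a" and L: "0 \<le> L"
    and cont: "continuous_on {0..L} y" and nonneg: "\<And>t. t \<in> {0..L} \<Longrightarrow> 0 \<le> y t"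
    and der: "\<And>t. 0 < t \<Longrightarrow> t < L \<Longrightarrow> (y has_real_derivative D t) (at t)"
    and D: "\<And>t. 0 < t \<Longrightarrow> t < L \<Longrightarrow> y t powr p + a \<le> D t"
  shows "L \<le> 2 powr p / (p - 1) * a powr ((1 - p) / p)"
proof -
  define b where "b = a powr (1 / p)"
  have b: "0 < b" "b powr p = a" using a p by (simp_all add: b_def powr_powr)
  define c where "c = (p - 1) / 2 powr p"
  have c: "0 < c" using p by (simp add: c_def)
  have key: "(z + b) powr p \<le> 2 powr p * (z powr p + a)" if "0 \<le> z" for z
  proof -
    have "(z + b) powr p \<le> (2 * max z b) powr p" using that b p by (intro powr_mono2) auto
    also have "\<dots> = 2 powr p * max z b powr p" using that by (simp add: powr_mult)
    also have "max z b powr p \<le> z powr p + a" using a b that by (cases "z \<le> b") (auto simp: max_def)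
    finally show ?thesis by simp
  qed
  have "(y L + b) powr (1 - p) + c * L \<le> (y 0 + b) powr (1 - p) + c * 0"
  proof (rule DERIV_nonpos_imp_decreasing_open[OF L])
    fix t assume t: "0 < t" "t < L"
    let ?d = "(1 - p) * (y t + b) powr (1 - p - 1) * D t + c"
    have Y: "0 < y t + b" using nonneg[of t] t b by auto
    have "((\<lambda>t. (y t + b) powr (1 - p) + c * t) has_real_derivative ?d) (at t)"
      using Y by (auto intro!: derivative_eq_intros der[OF t])
    moreover have "?d \<le> 0"
    proof -
      have "1 = (y t + b) powr (- p) * (y t + b) powr p" using Y by (simp add: powr_add[symmetric])
      also have "\<dots> \<le> (y t + b) powr (- p) * (2 powr p * D t)"
        using key[of "y t"] nonneg[of t] D[OF t] t by (intro mult_left_mono) (auto intro: order_trans)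
      finally have "(p - 1) * 1 \<le> (p - 1) * ((y t + b) powr (- p) * (2 powr p * D t))"
        using p by (intro mult_left_mono) auto
      then have "p - 1 \<le> ((p - 1) * (y t + b) powr (- p) * D t) * 2 powr p"
        by (simp only: mult_ac mult_1_left mult_1_right)
      then have "c \<le> (p - 1) * (y t + b) powr (- p) * D t"
        unfolding c_def by (subst pos_divide_le_eq) simp_all
      then show ?thesis by (simp add: algebra_simps)
    qed
    ultimately show "\<exists>d. ((\<lambda>t. (y t + b) powr (1 - p) + c * t) has_real_derivative d) (at t) \<and> d \<le> 0" by blast
  next
    show "continuous_on {0..L} (\<lambda>t. (y t + b) powr (1 - p) + c * t)"
      using b nonneg by (intro continuous_intros cont) (auto simp: add_nonneg_eq_0_iff)
  qed
  then have "c * L \<le> (y 0 + b) powr (1 - p)"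
    using powr_ge_zero[of "y L + b" "1 - p"] by linarith
  also have "\<dots> \<le> b powr (1 - p)"
    using b nonneg[of 0] L p by (intro powr_mono2') auto
  also have "\<dots> = a powr ((1 - p) / p)" by (simp add: b_def powr_powr)
  finally have "L \<le> a powr ((1 - p) / p) / c" using c by (simp add: pos_le_divide_eq mult.commute)
  then show ?thesis by (simp add: c_def mult.commute)
qed

text \<open>
  The solution increases, hence has a constant sign on one half of the interval. If it is
  negative on the first half, reversing time and sign there leads back to the nonnegative case.
  The initial value does not enter the bound.
\<close>

lemma superlinear_lifespan:
  fixes y D :: "real \<Rightarrow> real"
  assumes p: "1 < p" and a: "0 < a" and L: "0 \<le> L" and cont: "continuous_on {0..L} y"
    and der: "\<And>t. 0 < t \<Longrightarrow> t < L \<Longrightarrow> (y has_real_derivative D t) (at t)"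
    and D: "\<And>t. 0 < t \<Longrightarrow> t < L \<Longrightarrow> \<bar>y t\<bar> powr p + a \<le> D t"
  shows "L \<le> 2 * (2 powr p / (p - 1) * a powr ((1 - p) / p))"
proof -
  let ?C = "2 powr p / (p - 1) * a powr ((1 - p) / p)"
  have mono: "y s \<le> y t" if "0 \<le> s" "s \<le> t" "t \<le> L" for s t
  proof (rule DERIV_nonneg_imp_increasing_open[OF that(2)])
    fix x assume "s < x" "x < t"
    then have x: "0 < x" "x < L" using that by auto
    have "0 \<le> \<bar>y x\<bar> powr p + a" using a by simp
    then show "\<exists>d. (y has_real_derivative d) (at x) \<and> 0 \<le> d"
      using der[OF x] D[OF x] order_trans by blast
  qed (use continuous_on_subset[OF cont, of "{s..t}"] that in auto)
  have "L / 2 \<le> ?C"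
  proof (cases "0 \<le> y (L / 2)")
    case True
    have pos: "0 \<le> y (L / 2 + t)" if "t \<in> {0..L / 2}" for t
      using True mono[of "L / 2" "L / 2 + t"] that L by auto
    show ?thesis
    proof (rule superlinear_lifespan_nonneg[OF p a, where y = "\<lambda>t. y (L / 2 + t)" and D = "\<lambda>t. D (L / 2 + t)"])
      show "continuous_on {0..L / 2} (\<lambda>t. y (L / 2 + t))"
        using L by (intro continuous_on_compose2[OF cont] continuous_intros) auto
      fix t assume t: "0 < t" "t < L / 2"
      show "((\<lambda>t. y (L / 2 + t)) has_real_derivative D (L / 2 + t)) (at t)"
        using DERIV_shift[of y "D (L / 2 + t)" t "L / 2"] der[of "L / 2 + t"] t by (simp add: add.commute)
      show "y (L / 2 + t) powr p + a \<le> D (L / 2 + t)"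
        using D[of "L / 2 + t"] pos[of t] t by simp
    qed (use L pos in auto)
  next
    case False
    have neg: "y (L / 2 - t) \<le> 0" if "t \<in> {0..L / 2}" for t
      using False mono[of "L / 2 - t" "L / 2"] that L by auto
    show ?thesis
    proof (rule superlinear_lifespan_nonneg[OF p a, where y = "\<lambda>t. - y (L / 2 - t)" and D = "\<lambda>t. D (L / 2 - t)"])
      show "continuous_on {0..L / 2} (\<lambda>t. - y (L / 2 - t))"
        using L by (intro continuous_on_minus continuous_on_compose2[OF cont] continuous_intros) auto
      fix t assume t: "0 < t" "t < L / 2"
      have "((\<lambda>t. L / 2 - t) has_real_derivative - 1) (at t)"
        by (auto intro!: derivative_eq_intros)
      from DERIV_minus[OF DERIV_chain2[OF der this]] t
      show "((\<lambda>t. - y (L / 2 - t)) has_real_derivative D (L / 2 - t)) (at t)" by simp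
      show "(- y (L / 2 - t)) powr p + a \<le> D (L / 2 - t)"
        using D[of "L / 2 - t"] neg[of t] t by simp
    qed (use L neg in auto)
  qed
  then show ?thesis by linarith
qed

text \<open>
  Up to the normalising factor the heat average at the origin tends to the integral of \<open>w\<close>.
\<close>

lemma heat_flow_origin_lower_bound:
  fixes w :: "(real ^ 'n::finite) \<Rightarrow>\<^sub>C real"
  assumes w: "integrable lborel w" and I: "0 < (\<integral>x. w x \<partial>lborel)"
  obtains \<tau>0 where "0 < \<tau>0" "\<And>\<tau>. \<tau>0 \<le> \<tau> \<Longrightarrow>
     (4 * pi * \<tau>) powr (- real CARD('n) / 2) * ((\<integral>x. w x \<partial>lborel) / 2) \<le> heat_flow \<tau> w 0"
proof -
  let ?I = "\<integral>x. w x \<partial>lborel"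
  have "((\<lambda>\<tau>. \<integral>y. exp (- (norm (0 - y))\<^sup>2 / (4 * \<tau>)) * w y \<partial>lborel) \<longlongrightarrow> ?I) at_top"
  proof (rule integral_dominated_convergence_at_top[where w = "\<lambda>y. \<bar>w y\<bar>"])
    show "\<forall>\<^sub>F \<tau> in at_top. AE y in lborel. norm (exp (- (norm (0 - y))\<^sup>2 / (4 * \<tau>)) * w y) \<le> \<bar>w y\<bar>"
      using eventually_gt_at_top[of 0]
      by eventually_elim (auto simp: abs_mult intro!: AE_I2 mult_left_le_one_le)
    have "((\<lambda>\<tau>. exp (- (norm (0 - y))\<^sup>2 / (4 * \<tau>)) * w y) \<longlongrightarrow> exp 0 * w y) at_top" for y :: "real ^ 'n"
    proof (intro tendsto_intros)
      have "((\<lambda>\<tau>. (- (norm (0 - y))\<^sup>2 / 4) / \<tau>) \<longlongrightarrow> 0) at_top"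
        by (rule real_tendsto_divide_at_top[OF tendsto_const filterlim_ident])
      then show "((\<lambda>\<tau>. - (norm (0 - y))\<^sup>2 / (4 * \<tau>)) \<longlongrightarrow> 0) at_top" by simp
    qed
    then show "AE y in lborel. ((\<lambda>\<tau>. exp (- (norm (0 - y))\<^sup>2 / (4 * \<tau>)) * w y) \<longlongrightarrow> w y) at_top" by simp
  qed (use w in auto)
  then have "\<forall>\<^sub>F \<tau> in at_top. ?I / 2 < (\<integral>y. exp (- (norm (0 - y))\<^sup>2 / (4 * \<tau>)) * w y \<partial>lborel)"
    by (rule order_tendstoD) (use I in simp)
  then obtain \<tau>1 where \<tau>1: "\<And>\<tau>. \<tau>1 \<le> \<tau> \<Longrightarrow> ?I / 2 < (\<integral>y. exp (- (norm (0 - y))\<^sup>2 / (4 * \<tau>)) * w y \<partial>lborel)"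
    unfolding eventually_at_top_linorder by blast
  show thesis
  proof (rule that[of "max \<tau>1 1"])
    fix \<tau> assume "max \<tau>1 1 \<le> \<tau>"
    then have \<tau>: "\<tau>1 \<le> \<tau>" "0 < \<tau>" by auto
    then show "(4 * pi * \<tau>) powr (- real CARD('n) / 2) * (?I / 2) \<le> heat_flow \<tau> w 0"
      using \<tau>1[OF \<tau>(1)] by (simp add: heat_flow_eq_heat heat_def mult_left_mono)
  qed simp
qed

text \<open>
  The average \<open>m t\<close> of \<open>u t\<close> against the heat kernel at time \<open>2 * T - t\<close> sees the integral equation as
  \<open>m t = const + integral {0..t} k\<close>. The horizon \<open>2 * T\<close> keeps the kernel times in \<open>{T..2 * T}\<close>, where the
  average of \<open>w\<close> is bounded below by \<open>B\<close>.
\<close>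

lemma heat_average_lifespan:
  fixes w u0 :: "(real ^ 'n::finite) \<Rightarrow>\<^sub>C real"
  assumes \<sigma>: "-1 < \<sigma>" "\<sigma> < 0" and p: "1 < p" and w: "w \<in> C0" and u0: "u0 \<in> C0"
    and T: "0 < T" and u: "solves p (forcing \<sigma> w u0) T u"
    and B: "0 < B" "\<And>\<tau>. \<tau> \<in> {T..2 * T} \<Longrightarrow> B \<le> heat_flow \<tau> w 0"
  shows "T \<le> 2 * (2 powr p / (p - 1) * (T powr \<sigma> * B) powr ((1 - p) / p))"
proof -
  define m where "m = (\<lambda>t. heat_flow (2 * T - t) (u t) 0)"
  define k where "k = (\<lambda>s. s powr \<sigma> * heat_flow (2 * T - s) w 0 + heat_flow (2 * T - s) (abs_powr p (u s)) 0)"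
  have F: "continuous_on {0..T} (\<lambda>s. abs_powr p (u s))" "\<And>s. s \<in> {0..T} \<Longrightarrow> abs_powr p (u s) \<in> C0"
    using solvesD(1,2)[OF u] p by (auto intro!: continuous_intros)
  have m_eq: "(k has_integral m t - heat_flow (2 * T) u0 0) {0..t}" if t: "t \<in> {0..T}" for t
  proof -
    have "heat_flow (2 * T - t) (u t) = heat_flow (2 * T - t) (heat_flow t u0) +
        heat_flow (2 * T - t) (source_flow \<sigma> w t) + heat_flow (2 * T - t) (duhamel (\<lambda>s. abs_powr p (u s)) t)"
      by (subst solvesD(3)[OF u t]) (simp add: forcing_def heat_flow_add)
    also have "heat_flow (2 * T - t) (heat_flow t u0) = heat_flow (2 * T) u0"
      using t by (subst heat_flow_semigroup) auto
    finally have "m t - heat_flow (2 * T) u0 0 = heat_flow (2 * T - t) (source_flow \<sigma> w t) 0 +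
        heat_flow (2 * T - t) (duhamel (\<lambda>s. abs_powr p (u s)) t) 0"
      by (simp add: m_def)
    moreover have "((\<lambda>s. s powr \<sigma> * heat_flow (2 * T - t + t - s) w 0) has_integral heat_flow (2 * T - t) (source_flow \<sigma> w t) 0) {0..t}"
      using t by (intro heat_flow_source_has_integral \<sigma> w) auto
    moreover have "((\<lambda>s. heat_flow (2 * T - t + t - s) (abs_powr p (u s)) 0) has_integral
        heat_flow (2 * T - t) (duhamel (\<lambda>s. abs_powr p (u s)) t) 0) {0..t}"
      using t by (intro heat_flow_duhamel_has_integral[OF F]) auto
    ultimately show ?thesis
      unfolding k_def by (simp add: has_integral_add)
  qed
  \<comment> \<open>The factor \<open>s powr \<sigma>\<close> makes \<open>k\<close> unbounded near 0; the derivative is only needed at later times.\<close>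
  have k_cont: "continuous (at s within {0..T}) k" if s: "s \<in> {0<..T}" for s
  proof -
    have "continuous_on {0<..T} k"
      unfolding k_def using w
      by (intro continuous_intros bounded_linear.continuous_on[OF bounded_linear_bcontfun_apply]
        continuous_on_duhamel_integrand_apply[OF F]) auto
    then have "continuous (at s within {0<..T}) k" using s by (simp add: continuous_on_eq_continuous_within)
    moreover have "at s within {0<..T} = at s within {0..T}"
      using s by (intro at_within_nhd[of _ "{0<..}"]) auto
    ultimately show ?thesis by simp
  qed
  show ?thesis
  proof (rule superlinear_lifespan[OF p, where y = m and D = k])
    show "0 < T powr \<sigma> * B" "0 \<le> T" using T B by auto
    show "continuous_on {0..T} m"
      unfolding m_def using solvesD(1,2)[OF u]
      by (intro bounded_linear.continuous_on[OF bounded_linear_bcontfun_apply] continuous_intros) auto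
    fix t assume t: "0 < t" "t < T"
    have "((\<lambda>t. integral {0..t} k) has_vector_derivative k t) (at t within ({0..T} - {}))"
      using t T m_eq[of T] k_cont[of t]
      by (intro integral_has_vector_derivative_continuous_at) auto
    then have "((\<lambda>t. integral {0..t} k + heat_flow (2 * T) u0 0) has_real_derivative k t) (at t within {0..T})"
      unfolding has_real_derivative_iff_has_vector_derivative[symmetric]
      by (auto intro!: derivative_eq_intros)
    then have "(m has_real_derivative k t) (at t within {0..T})"
      by (rule has_field_derivative_transform_within[where d = 1])
        (use t integral_unique[OF m_eq] in auto)
    moreover have "at t within {0..T} = at t" using t by (intro at_within_interior) simp
    ultimately show "(m has_real_derivative k t) (at t)" by simp
    have "T powr \<sigma> * B \<le> t powr \<sigma> * heat_flow (2 * T - t) w 0"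
      using t T B \<sigma> by (intro mult_mono powr_mono2') auto
    moreover have "\<bar>m t\<bar> powr p \<le> heat_flow (2 * T - t) (abs_powr p (u t)) 0"
    proof -
      have "\<bar>m t\<bar> powr p \<le> heat_flow (2 * T - t) (abs_powr 1 (u t)) 0 powr p"
        unfolding m_def using p by (intro powr_mono2 abs_heat_flow_le) auto
      also have "\<dots> \<le> heat_flow (2 * T - t) (abs_powr p (u t)) 0"
        using heat_flow_Jensen[of 1 p] p by simp
      finally show ?thesis .
    qed
    ultimately show "\<bar>m t\<bar> powr p + T powr \<sigma> * B \<le> k t" by (simp add: k_def)
  qed
qed

text \<open>
  Here \<open>e\<close> is the exponent of \<open>T\<close> in the lifespan bound. Subcriticality of \<open>p\<close> says precisely that
  \<open>e < 1\<close>, so the bound on \<open>T powr (1 - e)\<close> excludes solutions on long intervals.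
\<close>

theorem finite_time_blow_up:
  fixes w u0 :: "(real ^ 'n::finite) \<Rightarrow>\<^sub>C real"
  assumes \<sigma>: "-1 < \<sigma>" "\<sigma> < 0" and p: "1 < p"
    and subcritical: "p * (real CARD('n) - 2 - 2 * \<sigma>) < real CARD('n) - 2 * \<sigma>"
    and w: "w \<in> C0" "integrable lborel w" and I: "0 < (\<integral>x. w x \<partial>lborel)" and u0: "u0 \<in> C0"
  shows "blows_up_in_finite_time p \<sigma> w u0"
proof (rule blows_up_if_not_global[OF \<sigma>(1) p w(1) u0])
  let ?N = "real CARD('n)" and ?I = "\<integral>x. w x \<partial>lborel"
  obtain \<tau>0 where \<tau>0: "0 < \<tau>0" "\<And>\<tau>. \<tau>0 \<le> \<tau> \<Longrightarrow> (4 * pi * \<tau>) powr (- ?N / 2) * (?I / 2) \<le> heat_flow \<tau> w 0"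
    using heat_flow_origin_lower_bound[OF w(2) I] by blast
  define c where "c = (8 * pi) powr (- ?N / 2) * (?I / 2)"
  have c: "0 < c" using I by (simp add: c_def)
  define e where "e = (?N / 2 - \<sigma>) * (p - 1) / p"
  have e: "e < 1" using subcritical p by (simp add: e_def field_simps)
  define C where "C = 2 * (2 powr p / (p - 1) * c powr ((1 - p) / p))"
  have bound: "T powr (1 - e) \<le> C" if T: "\<tau>0 \<le> T" and u: "solves p (forcing \<sigma> w u0) T u" for T u
  proof -
    have T0: "0 < T" using T \<tau>0 by simp
    have "T \<le> 2 * (2 powr p / (p - 1) * (T powr \<sigma> * (c * T powr (- ?N / 2))) powr ((1 - p) / p))"
    proof (rule heat_average_lifespan[OF \<sigma> p w(1) u0 T0 u])
      show "0 < c * T powr (- ?N / 2)" using c T0 by simp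
      fix \<tau> assume \<tau>: "\<tau> \<in> {T..2 * T}"
      have "(8 * pi * T) powr (- ?N / 2) \<le> (4 * pi * \<tau>) powr (- ?N / 2)"
        using \<tau> T0 by (intro powr_mono2') auto
      then have "(8 * pi * T) powr (- ?N / 2) * (?I / 2) \<le> (4 * pi * \<tau>) powr (- ?N / 2) * (?I / 2)"
        using I by (intro mult_right_mono) auto
      then show "c * T powr (- ?N / 2) \<le> heat_flow \<tau> w 0"
        using \<tau>0(2)[of \<tau>] \<tau> T T0 by (simp add: c_def powr_mult mult_ac)
    qed
    also have "(T powr \<sigma> * (c * T powr (- ?N / 2))) powr ((1 - p) / p) = c powr ((1 - p) / p) * T powr e"
    proof -
      have "T powr \<sigma> * (c * T powr (- ?N / 2)) = c * T powr (\<sigma> - ?N / 2)"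
        using powr_add[of T \<sigma> "- ?N / 2"] by simp
      moreover have "(\<sigma> - ?N / 2) * ((1 - p) / p) = e" using p by (simp add: e_def field_simps)
      ultimately show ?thesis using c by (simp only: powr_powr) (subst powr_mult; simp only: powr_powr powr_ge_zero less_imp_le)
    qed
    finally have "T \<le> C * T powr e" by (simp add: C_def)
    then have "T * T powr (- e) \<le> C * T powr e * T powr (- e)" by (intro mult_right_mono) auto
    then show ?thesis
      using T0 by (simp add: powr_add[symmetric] powr_diff powr_minus divide_inverse mult.assoc)
  qed
  define T where "T = max \<tau>0 ((C + 1) powr (1 / (1 - e)))"
  have T: "\<tau>0 \<le> T" "C + 1 \<le> T powr (1 - e)"
  proof -
    have "0 < C + 1" using c p by (simp add: C_def add_pos_pos)
    then have "C + 1 = ((C + 1) powr (1 / (1 - e))) powr (1 - e)" using e by (simp add: powr_powr)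
    also have "\<dots> \<le> T powr (1 - e)" using e by (intro powr_mono2) (auto simp: T_def)
    finally show "C + 1 \<le> T powr (1 - e)" .
  qed (simp add: T_def)
  have "\<not> ereal T < T_max p \<sigma> w u0"
    using bound[OF T(1)] T(2) solves_below_T_max[OF \<sigma>(1) p w(1) u0, of T] by fastforce
  then show "T_max p \<sigma> w u0 < \<infinity>"
    by (metis ereal_infty_less(1) not_less less_ereal.simps(4))
qed

section \<open>Smoothing estimates in Lebesgue spaces\<close>

text \<open>
  The integral is the one with values in the extended nonnegative reals, so that the bound
  includes membership in the Lebesgue space.
\<close>

definition Lq_le :: "real \<Rightarrow> real \<Rightarrow> (real ^ 'n::finite \<Rightarrow> real) \<Rightarrow> bool" where
  "Lq_le q c f \<longleftrightarrow> f \<in> borel_measurable borel \<and>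
     (\<integral>\<^sup>+ x. ennreal (\<bar>f x\<bar> powr q) \<partial>lborel) \<le> ennreal (c powr q)"

lemma Lq_leD:
  assumes "Lq_le q c f"
  shows "f \<in> borel_measurable borel" and "(\<integral>\<^sup>+ x. ennreal (\<bar>f x\<bar> powr q) \<partial>lborel) \<le> ennreal (c powr q)"
  using assms by (auto simp: Lq_le_def)

lemma Lq_le_mono:
  assumes f: "Lq_le q c f" and g: "g \<in> borel_measurable borel" "\<And>x. \<bar>g x\<bar> \<le> \<bar>f x\<bar>"
    and q: "0 \<le> q" and c: "0 \<le> c" "c \<le> c'"
  shows "Lq_le q c' g"
  unfolding Lq_le_def
proof
  have "(\<integral>\<^sup>+ x. ennreal (\<bar>g x\<bar> powr q) \<partial>lborel) \<le> (\<integral>\<^sup>+ x. ennreal (\<bar>f x\<bar> powr q) \<partial>lborel)"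
    using g q by (intro nn_integral_mono ennreal_leI powr_mono2) auto
  also have "\<dots> \<le> ennreal (c powr q)" by (rule Lq_leD(2)[OF f])
  also have "\<dots> \<le> ennreal (c' powr q)" using q c by (intro ennreal_leI powr_mono2) auto
  finally show "(\<integral>\<^sup>+ x. ennreal (\<bar>g x\<bar> powr q) \<partial>lborel) \<le> ennreal (c' powr q)" .
qed (rule g)

text \<open>
  The constant in this triangle inequality is crude: below, the smallness of the data absorbs it.
\<close>

lemma Lq_le_add:
  assumes f: "Lq_le q c1 f" and g: "Lq_le q c2 g" and q: "1 \<le> q" and c: "0 \<le> c1" "0 \<le> c2"
  shows "Lq_le q (4 * (c1 + c2)) (\<lambda>x. f x + g x)"
  unfolding Lq_le_def
proof
  note [measurable] = Lq_leD(1)[OF f] Lq_leD(1)[OF g]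
  show "(\<lambda>x. f x + g x) \<in> borel_measurable borel" by measurable
  have pt: "\<bar>f x + g x\<bar> powr q \<le> 2 powr q * (\<bar>f x\<bar> powr q + \<bar>g x\<bar> powr q)" for x
  proof -
    have "\<bar>f x + g x\<bar> powr q \<le> (2 * max \<bar>f x\<bar> \<bar>g x\<bar>) powr q" using q by (intro powr_mono2) auto
    also have "\<dots> = 2 powr q * max \<bar>f x\<bar> \<bar>g x\<bar> powr q" by (simp add: powr_mult)
    also have "max \<bar>f x\<bar> \<bar>g x\<bar> powr q \<le> \<bar>f x\<bar> powr q + \<bar>g x\<bar> powr q" by (auto simp: max_def)
    finally show ?thesis by simp
  qed
  have "(\<integral>\<^sup>+ x. ennreal (\<bar>f x + g x\<bar> powr q) \<partial>lborel) \<le>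
      (\<integral>\<^sup>+ x. ennreal (2 powr q) * (ennreal (\<bar>f x\<bar> powr q) + ennreal (\<bar>g x\<bar> powr q)) \<partial>lborel)"
    using pt by (intro nn_integral_mono) (simp add: ennreal_plus[symmetric] ennreal_mult[symmetric] del: ennreal_plus)
  also have "\<dots> = ennreal (2 powr q) * ((\<integral>\<^sup>+ x. ennreal (\<bar>f x\<bar> powr q) \<partial>lborel) + (\<integral>\<^sup>+ x. ennreal (\<bar>g x\<bar> powr q) \<partial>lborel))"
    by (simp add: nn_integral_cmult nn_integral_add)
  also have "\<dots> \<le> ennreal (2 powr q) * (ennreal (c1 powr q) + ennreal (c2 powr q))"
    by (intro mult_left_mono add_mono Lq_leD(2)[OF f] Lq_leD(2)[OF g]) auto
  also have "\<dots> = ennreal (2 powr q * (c1 powr q + c2 powr q))"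
    by (simp add: ennreal_plus[symmetric] ennreal_mult[symmetric] del: ennreal_plus)
  also have "\<dots> \<le> ennreal ((4 * (c1 + c2)) powr q)"
  proof (rule ennreal_leI)
    have "c1 powr q \<le> (c1 + c2) powr q" "c2 powr q \<le> (c1 + c2) powr q"
      using c q by (auto intro!: powr_mono2)
    then have "c1 powr q + c2 powr q \<le> 2 powr 1 * (c1 + c2) powr q" by simp
    also have "\<dots> \<le> 2 powr q * (c1 + c2) powr q" using q by (intro mult_right_mono powr_mono) auto
    finally have "2 powr q * (c1 powr q + c2 powr q) \<le> 2 powr q * (2 powr q * (c1 + c2) powr q)"
      by (intro mult_left_mono) auto
    also have "\<dots> = (4 * (c1 + c2)) powr q" using c by (simp add: powr_mult[symmetric])
    finally show "2 powr q * (c1 powr q + c2 powr q) \<le> (4 * (c1 + c2)) powr q" .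
  qed
  finally show "(\<integral>\<^sup>+ x. ennreal (\<bar>f x + g x\<bar> powr q) \<partial>lborel) \<le> ennreal ((4 * (c1 + c2)) powr q)" .
qed

lemma Lq_le_mult:
  assumes f: "Lq_le q c f" and b: "0 \<le> b" and c: "0 \<le> c"
  shows "Lq_le q (b * c) (\<lambda>x. b * f x)"
  unfolding Lq_le_def
proof
  note [measurable] = Lq_leD(1)[OF f]
  show "(\<lambda>x. b * f x) \<in> borel_measurable borel" by measurable
  have "(\<integral>\<^sup>+ x. ennreal (\<bar>b * f x\<bar> powr q) \<partial>lborel) = (\<integral>\<^sup>+ x. ennreal (b powr q) * ennreal (\<bar>f x\<bar> powr q) \<partial>lborel)"
    using b by (intro nn_integral_cong) (simp add: abs_mult powr_mult ennreal_mult)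
  also have "\<dots> = ennreal (b powr q) * (\<integral>\<^sup>+ x. ennreal (\<bar>f x\<bar> powr q) \<partial>lborel)"
    by (rule nn_integral_cmult) measurable
  also have "\<dots> \<le> ennreal (b powr q) * ennreal (c powr q)"
    by (intro mult_left_mono Lq_leD(2)[OF f]) simp
  also have "\<dots> = ennreal ((b * c) powr q)" using b c by (simp add: powr_mult ennreal_mult)
  finally show "(\<integral>\<^sup>+ x. ennreal (\<bar>b * f x\<bar> powr q) \<partial>lborel) \<le> ennreal ((b * c) powr q)" .
qed

lemma Lq_le_abs_powr:
  assumes "Lq_le q c f" "0 < p" "0 \<le> c"
  shows "Lq_le (q / p) (c powr p) (\<lambda>x. \<bar>f x\<bar> powr p)"
proof -
  note [measurable] = Lq_leD(1)[OF assms(1)]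
  have "(\<lambda>x. \<bar>f x\<bar> powr p) \<in> borel_measurable borel" by measurable
  then show ?thesis using assms by (simp add: Lq_le_def powr_powr)
qed

text \<open>
  By Jensen's inequality the \<open>r\<close>-th power of the flow of \<open>|f|\<close> is at most \<open>h\<close>, the flow of \<open>|f| powr r\<close>. The
  function \<open>h\<close> has integral at most \<open>c powr r\<close> and supremum at most \<open>S\<close>; raising it to the power \<open>q / r\<close>
  and pulling out \<open>q / r - 1\<close> factors \<open>S\<close> gives the bound.
\<close>

lemma heat_flow_Lq:
  fixes f :: "(real ^ 'n::finite) \<Rightarrow>\<^sub>C real"
  assumes r: "1 \<le> r" "r \<le> q" and t: "0 < t" and f: "Lq_le r c f" and c: "0 \<le> c"
  shows "Lq_le q (t powr (- (real CARD('n) / 2 * (1 / r - 1 / q))) * c) (heat_flow t (abs_powr 1 f))"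
  unfolding Lq_le_def
proof
  let ?N = "real CARD('n)"
  define h where "h = heat_flow t (abs_powr r f)"
  define S where "S = t powr (- (?N / 2)) * c powr r"
  have r0: "0 < r" using r by simp
  have h0: "0 \<le> h x" for x using r by (simp add: h_def heat_flow_abs_powr_nonneg)
  have int_f: "(\<integral>\<^sup>+ x. ennreal (abs_powr r f x) \<partial>lborel) \<le> ennreal (c powr r)"
    using Lq_leD(2)[OF f] r by simp
  have h_int: "(\<integral>\<^sup>+ x. ennreal (h x) \<partial>lborel) \<le> ennreal (c powr r)"
    unfolding h_def using int_f r0 by (subst nn_integral_heat_flow) simp_all
  have h_le: "h x \<le> S" for x
  proof -
    have "h x \<le> (4 * pi * t) powr (- ?N / 2) * c powr r"
      unfolding h_def using r0 int_f by (intro heat_flow_le_integral t) auto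
    \<comment> \<open>The factor \<open>4 * pi\<close> is at least 1 and its power is dropped.\<close>
    also have "\<dots> \<le> S"
      unfolding S_def using t pi_ge_two by (intro mult_right_mono) (auto intro!: powr_mono2')
    finally show ?thesis .
  qed
  have pt: "\<bar>heat_flow t (abs_powr 1 f) x\<bar> powr q \<le> S powr (q / r - 1) * h x" for x
  proof -
    have "\<bar>heat_flow t (abs_powr 1 f) x\<bar> powr q = (heat_flow t (abs_powr 1 f) x powr r) powr (q / r)"
      using r heat_flow_abs_powr_nonneg[of 1 t f x] by (simp add: powr_powr)
    also have "\<dots> \<le> h x powr (q / r)"
      unfolding h_def using r heat_flow_Jensen[of 1 r t f x] by (intro powr_mono2) auto
    also have "\<dots> = h x powr (q / r - 1) * h x"
      using h0[of x] by (cases "h x = 0") (simp_all add: powr_diff)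
    also have "\<dots> \<le> S powr (q / r - 1) * h x"
      using h0[of x] h_le[of x] r by (intro mult_right_mono powr_mono2) auto
    finally show ?thesis .
  qed
  have "(\<integral>\<^sup>+ x. ennreal (\<bar>heat_flow t (abs_powr 1 f) x\<bar> powr q) \<partial>lborel) \<le>
      (\<integral>\<^sup>+ x. ennreal (S powr (q / r - 1)) * ennreal (h x) \<partial>lborel)"
    by (intro nn_integral_mono) (simp add: ennreal_mult'[symmetric] ennreal_leI[OF pt])
  also have "\<dots> = ennreal (S powr (q / r - 1)) * (\<integral>\<^sup>+ x. ennreal (h x) \<partial>lborel)"
    by (simp add: nn_integral_cmult)
  also have "\<dots> \<le> ennreal (S powr (q / r - 1)) * ennreal (c powr r)"
    by (intro mult_left_mono h_int) simp
  also have "\<dots> = ennreal (S powr (q / r - 1) * c powr r)"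
    by (simp add: ennreal_mult)
  also have "S powr (q / r - 1) * c powr r = (t powr (- (?N / 2 * (1 / r - 1 / q))) * c) powr q"
  proof (cases "c = 0")
    case False
    then have c: "0 < c" using c by simp
    have "S powr (q / r - 1) * c powr r = t powr (- (?N / 2) * (q / r - 1)) * c powr (r * (q / r - 1) + r)"
      unfolding S_def using t c by (simp add: powr_mult powr_powr powr_add)
    also have "r * (q / r - 1) + r = q" using r0 by (simp add: right_diff_distrib)
    also have "- (?N / 2) * (q / r - 1) = - (?N / 2 * (1 / r - 1 / q)) * q"
      using r by (simp add: right_diff_distrib left_diff_distrib)
    finally show ?thesis using t c by (simp add: powr_mult powr_powr)
  qed simp
  finally show "(\<integral>\<^sup>+ x. ennreal (\<bar>heat_flow t (abs_powr 1 f) x\<bar> powr q) \<partial>lborel) \<le>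
      ennreal ((t powr (- (?N / 2 * (1 / r - 1 / q))) * c) powr q)" .
qed simp

text \<open>
  The open interval avoids the endpoints, where the integrands below are singular.
\<close>

lemma nn_integral_Ioo_has_integral:
  fixes f :: "real \<Rightarrow> real"
  assumes "f \<in> borel_measurable borel" "(f has_integral I) {a..b}" "\<And>s. s \<in> {a<..<b} \<Longrightarrow> 0 \<le> f s"
  shows "(\<integral>\<^sup>+ s. ennreal (indicator {a<..<b} s * f s) \<partial>lborel) = ennreal I"
proof (rule nn_integral_has_integral_lborel)
  have "((\<lambda>s. if s \<in> {a<..<b} then f s else 0) has_integral I) UNIV"
    using assms(2) by (simp only: has_integral_restrict_UNIV has_integral_Icc_iff_Ioo)
  then show "((\<lambda>s. indicator {a<..<b} s * f s) has_integral I) UNIV"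
    by (rule has_integral_eq[rotated]) (auto simp: indicator_def)
qed (use assms in \<open>auto simp: indicator_def\<close>)

text \<open>
  For fixed \<open>x\<close> let \<open>z = G x / A\<close> be the mean of \<open>g s x / a s\<close> with respect to the weight \<open>a s / A\<close>. The
  tangent inequality at \<open>z\<close> bounds \<open>z powr q\<close> by the mean of the \<open>q\<close>-th powers; integrating over \<open>x\<close> and
  exchanging the integrals, each \<open>s\<close> contributes at most \<open>a s\<close> because \<open>a s\<close> bounds the norm of \<open>g s\<close>.
\<close>

lemma Minkowski_integral:
  fixes g :: "real \<Rightarrow> real ^ 'n::finite \<Rightarrow> real" and a :: "real \<Rightarrow> real"
  assumes q: "1 \<le> q" and A: "0 < A" "(a has_integral A) {0..t}"
    and a: "a \<in> borel_measurable borel" "\<And>s. s \<in> {0<..<t} \<Longrightarrow> 0 < a s"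
    and g: "(\<lambda>(s, x). indicator {0<..<t} s * g s x) \<in> borel_measurable (borel \<Otimes>\<^sub>M borel)"
    and g_pos: "\<And>s x. s \<in> {0<..<t} \<Longrightarrow> 0 \<le> g s x"
    and g_Lq: "\<And>s. s \<in> {0<..<t} \<Longrightarrow> Lq_le q (a s) (g s)"
    and G: "\<And>x. ((\<lambda>s. g s x) has_integral G x) {0..t}" "G \<in> borel_measurable borel"
  shows "Lq_le q A G"
  unfolding Lq_le_def
proof
  define I where "I = (indicator {0<..<t} :: real \<Rightarrow> real)"
  define X where "X = (\<lambda>s x. I s * (a s * ((I s * g s x) / a s) powr q))"
  note [measurable] = a(1)
  have g_meas [measurable]: "(\<lambda>y. I (fst y) * g (fst y) (snd y)) \<in> borel_measurable (borel \<Otimes>\<^sub>M borel)"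
    using g unfolding I_def split_beta' .
  have I_meas [measurable]: "I \<in> borel_measurable borel" unfolding I_def by simp
  have X_meas: "(\<lambda>(s, x). ennreal (X s x)) \<in> borel_measurable (lborel \<Otimes>\<^sub>M lborel)"
    unfolding X_def split_beta' by measurable
  have X0: "0 \<le> X s x" for s x
    using a(2)[of s] by (cases "s \<in> {0<..<t}") (auto simp: X_def I_def)
  have g_sect [measurable]: "(\<lambda>s. I s * g s x) \<in> borel_measurable borel" for x
  proof -
    have "(\<lambda>s. (s, x)) \<in> borel \<rightarrow>\<^sub>M borel \<Otimes>\<^sub>M borel" by measurable
    from measurable_compose[OF this g_meas] show ?thesis by simp
  qed
  have G0: "0 \<le> G x" for x
  proof -
    have "((\<lambda>s. g s x) has_integral G x) {0<..<t}" using G(1)[of x] by (simp only: has_integral_Icc_iff_Ioo)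
    then show ?thesis by (rule has_integral_nonneg) (rule g_pos)
  qed
  have pt: "ennreal (G x powr q) \<le> ennreal (A powr (q - 1)) * (\<integral>\<^sup>+ s. ennreal (X s x) \<partial>lborel)" for x
  proof -
    \<comment> \<open>Integrating \<open>q * z powr (q - 1) * g \<le> X + (q - 1) * z powr q * a\<close> over \<open>s\<close>
      turns the left side into \<open>q * z powr q * A\<close>; then \<open>(q - 1) * z powr q * A\<close> is cancelled.\<close>
    define z where "z = G x / A"
    have z: "0 \<le> z" "G x = z * A" using G0[of x] A by (auto simp: z_def)
    have gI: "((\<lambda>s. I s * g s x) has_integral G x) {0..t}"
      unfolding has_integral_Icc_iff_Ioo
      by (rule has_integral_eq[OF _ G(1)[of x, unfolded has_integral_Icc_iff_Ioo]]) (simp add: I_def)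
    have "ennreal (q * z powr q * A) = ennreal (q * z powr (q - 1) * G x)"
      using z powr_mult_base[of z "q - 1"] by (cases "z = 0") (auto simp: mult_ac)
    also have "\<dots> = ennreal (q * z powr (q - 1)) * (\<integral>\<^sup>+ s. ennreal (I s * (I s * g s x)) \<partial>lborel)"
    proof -
      have "(\<integral>\<^sup>+ s. ennreal (I s * (I s * g s x)) \<partial>lborel) = ennreal (G x)"
        using gI unfolding I_def
        by (intro nn_integral_Ioo_has_integral) (use g_sect[of x] g_pos in \<open>auto simp: I_def\<close>)
      then show ?thesis using q G0[of x] by (simp add: ennreal_mult)
    qed
    also have "\<dots> = (\<integral>\<^sup>+ s. ennreal (q * z powr (q - 1)) * ennreal (I s * (I s * g s x)) \<partial>lborel)"
      by (rule nn_integral_cmult[symmetric]) measurable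
    also have "\<dots> \<le> (\<integral>\<^sup>+ s. ennreal (X s x) + ennreal ((q - 1) * z powr q) * ennreal (I s * a s) \<partial>lborel)"
    proof (rule nn_integral_mono)
      fix s
      show "ennreal (q * z powr (q - 1)) * ennreal (I s * (I s * g s x)) \<le> ennreal (X s x) + ennreal ((q - 1) * z powr q) * ennreal (I s * a s)"
      proof (cases "s \<in> {0<..<t}")
        case True
        then have Is: "I s = 1" and as: "0 < a s" using a by (auto simp: I_def)
        define y where "y = g s x / a s"
        have y: "0 \<le> y" "g s x = a s * y" using g_pos[OF True] as by (auto simp: y_def)
        have "q * z powr (q - 1) * y \<le> y powr q + (q - 1) * z powr q"
          using powr_above_tangent[OF q y(1) z(1)] powr_mult_base[OF z(1), of "q - 1"] z(1)
          by (cases "z = 0") (auto simp: algebra_simps)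
        then have "a s * (q * z powr (q - 1) * y) \<le> a s * (y powr q + (q - 1) * z powr q)"
          using as by (intro mult_left_mono) auto
        then have "q * z powr (q - 1) * g s x \<le> a s * y powr q + (q - 1) * z powr q * a s"
          by (simp add: y(2) algebra_simps)
        then show ?thesis
          using q as g_pos[OF True] unfolding X_def Is y_def
          by (simp add: ennreal_mult[symmetric] ennreal_plus[symmetric] del: ennreal_plus)
      qed (simp add: I_def)
    qed
    also have "\<dots> = (\<integral>\<^sup>+ s. ennreal (X s x) \<partial>lborel) + ennreal ((q - 1) * z powr q) * (\<integral>\<^sup>+ s. ennreal (I s * a s) \<partial>lborel)"
    proof -
      have "(\<lambda>s. X s x) \<in> borel_measurable borel" unfolding X_def by measurable
      then show ?thesis by (simp add: nn_integral_add nn_integral_cmult)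
    qed
    also have "(\<integral>\<^sup>+ s. ennreal (I s * a s) \<partial>lborel) = ennreal A"
      unfolding I_def using a A by (intro nn_integral_Ioo_has_integral) (auto intro: less_imp_le)
    also have "ennreal ((q - 1) * z powr q) * ennreal A = ennreal ((q - 1) * z powr q * A)"
      using q A by (simp add: ennreal_mult)
    finally have "ennreal (q * z powr q * A) \<le> (\<integral>\<^sup>+ s. ennreal (X s x) \<partial>lborel) + ennreal ((q - 1) * z powr q * A)" .
    moreover have "ennreal (q * z powr q * A) = ennreal (z powr q * A) + ennreal ((q - 1) * z powr q * A)"
      using q A mult_right_mono[of 1 q "z powr q"] by (subst ennreal_plus[symmetric]) (auto simp: algebra_simps)
    ultimately have *: "ennreal (z powr q * A) \<le> (\<integral>\<^sup>+ s. ennreal (X s x) \<partial>lborel)"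
      by (simp add: ennreal_add_left_cancel_le add.commute)
    have "G x powr q = A powr (q - 1) * (z powr q * A)"
      using z A by (simp add: powr_mult powr_diff)
    then have "ennreal (G x powr q) = ennreal (A powr (q - 1)) * ennreal (z powr q * A)"
      using A by (simp add: ennreal_mult)
    also have "\<dots> \<le> ennreal (A powr (q - 1)) * (\<integral>\<^sup>+ s. ennreal (X s x) \<partial>lborel)"
      by (intro mult_left_mono *) simp
    finally show ?thesis .
  qed
  have "(\<integral>\<^sup>+ x. ennreal (\<bar>G x\<bar> powr q) \<partial>lborel) \<le> (\<integral>\<^sup>+ x. ennreal (A powr (q - 1)) * (\<integral>\<^sup>+ s. ennreal (X s x) \<partial>lborel) \<partial>lborel)"
    using pt G0 by (intro nn_integral_mono) simp
  also have "\<dots> = ennreal (A powr (q - 1)) * (\<integral>\<^sup>+ x. (\<integral>\<^sup>+ s. ennreal (X s x) \<partial>lborel) \<partial>lborel)"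
    using lborel.borel_measurable_nn_integral[of "\<lambda>x s. ennreal (X s x)" lborel] measurable_pair_swap[OF X_meas]
    by (intro nn_integral_cmult) (simp add: split_beta')
  also have "(\<integral>\<^sup>+ x. (\<integral>\<^sup>+ s. ennreal (X s x) \<partial>lborel) \<partial>lborel) = (\<integral>\<^sup>+ s. (\<integral>\<^sup>+ x. ennreal (X s x) \<partial>lborel) \<partial>lborel)"
    by (rule lborel_pair.Fubini'[OF X_meas])
  also have "\<dots> \<le> (\<integral>\<^sup>+ s. ennreal (I s * a s) \<partial>lborel)"
  proof (rule nn_integral_mono)
    fix s
    show "(\<integral>\<^sup>+ x. ennreal (X s x) \<partial>lborel) \<le> ennreal (I s * a s)"
    proof (cases "s \<in> {0<..<t}")
      case True
      then have Is: "I s = 1" and as: "0 < a s" using a by (auto simp: I_def)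
      note [measurable] = Lq_leD(1)[OF g_Lq[OF True]]
      have "(\<integral>\<^sup>+ x. ennreal (X s x) \<partial>lborel) = (\<integral>\<^sup>+ x. ennreal (a s powr (1 - q)) * ennreal (\<bar>g s x\<bar> powr q) \<partial>lborel)"
        using as g_pos[OF True] unfolding X_def Is
        by (intro nn_integral_cong) (simp add: ennreal_mult[symmetric] powr_divide powr_diff)
      also have "\<dots> = ennreal (a s powr (1 - q)) * (\<integral>\<^sup>+ x. ennreal (\<bar>g s x\<bar> powr q) \<partial>lborel)"
        by (rule nn_integral_cmult) measurable
      also have "\<dots> \<le> ennreal (a s powr (1 - q)) * ennreal (a s powr q)"
        by (intro mult_left_mono Lq_leD(2)[OF g_Lq[OF True]]) simp
      also have "\<dots> = ennreal (a s)" using as by (simp add: ennreal_mult[symmetric] powr_add[symmetric])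
      finally show ?thesis by (simp add: Is)
    qed (simp add: X_def I_def)
  qed
  also have "(\<integral>\<^sup>+ s. ennreal (I s * a s) \<partial>lborel) = ennreal A"
    unfolding I_def using a A by (intro nn_integral_Ioo_has_integral) (auto intro: less_imp_le)
  also have "ennreal (A powr (q - 1)) * ennreal A = ennreal (A powr q)"
    using A by (simp add: ennreal_mult[symmetric] powr_diff)
  finally show "(\<integral>\<^sup>+ x. ennreal (\<bar>G x\<bar> powr q) \<partial>lborel) \<le> ennreal (A powr q)"
    by (simp add: mult_left_mono)
qed (rule G)

lemma has_integral_Beta_scaled:
  fixes a b t :: real
  assumes a: "a < 1" and b: "b < 1" and t: "0 < t"
  shows "((\<lambda>s. (t - s) powr (- a) * s powr (- b)) has_integral t powr (1 - a - b) * Beta (1 - b) (1 - a)) {0..t}"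
proof -
  have "((\<lambda>x. x powr (- b) * (1 - x) powr (- a)) has_integral Beta (1 - b) (1 - a)) (cbox 0 1)"
    using has_integral_Beta_real[of "1 - b" "1 - a"] a b by simp
  from has_integral_affinity'[OF this, of "1 / t" 0] t
  have "((\<lambda>s. (s / t) powr (- b) * (1 - s / t) powr (- a)) has_integral t * Beta (1 - b) (1 - a)) {0..t}"
    by simp
  from has_integral_mult_right[OF this, of "t powr (- a - b)"]
  have "((\<lambda>s. t powr (- a - b) * ((s / t) powr (- b) * (1 - s / t) powr (- a))) has_integral t powr (1 - a - b) * Beta (1 - b) (1 - a)) {0..t}"
  proof -
    have "t powr (1 - a - b) = t powr (- a - b) * t"
      using t powr_add[of t "- a - b" 1] by (simp add: algebra_simps)
    then have e: "t powr (1 - a - b) * Beta (1 - b) (1 - a) = t powr (- a - b) * (t * Beta (1 - b) (1 - a))" by simp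
    show ?thesis unfolding e by fact
  qed
  then show ?thesis
  proof (rule has_integral_eq[rotated])
    fix s assume s: "s \<in> {0..t}"
    have "1 - s / t = (t - s) / t" using t by (simp add: diff_divide_distrib)
    then show "t powr (- a - b) * ((s / t) powr (- b) * (1 - s / t) powr (- a)) = (t - s) powr (- a) * s powr (- b)"
      using s t powr_add[of t "- a" "- b"] by (simp add: powr_divide)
  qed
qed

lemma Beta_pos: "0 < a \<Longrightarrow> 0 < b \<Longrightarrow> 0 < Beta a (b :: real)"
  by (simp add: Beta_def)

section \<open>Global existence for small data\<close>

lemma continuous_on_bcontfun_joint:
  fixes F :: "'a::topological_space \<Rightarrow> (real ^ 'n::finite) \<Rightarrow>\<^sub>C real"
  assumes F: "continuous_on S F"
  shows "continuous_on (S \<times> UNIV) (\<lambda>(s, x). F s x)"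
  unfolding continuous_on_def split_beta
proof
  fix y assume "y \<in> S \<times> (UNIV :: (real ^ 'n) set)"
  then obtain s x where y: "y = (s, x)" "s \<in> S" by auto
  let ?A = "at y within S \<times> UNIV"
  have "continuous_on (S \<times> UNIV) (\<lambda>z. F (fst z))"
    by (rule continuous_on_compose2[OF F]) (auto intro!: continuous_intros)
  then have Ft: "((\<lambda>z. F (fst z)) \<longlongrightarrow> F s) ?A"
    using y unfolding continuous_on_def by force
  have 1: "((\<lambda>z. F (fst z) (snd z) - F s (snd z)) \<longlongrightarrow> 0) ?A"
  proof (rule Lim_null_comparison)
    have "norm (F (fst z) (snd z) - F s (snd z)) \<le> norm (F (fst z) - F s)" for z
      using norm_bounded[of "F (fst z) - F s" "snd z"] by simp
    then show "\<forall>\<^sub>F z in ?A. norm (F (fst z) (snd z) - F s (snd z)) \<le> norm (F (fst z) - F s)" by simp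
    show "((\<lambda>z. norm (F (fst z) - F s)) \<longlongrightarrow> 0) ?A"
      using Ft by (intro tendsto_norm_zero) (rule LIM_zero)
  qed
  have "continuous_on (S \<times> UNIV) (\<lambda>z. F s (snd z))"
    by (rule continuous_on_compose2[OF continuous_on_apply_bcontfun[of UNIV]]) (auto intro!: continuous_intros)
  then have 2: "((\<lambda>z. F s (snd z)) \<longlongrightarrow> F s x) ?A"
    using y unfolding continuous_on_def by force
  show "((\<lambda>z. F (fst z) (snd z)) \<longlongrightarrow> F (fst y) (snd y)) ?A"
    using tendsto_add[OF 1 2] y by simp
qed

lemma measurable_bcontfun_joint:
  fixes F :: "real \<Rightarrow> (real ^ 'n::finite) \<Rightarrow>\<^sub>C real"
  assumes F: "continuous_on {0..t} F"
  shows "(\<lambda>(s, x). indicator {0<..<t} s * F s x) \<in> borel_measurable (borel \<Otimes>\<^sub>M borel)"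
proof -
  have "continuous_on ({0<..<t} \<times> UNIV) (\<lambda>(s, x). F s x)"
    by (intro continuous_on_bcontfun_joint continuous_on_subset[OF F]) auto
  then have "(\<lambda>z. indicator ({0<..<t} \<times> UNIV) z *\<^sub>R (case z of (s, x) \<Rightarrow> F s x)) \<in> borel_measurable borel"
    by (intro borel_measurable_continuous_on_indicator borel_open open_Times) auto
  then show ?thesis
    unfolding borel_prod by (simp add: indicator_times split_beta')
qed

lemma abs_powr_1_abs_powr [simp]: "0 < p \<Longrightarrow> abs_powr 1 (abs_powr p f) = abs_powr p f"
  by (rule bcontfun_eqI) simp

text \<open>
  Minkowski's inequality with the smoothing bound for the time \<open>t - s\<close>; the resulting weight is a
  scaled Beta integrand.
\<close>

lemma source_flow_Lq:
  fixes w :: "(real ^ 'n::finite) \<Rightarrow>\<^sub>C real"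
  assumes \<sigma>: "-1 < \<sigma>" and w: "w \<in> C0" and k: "1 \<le> k" "k \<le> q" and c: "0 < c" and Lw: "Lq_le k c w"
    and \<theta>: "\<theta> = real CARD('n) / 2 * (1 / k - 1 / q)" "\<theta> < 1" and t: "0 < t"
  shows "Lq_le q (c * (t powr (1 - \<theta> + \<sigma>) * Beta (\<sigma> + 1) (1 - \<theta>))) (source_flow \<sigma> (abs_powr 1 w) t)"
proof (rule Minkowski_integral[where t = t and g = "\<lambda>s x. s powr \<sigma> * heat_flow (t - s) (abs_powr 1 w) x"
    and a = "\<lambda>s. c * ((t - s) powr (- \<theta>) * s powr \<sigma>)"])
  have w1: "abs_powr 1 w \<in> C0" using w by auto
  show "1 \<le> q" using k by simp
  show "0 < c * (t powr (1 - \<theta> + \<sigma>) * Beta (\<sigma> + 1) (1 - \<theta>))"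
    using c t \<sigma> \<theta> by (simp add: Beta_pos)
  show "((\<lambda>s. c * ((t - s) powr (- \<theta>) * s powr \<sigma>)) has_integral c * (t powr (1 - \<theta> + \<sigma>) * Beta (\<sigma> + 1) (1 - \<theta>))) {0..t}"
    using has_integral_mult_right[OF has_integral_Beta_scaled[of \<theta> "- \<sigma>" t], of c] \<sigma> \<theta>(2) t by (simp add: add.commute)
  show "(\<lambda>(s, x). indicator {0<..<t} s * (s powr \<sigma> * heat_flow (t - s) (abs_powr 1 w) x)) \<in> borel_measurable (borel \<Otimes>\<^sub>M borel)"
  proof -
    have [measurable]: "(\<lambda>z. indicator {0<..<t} (fst z) * heat_flow (t - fst z) (abs_powr 1 w) (snd z)) \<in> borel_measurable (borel \<Otimes>\<^sub>M borel)"
    proof -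
      have "continuous_on {0..t} (\<lambda>s. heat_flow (t - s) (abs_powr 1 w))"
        by (intro continuous_intros w1)
      from measurable_bcontfun_joint[OF this] show ?thesis by (simp add: split_beta')
    qed
    have "(\<lambda>z. fst z powr \<sigma> * (indicator {0<..<t} (fst z) * heat_flow (t - fst z) (abs_powr 1 w) (snd z))) \<in> borel_measurable (borel \<Otimes>\<^sub>M borel)"
      by measurable
    then show ?thesis by (simp add: split_beta' mult.left_commute)
  qed
  show "0 \<le> s powr \<sigma> * heat_flow (t - s) (abs_powr 1 w) x" for s x
    by (simp add: heat_flow_abs_powr_nonneg)
  show "Lq_le q (c * ((t - s) powr (- \<theta>) * s powr \<sigma>)) (\<lambda>x. s powr \<sigma> * heat_flow (t - s) (abs_powr 1 w) x)" if "s \<in> {0<..<t}" for s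
    using Lq_le_mult[OF heat_flow_Lq[OF k _ Lw, of "t - s", folded \<theta>(1)], of "s powr \<sigma>"] c that
    by (simp add: mult_ac)
  show "((\<lambda>s. s powr \<sigma> * heat_flow (t - s) (abs_powr 1 w) x) has_integral source_flow \<sigma> (abs_powr 1 w) t x) {0..t}" for x
    using t by (intro source_flow_has_integral \<sigma> w1) simp
qed (use c in auto)

text \<open>
  The \<open>p\<close>-th power of a function bounded in the norm with exponent \<open>q\<close> is bounded in the one with
  exponent \<open>q / p\<close>, from which the heat flow smooths back to \<open>q\<close>.
\<close>

lemma duhamel_Lq:
  fixes f :: "real \<Rightarrow> (real ^ 'n::finite) \<Rightarrow>\<^sub>C real"
  assumes p: "1 < p" "p \<le> q" and f: "continuous_on {0..t} f" "\<And>s. s \<in> {0..t} \<Longrightarrow> f s \<in> C0"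
    and K: "0 < K" and Lf: "\<And>s. s \<in> {0<..<t} \<Longrightarrow> Lq_le q (K * s powr (- \<beta>)) (f s)"
    and \<theta>: "\<theta> = real CARD('n) / 2 * (p / q - 1 / q)" "\<theta> < 1" and \<beta>: "p * \<beta> < 1" and t: "0 < t"
  shows "Lq_le q (K powr p * (t powr (1 - \<theta> - p * \<beta>) * Beta (1 - p * \<beta>) (1 - \<theta>))) (duhamel (\<lambda>s. abs_powr p (f s)) t)"
proof (rule Minkowski_integral[where t = t and g = "\<lambda>s x. heat_flow (t - s) (abs_powr p (f s)) x"
    and a = "\<lambda>s. K powr p * ((t - s) powr (- \<theta>) * s powr (- (p * \<beta>)))"])
  have F: "continuous_on {0..t} (\<lambda>s. abs_powr p (f s))" "\<And>s. s \<in> {0..t} \<Longrightarrow> abs_powr p (f s) \<in> C0"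
    using f p by (auto intro!: continuous_intros)
  show "1 \<le> q" using p by simp
  show "0 < K powr p * (t powr (1 - \<theta> - p * \<beta>) * Beta (1 - p * \<beta>) (1 - \<theta>))"
    using K t \<beta> \<theta> by (simp add: Beta_pos)
  show "((\<lambda>s. K powr p * ((t - s) powr (- \<theta>) * s powr (- (p * \<beta>)))) has_integral
      K powr p * (t powr (1 - \<theta> - p * \<beta>) * Beta (1 - p * \<beta>) (1 - \<theta>))) {0..t}"
    by (rule has_integral_mult_right[OF has_integral_Beta_scaled[OF \<theta>(2) \<beta> t]])
  show "(\<lambda>(s, x). indicator {0<..<t} s * heat_flow (t - s) (abs_powr p (f s)) x) \<in> borel_measurable (borel \<Otimes>\<^sub>M borel)"
    by (intro measurable_bcontfun_joint continuous_on_duhamel_integrand[OF F]) auto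
  show "0 \<le> heat_flow (t - s) (abs_powr p (f s)) x" for s x
    using p by (simp add: heat_flow_abs_powr_nonneg)
  show "Lq_le q (K powr p * ((t - s) powr (- \<theta>) * s powr (- (p * \<beta>)))) (heat_flow (t - s) (abs_powr p (f s)))" if s: "s \<in> {0<..<t}" for s
  proof -
    have "apply_bcontfun (abs_powr p (f s)) = (\<lambda>x. \<bar>f s x\<bar> powr p)" using p by auto
    then have "Lq_le (q / p) ((K * s powr (- \<beta>)) powr p) (abs_powr p (f s))"
      using Lq_le_abs_powr[OF Lf[OF s], of p] p K by simp
    moreover have "1 \<le> q / p" "q / p \<le> q" using p by (simp_all add: divide_le_eq)
    ultimately have "Lq_le q ((t - s) powr (- (real CARD('n) / 2 * (1 / (q / p) - 1 / q))) * (K * s powr (- \<beta>)) powr p)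
        (heat_flow (t - s) (abs_powr 1 (abs_powr p (f s))))"
      using s by (intro heat_flow_Lq) auto
    moreover have "real CARD('n) / 2 * (1 / (q / p) - 1 / q) = \<theta>" by (simp add: \<theta>(1))
    moreover have "(K * s powr (- \<beta>)) powr p = K powr p * s powr (- (p * \<beta>))"
      using K by (simp add: powr_mult powr_powr mult.commute)
    ultimately show ?thesis using p by (simp add: mult_ac)
  qed
  show "((\<lambda>s. heat_flow (t - s) (abs_powr p (f s)) x) has_integral duhamel (\<lambda>s. abs_powr p (f s)) t x) {0..t}" for x
    by (intro duhamel_apply_has_integral[OF F]) auto
qed (use K in auto)

primrec picard :: "real \<Rightarrow> (real \<Rightarrow> (real ^ 'n::finite) \<Rightarrow>\<^sub>C real) \<Rightarrow> nat \<Rightarrow> real \<Rightarrow> (real ^ 'n) \<Rightarrow>\<^sub>C real" where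
  "picard p G 0 = (\<lambda>_. 0)"
| "picard p G (Suc n) = (\<lambda>t. G t + duhamel (\<lambda>s. abs_powr p (picard p G n s)) t)"

lemma picard_regular:
  assumes p: "1 < p" and G: "continuous_on {0..T} G" "\<And>t. t \<in> {0..T} \<Longrightarrow> G t \<in> C0"
  shows "continuous_on {0..T} (picard p G n)" and "t \<in> {0..T} \<Longrightarrow> picard p G n t \<in> C0"
proof (induction n arbitrary: t)
  case (Suc n)
  have F: "continuous_on {0..T} (\<lambda>s. abs_powr p (picard p G n s))" "\<And>s. s \<in> {0..T} \<Longrightarrow> abs_powr p (picard p G n s) \<in> C0"
    using Suc.IH p by (auto intro!: continuous_intros)
  case 1
  show ?case using G(1) continuous_on_duhamel[OF F] by (auto intro!: continuous_intros)
  case 2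
  then show ?case using G(2) C0_duhamel[OF F, of t] by auto
qed auto

text \<open>
  The parameter \<open>x\<close> stands for \<open>N / (2 * q)\<close>. In the order of the conclusion, the conditions say that the
  time weight of the nonlinear term is integrable at 0 (\<open>p * \<beta> < 1\<close>), that the smoothing of \<open>w\<close> is
  integrable at \<open>s = t\<close>, that \<open>q > d\<close>, and that \<open>q > p\<close>. They are compatible when \<open>p\<close> is at least the critical
  exponent.
\<close>

lemma admissible_exponent:
  fixes N p \<sigma> :: real
  assumes \<sigma>: "-1 < \<sigma>" "\<sigma> < 0" and p: "1 < p" and crit: "N - 2 * \<sigma> \<le> p * (N - 2 - 2 * \<sigma>)"
  obtains x where "1 / (p * (p - 1)) < x" "\<sigma> + 1 / (p - 1) < x" "x < 1 / (p - 1)" "x < N / (2 * p)"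
proof -
  define y where "y = 1 / (p - 1)"
  have y: "0 < y" "p * y = y + 1" "1 / (p * (p - 1)) = y / p" using p by (simp_all add: y_def field_simps)
  have "2 \<le> (p - 1) * (N - 2 - 2 * \<sigma>)" using crit by (simp add: algebra_simps)
  then have yN: "y \<le> N / 2 - 1 - \<sigma>" using p by (simp add: y_def field_simps)
  \<comment> \<open>At the critical exponent \<open>yN\<close> is an equality, and the strictness comes from \<open>\<sigma> < 0\<close>.\<close>
  have "(p - 1) * \<sigma> < 0" using p \<sigma> by (simp add: mult_pos_neg)
  then have "p * (\<sigma> + y) < N / 2" using yN by (simp add: y(2) algebra_simps)
  then have "\<sigma> + y < N / (2 * p)" using p by (simp add: field_simps)
  moreover have "y / p < N / (2 * p)"
  proof -
    have "y / p < (N / 2) / p" using yN \<sigma> p by (intro divide_strict_right_mono) auto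
    then show ?thesis by simp
  qed
  moreover have "y / p < y" using p y(1) by (simp add: divide_less_eq)
  ultimately have "max (y / p) (\<sigma> + y) < min y (N / (2 * p))" using \<sigma> by auto
  then obtain x where "max (y / p) (\<sigma> + y) < x" "x < min y (N / (2 * p))" using dense by blast
  then show thesis using that[of x] unfolding y(3) by (simp add: y_def)
qed

text \<open>
  All three terms of an iterate scale like \<open>t powr (- \<beta>)\<close>: this is what \<open>ex_d\<close>, \<open>ex_k\<close> and \<open>ex_t\<close> in the
  proof express. The second condition on \<open>K\<close> closes the induction.
\<close>

lemma picard_Lq_bound:
  fixes w u0 :: "(real ^ 'n::finite) \<Rightarrow>\<^sub>C real"
  defines "N \<equiv> real CARD('n)"
  assumes \<sigma>: "-1 < \<sigma>" and p: "1 < p" and w: "w \<in> C0" and u0: "u0 \<in> C0"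
    and x: "1 / (p * (p - 1)) < x" "\<sigma> + 1 / (p - 1) < x" "x < 1 / (p - 1)" "x < N / (2 * p)"
    and d: "d = N * (p - 1) / 2" and k: "k = d / (p * (\<sigma> + 1) - \<sigma>)" "1 \<le> k"
    and q: "q = N / (2 * x)" and \<beta>: "\<beta> = 1 / (p - 1) - x"
    and \<epsilon>: "0 < \<epsilon>" "Lq_le d \<epsilon> u0" "Lq_le k \<epsilon> w"
    and K: "0 < K" "4 * (\<epsilon> + 4 * (\<epsilon> * Beta (\<sigma> + 1) (- \<sigma> - \<beta>) + K powr p * Beta (1 - p * \<beta>) (1 - (p - 1) * x))) \<le> K"
    and t: "0 < t"
  shows "Lq_le q (K * t powr (- \<beta>)) (picard p (forcing \<sigma> w u0) n t)"
  using t
proof (induction n arbitrary: t)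
  case 0
  then show ?case by (simp add: Lq_le_def)
next
  case (Suc n)
  have N: "0 < N" by (simp add: N_def)
  have x0: "0 < x" using x(1) p by (smt (verit) divide_pos_pos mult_pos_pos)
  have den: "1 < p * (\<sigma> + 1) - \<sigma>"
  proof -
    have "p * (\<sigma> + 1) - \<sigma> = (p - 1) * (\<sigma> + 1) + 1" by (simp add: algebra_simps)
    then show ?thesis using p \<sigma> by simp
  qed
  have d0: "0 < d" unfolding d using N p by simp
  have kd: "k \<le> d" using k d0 den by (simp add: divide_le_eq)
  have dq: "d \<le> q"
  proof -
    have "x * (p - 1) < 1" using x(3) p by (simp add: pos_less_divide_eq)
    then have "N * (x * (p - 1)) \<le> N * 1" using N by (intro mult_left_mono) auto
    then show ?thesis unfolding d q using x0 by (simp add: field_simps)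
  qed
  have pq: "p \<le> q" using x(4) x0 p unfolding q by (simp add: field_simps)
  have Nq: "N / 2 * (1 / q) = x" using N x0 by (simp add: q)
  have ex_d: "N / 2 * (1 / d - 1 / q) = \<beta>"
  proof -
    have "N / 2 * (1 / d) = 1 / (p - 1)" using N p by (simp add: d)
    then show ?thesis by (simp only: right_diff_distrib Nq \<beta>)
  qed
  have ex_k: "N / 2 * (1 / k - 1 / q) = \<sigma> + 1 + \<beta>"
  proof -
    have "N / 2 * (1 / (N * P / 2 / D)) = D / P" for D P using N by simp
    then have "N / 2 * (1 / k) = (p * (\<sigma> + 1) - \<sigma>) / (p - 1)" unfolding k(1) d .
    also have "\<dots> = \<sigma> + 1 + 1 / (p - 1)" using p by (simp add: field_simps)
    finally show ?thesis unfolding right_diff_distrib Nq by (simp add: \<beta>)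
  qed
  have ex_p: "(p - 1) * x = N / 2 * (p / q - 1 / q)"
  proof -
    have "N / 2 * (p / q - 1 / q) = (p - 1) * (N / 2 * (1 / q))"
      by (simp add: left_diff_distrib diff_divide_distrib right_diff_distrib)
    then show ?thesis by (simp only: Nq)
  qed
  have p\<beta>: "p * \<beta> < 1"
  proof -
    have "1 < x * (p * (p - 1))" using x(1) p by (simp add: pos_divide_less_eq)
    then show ?thesis using p unfolding \<beta> by (simp add: field_simps)
  qed
  have ex_t: "1 - (p - 1) * x - p * \<beta> = - \<beta>"
    using p unfolding \<beta> by (simp add: field_simps)
  let ?B1 = "Beta (\<sigma> + 1) (- \<sigma> - \<beta>)" and ?B2 = "Beta (1 - p * \<beta>) (1 - (p - 1) * x)"
  have B: "0 < ?B1" "0 < ?B2"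
    using \<sigma> x(2,3) p p\<beta> by (auto intro!: Beta_pos simp: \<beta> pos_less_divide_eq mult.commute)
  let ?u = "picard p (forcing \<sigma> w u0)"
  note reg = picard_regular[OF p continuous_on_forcing[OF \<sigma> p w u0] C0_forcing[OF \<sigma> p w u0]]
  have F: "continuous_on {0..t} (\<lambda>s. abs_powr p (?u n s))" "\<And>s. s \<in> {0..t} \<Longrightarrow> abs_powr p (?u n s) \<in> C0"
    using reg p by (auto intro!: continuous_intros)
  have L1: "Lq_le q (\<epsilon> * t powr (- \<beta>)) (heat_flow t (abs_powr 1 u0))"
    using heat_flow_Lq[of d q t \<epsilon> u0, folded N_def, unfolded ex_d] k(2) kd dq Suc.prems \<epsilon>(1,2) by (simp add: mult.commute)
  have L2: "Lq_le q (\<epsilon> * (t powr (- \<beta>) * ?B1)) (source_flow \<sigma> (abs_powr 1 w) t)"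
    using source_flow_Lq[OF \<sigma> w k(2) _ \<epsilon>(1) \<epsilon>(3) ex_k[unfolded N_def, symmetric] _ Suc.prems] kd dq x(2)
    by (simp add: \<beta> algebra_simps)
  have L3: "Lq_le q (K powr p * (t powr (- \<beta>) * ?B2)) (duhamel (\<lambda>s. abs_powr p (?u n s)) t)"
    unfolding ex_t[symmetric]
  proof (rule duhamel_Lq[OF p pq reg K(1) Suc.IH ex_p[unfolded N_def] _ p\<beta> Suc.prems])
    show "(p - 1) * x < 1" using x(3) p by (simp add: pos_less_divide_eq mult.commute)
  qed auto
  have "Lq_le q (4 * (\<epsilon> * t powr (- \<beta>) + 4 * (\<epsilon> * (t powr (- \<beta>) * ?B1) + K powr p * (t powr (- \<beta>) * ?B2))))
      (\<lambda>y. heat_flow t (abs_powr 1 u0) y + (source_flow \<sigma> (abs_powr 1 w) t y + duhamel (\<lambda>s. abs_powr p (?u n s)) t y))"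
    using pq p \<epsilon>(1) B K(1) by (intro Lq_le_add L1 L2 L3) (auto intro!: add_nonneg_nonneg mult_nonneg_nonneg)
  then show ?case
  proof (rule Lq_le_mono)
    show "4 * (\<epsilon> * t powr (- \<beta>) + 4 * (\<epsilon> * (t powr (- \<beta>) * ?B1) + K powr p * (t powr (- \<beta>) * ?B2))) \<le> K * t powr (- \<beta>)"
      using mult_right_mono[OF K(2), of "t powr (- \<beta>)"] by (simp add: algebra_simps)
    show "0 \<le> 4 * (\<epsilon> * t powr (- \<beta>) + 4 * (\<epsilon> * (t powr (- \<beta>) * ?B1) + K powr p * (t powr (- \<beta>) * ?B2)))"
      using \<epsilon>(1) B K(1) by (auto intro!: add_nonneg_nonneg mult_nonneg_nonneg)
    fix y
    have D0: "0 \<le> duhamel (\<lambda>s. abs_powr p (?u n s)) t y"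
      using p by (intro has_integral_nonneg[OF duhamel_apply_has_integral[OF F]]) (auto simp: heat_flow_abs_powr_nonneg)
    have S: "\<bar>source_flow \<sigma> w t y\<bar> \<le> source_flow \<sigma> (abs_powr 1 w) t y"
    proof -
      have w1: "abs_powr 1 w \<in> C0" using w by auto
      have t0: "0 \<le> t" using Suc.prems by simp
      show ?thesis
      proof (intro abs_leI)
        have le: "\<bar>s powr \<sigma> * heat_flow (t - s) w y\<bar> \<le> s powr \<sigma> * heat_flow (t - s) (abs_powr 1 w) y" for s
          using abs_heat_flow_le[of "t - s" w y] by (simp add: abs_mult mult_left_mono)
        show "source_flow \<sigma> w t y \<le> source_flow \<sigma> (abs_powr 1 w) t y"
          by (rule has_integral_le[OF source_flow_has_integral[OF \<sigma> w t0] source_flow_has_integral[OF \<sigma> w1 t0]])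
            (rule order_trans[OF abs_ge_self le])
        show "- source_flow \<sigma> w t y \<le> source_flow \<sigma> (abs_powr 1 w) t y"
          by (rule has_integral_le[OF has_integral_neg[OF source_flow_has_integral[OF \<sigma> w t0]] source_flow_has_integral[OF \<sigma> w1 t0]])
            (rule order_trans[OF abs_ge_minus_self le])
      qed
    qed
    show "\<bar>?u (Suc n) t y\<bar> \<le> \<bar>heat_flow t (abs_powr 1 u0) y + (source_flow \<sigma> (abs_powr 1 w) t y + duhamel (\<lambda>s. abs_powr p (?u n s)) t y)\<bar>"
      using abs_heat_flow_le[of t u0 y] S D0 by (simp add: forcing_def)
  qed (use pq p in auto)
qed

text \<open>
  Estimating \<open>|u|\<^sup>p \<le> 2 * C * |u| powr (p - 1)\<close> leaves a factor that Jensen's inequality and the bound with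
  exponent \<open>q\<close> control by \<open>K powr (p - 1) * (t - s) powr (- \<theta>) * s powr (\<theta> - 1)\<close>. The exponents add up to \<open>-1\<close>, so the
  integral over \<open>s\<close> is a Beta value for every \<open>t\<close>, and a small \<open>K\<close> bounds the Duhamel term by \<open>C\<close>.
\<close>

lemma picard_sup_bound:
  fixes G :: "real \<Rightarrow> (real ^ 'n::finite) \<Rightarrow>\<^sub>C real"
  assumes p: "1 < p" and G: "continuous_on {0..T} G" "\<And>t. t \<in> {0..T} \<Longrightarrow> G t \<in> C0 \<and> norm (G t) \<le> C"
    and q: "p - 1 \<le> q" and \<theta>: "\<theta> = real CARD('n) / 2 * ((p - 1) / q)" "\<theta> < 1"
    and \<beta>: "(p - 1) * \<beta> = 1 - \<theta>"
    and Lq: "\<And>n s. 0 < s \<Longrightarrow> Lq_le q (K * s powr (- \<beta>)) (picard p G n s)"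
    and K: "0 < K" "K powr (p - 1) * Beta \<theta> (1 - \<theta>) \<le> 1 / 2"
    and t: "t \<in> {0..T}"
  shows "norm (picard p G n t) \<le> 2 * C"
  using t
proof (induction n arbitrary: t)
  case 0
  then show ?case using G(2)[of t] order_trans[OF norm_ge_zero, of "G t" C] by simp
next
  case (Suc n)
  have C: "0 \<le> C" using G(2)[OF Suc.prems] norm_ge_zero[of "G t"] by linarith
  let ?u = "picard p G"
  note reg = picard_regular[OF p G(1) conjunct1[OF G(2)]]
  have F: "continuous_on {0..T} (\<lambda>s. abs_powr p (?u n s))" "\<And>s. s \<in> {0..T} \<Longrightarrow> abs_powr p (?u n s) \<in> C0"
    using reg p by (auto intro!: continuous_intros)
  have q0: "0 < q" using p q by simp
  have \<theta>0: "0 < \<theta>" using \<theta>(1) p q0 by simp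
  have "norm (duhamel (\<lambda>s. abs_powr p (?u n s)) t) \<le> C"
  proof (cases "t = 0")
    case False
    then have t0: "0 < t" using Suc.prems by simp
    show ?thesis
    proof (rule norm_bound)
      fix y
      let ?D = "duhamel (\<lambda>s. abs_powr p (?u n s)) t y"
      have Di: "((\<lambda>s. heat_flow (t - s) (abs_powr p (?u n s)) y) has_integral ?D) {0<..<t}"
        using duhamel_apply_has_integral[OF F, of t y] Suc.prems by (simp add: has_integral_Icc_iff_Ioo)
      have "((\<lambda>s. (t - s) powr (- \<theta>) * s powr (- (1 - \<theta>))) has_integral Beta \<theta> (1 - \<theta>)) {0<..<t}"
        using has_integral_Beta_scaled[of \<theta> "1 - \<theta>" t] \<theta>(2) \<theta>0 t0 by (simp add: has_integral_Icc_iff_Ioo)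
      then have Bi: "((\<lambda>s. 2 * C * K powr (p - 1) * ((t - s) powr (- \<theta>) * s powr (- (1 - \<theta>)))) has_integral
          2 * C * K powr (p - 1) * Beta \<theta> (1 - \<theta>)) {0<..<t}"
        by (rule has_integral_mult_right)
      have "?D \<le> 2 * C * K powr (p - 1) * Beta \<theta> (1 - \<theta>)"
      proof (rule has_integral_le[OF Di Bi])
        fix s assume s: "s \<in> {0<..<t}"
        then have sT: "s \<in> {0..T}" using Suc.prems by auto
        let ?f = "?u n s" and ?r = "q / (p - 1)"
        have "heat_flow (t - s) (abs_powr p ?f) y \<le> heat_flow (t - s) ((2 * C) *\<^sub>R abs_powr (p - 1) ?f) y"
        proof (rule heat_flow_mono)
          fix x
          have "\<bar>?f x\<bar> \<le> 2 * C" using Suc.IH[OF sT] norm_bounded[of ?f x] by simp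
          then have "\<bar>?f x\<bar> * \<bar>?f x\<bar> powr (p - 1) \<le> 2 * C * \<bar>?f x\<bar> powr (p - 1)" by (intro mult_right_mono) auto
          then show "abs_powr p ?f x \<le> ((2 * C) *\<^sub>R abs_powr (p - 1) ?f) x"
            using p by (simp add: powr_mult_base)
        qed
        also have "\<dots> = 2 * C * heat_flow (t - s) (abs_powr (p - 1) ?f) y" by (simp add: heat_flow_scaleR)
        also have "\<dots> \<le> 2 * C * (K powr (p - 1) * ((t - s) powr (- \<theta>) * s powr (- (1 - \<theta>))))"
        proof (rule mult_left_mono)
          let ?h = "heat_flow (t - s) (abs_powr (p - 1) ?f) y"
          have h0: "0 \<le> ?h" using p by (simp add: heat_flow_abs_powr_nonneg)
          have "?h powr ?r \<le> heat_flow (t - s) (abs_powr ((p - 1) * ?r) ?f) y"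
            using p q by (intro heat_flow_Jensen) auto
          also have "(p - 1) * ?r = q" using p by simp
          also have "heat_flow (t - s) (abs_powr q ?f) y \<le> (4 * pi * (t - s)) powr (- real CARD('n) / 2) * (K * s powr (- \<beta>)) powr q"
            using s q0 Lq_leD(2)[OF Lq[of s n]] by (intro heat_flow_le_integral) auto
          also have "\<dots> \<le> (t - s) powr (- real CARD('n) / 2) * (K * s powr (- \<beta>)) powr q"
            using s pi_ge_two by (intro mult_right_mono powr_mono2') auto
          finally have "(?h powr ?r) powr (1 / ?r) \<le> ((t - s) powr (- real CARD('n) / 2) * (K * s powr (- \<beta>)) powr q) powr (1 / ?r)"
            using p q0 by (intro powr_mono2) auto
          also have "(?h powr ?r) powr (1 / ?r) = ?h" using h0 p q0 by (simp add: powr_powr)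
          also have "((t - s) powr (- real CARD('n) / 2) * (K * s powr (- \<beta>)) powr q) powr (1 / ?r) =
              (t - s) powr (- \<theta>) * (K * s powr (- \<beta>)) powr (p - 1)"
            using s q0 K p by (simp add: powr_mult powr_powr \<theta>(1))
          also have "(K * s powr (- \<beta>)) powr (p - 1) = K powr (p - 1) * s powr (- (1 - \<theta>))"
            using K \<beta> by (simp add: powr_mult powr_powr mult.commute)
          finally show "?h \<le> K powr (p - 1) * ((t - s) powr (- \<theta>) * s powr (- (1 - \<theta>)))"
            by (simp add: mult_ac)
        qed (use C in simp)
        finally show "heat_flow (t - s) (abs_powr p ?f) y \<le> 2 * C * K powr (p - 1) * ((t - s) powr (- \<theta>) * s powr (- (1 - \<theta>)))"
          by (simp add: mult.assoc)
      qed
      also have "\<dots> \<le> C" using mult_left_mono[OF K(2), of "2 * C"] C by (simp add: mult.assoc)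
      finally have "?D \<le> C" .
      moreover have "0 \<le> ?D"
        by (rule has_integral_nonneg[OF Di]) (use p in \<open>simp add: heat_flow_abs_powr_nonneg\<close>)
      ultimately show "norm ?D \<le> C" by simp
    qed
  qed (use C in simp)
  then show ?case
    using G(2)[OF Suc.prems] norm_triangle_ineq[of "G t" "duhamel (\<lambda>s. abs_powr p (?u n s)) t"] by simp
qed

lemma picard_limit_bound:
  fixes G :: "real \<Rightarrow> (real ^ 'n::finite) \<Rightarrow>\<^sub>C real"
  assumes p: "1 < p" and u: "solves p G T u" and G: "continuous_on {0..T} G" "\<And>t. t \<in> {0..T} \<Longrightarrow> G t \<in> C0"
    and B: "\<And>n t. t \<in> {0..T} \<Longrightarrow> norm (picard p G n t) \<le> B" and t: "t \<in> {0..T}"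
  shows "norm (u t) \<le> B"
proof -
  obtain M0 where M0: "0 < M0" "\<And>t. t \<in> {0..T} \<Longrightarrow> norm (u t) \<le> M0"
    using bounded_on_interval[OF solvesD(1)[OF u]] by metis
  define M where "M = max M0 B"
  have M: "norm (u t) \<le> M" "norm (picard p G n t) \<le> M" if "t \<in> {0..T}" for t n
    using M0(2)[OF that] B[OF that, of n] by (auto simp: M_def)
  have "norm (u t - picard p G n t) \<le> 2 * M * ((p * M powr (p - 1) * t) ^ n / fact n)" for n
  proof (rule picard_difference[OF p, where a = "\<lambda>_. u" and b = "picard p G" and T = T])
    fix t n assume t: "t \<in> {0..T}"
    show "u t - picard p G (Suc n) t = duhamel (\<lambda>s. abs_powr p (u s)) t - duhamel (\<lambda>s. abs_powr p (picard p G n s)) t"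
      by (subst solvesD(3)[OF u t]) simp
  qed (use solvesD(1,2)[OF u] picard_regular[OF p G] t M in blast)+
  then have "norm (u t) - B \<le> 2 * M * ((p * M powr (p - 1) * t) ^ n / fact n)" for n
    using B[OF t, of n] norm_triangle_ineq2[of "u t" "picard p G n t"] by (smt (verit))
  then have "norm (u t) - B \<le> 0"
    by (intro LIMSEQ_le_const[OF pow_over_fact_tendsto_0]) auto
  then show ?thesis by simp
qed

text \<open>
  The constant \<open>K\<close> is chosen with \<open>K powr (p - 1) = m\<close> so small that the nonlinear term takes at most half
  of \<open>K\<close> in \<open>picard_Lq_bound\<close> and the Beta factor in \<open>picard_sup_bound\<close> is at most \<open>1/2\<close>; then \<open>\<epsilon>\<close> is chosen so
  that the data take the other half of \<open>K\<close>. These choices involve only \<open>N\<close>, \<open>p\<close> and \<open>\<sigma>\<close>.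
\<close>

lemma global_existence_small_data:
  fixes \<sigma> p :: real
  defines "N \<equiv> real CARD('n::finite)"
  assumes \<sigma>: "-1 < \<sigma>" "\<sigma> < 0" and p: "1 < p" and crit: "N - 2 * \<sigma> \<le> p * (N - 2 - 2 * \<sigma>)"
    and d: "d = N * (p - 1) / 2" and k: "k = d / (p * (\<sigma> + 1) - \<sigma>)"
  shows "\<exists>\<epsilon>>0. \<forall>w u0 :: (real ^ 'n) \<Rightarrow>\<^sub>C real.
    w \<in> C0 \<and> u0 \<in> C0 \<and> Lq_le d \<epsilon> u0 \<and> Lq_le k \<epsilon> w \<longrightarrow> exists_globally p \<sigma> w u0"
proof -
  obtain x where x: "1 / (p * (p - 1)) < x" "\<sigma> + 1 / (p - 1) < x" "x < 1 / (p - 1)" "x < N / (2 * p)"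
    using admissible_exponent[OF \<sigma> p crit] by blast
  define q \<beta> \<theta> where "q = N / (2 * x)" and "\<beta> = 1 / (p - 1) - x" and "\<theta> = (p - 1) * x"
  have N: "0 < N" by (simp add: N_def)
  have x0: "0 < x" using x(1) p by (smt (verit) divide_pos_pos mult_pos_pos)
  have pq: "p \<le> q" using x(4) x0 p unfolding q_def by (simp add: field_simps)
  have \<theta>: "0 < \<theta>" "\<theta> < 1" using x0 x(3) p by (simp_all add: \<theta>_def pos_less_divide_eq mult.commute)
  have \<theta>q: "\<theta> = N / 2 * ((p - 1) / q)"
  proof -
    have "N / 2 * ((p - 1) / q) = (p - 1) * (N / 2 / q)" by simp
    also have "N / 2 / q = x" using N x0 by (simp add: q_def)
    finally show ?thesis by (simp add: \<theta>_def)
  qed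
  have p\<beta>: "p * \<beta> < 1"
  proof -
    have "1 < x * (p * (p - 1))" using x(1) p by (simp add: pos_divide_less_eq)
    then show ?thesis using p unfolding \<beta>_def by (simp add: field_simps)
  qed
  have \<beta>\<theta>: "(p - 1) * \<beta> = 1 - \<theta>" using p by (simp add: \<beta>_def \<theta>_def right_diff_distrib)
  have k1: "1 \<le> k"
  proof -
    have D: "p * (\<sigma> + 1) - \<sigma> = (p - 1) * (\<sigma> + 1) + 1" by (simp add: algebra_simps)
    then have "0 < p * (\<sigma> + 1) - \<sigma>" using p \<sigma> by (simp add: add_pos_pos)
    moreover have "p * (\<sigma> + 1) - \<sigma> \<le> d" using crit unfolding D d by (simp add: field_simps)
    ultimately show ?thesis unfolding k by (simp add: pos_le_divide_eq)
  qed
  define B1 B2 B3 where "B1 = Beta (\<sigma> + 1) (- \<sigma> - \<beta>)" and "B2 = Beta (1 - p * \<beta>) (1 - \<theta>)" and "B3 = Beta \<theta> (1 - \<theta>)"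
  have B: "0 < B1" "0 < B2" "0 < B3"
    unfolding B1_def B2_def B3_def using \<sigma> x(2) p\<beta> \<theta> by (auto intro!: Beta_pos simp: \<beta>_def)
  define m where "m = min (1 / (32 * B2)) (1 / (2 * B3))"
  have m: "0 < m" using B by (simp add: m_def)
  have mB2: "16 * (m * B2) \<le> 1 / 2"
  proof -
    have "m * B2 \<le> 1 / (32 * B2) * B2" using B by (intro mult_right_mono) (auto simp: m_def)
    then show ?thesis using B by simp
  qed
  have mB3: "m * B3 \<le> 1 / 2"
  proof -
    have "m * B3 \<le> 1 / (2 * B3) * B3" using B by (intro mult_right_mono) (auto simp: m_def)
    then show ?thesis using B by simp
  qed
  define K where "K = m powr (1 / (p - 1))"
  have K: "0 < K" "K powr (p - 1) = m" using m p by (simp_all add: K_def powr_powr)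
  have Kp: "K powr p = K * m" using K powr_mult_base[of K "p - 1"] by simp
  define \<epsilon> where "\<epsilon> = K / (8 * (1 + 4 * B1))"
  have \<epsilon>: "0 < \<epsilon>" "8 * (\<epsilon> * (1 + 4 * B1)) = K"
  proof -
    define c where "c = 8 * (1 + 4 * B1)"
    have c: "0 < c" "\<epsilon> = K / c" using B by (simp_all add: c_def \<epsilon>_def)
    then have "\<epsilon> * c = K" by simp
    then show "8 * (\<epsilon> * (1 + 4 * B1)) = K" by (simp add: c_def algebra_simps)
    show "0 < \<epsilon>" using c K by simp
  qed
  have small: "4 * (\<epsilon> + 4 * (\<epsilon> * B1 + K powr p * B2)) \<le> K"
  proof -
    have "4 * (\<epsilon> + 4 * (\<epsilon> * B1 + K powr p * B2)) = 8 * (\<epsilon> * (1 + 4 * B1)) / 2 + K * (16 * (m * B2))"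
      by (simp add: Kp algebra_simps)
    also have "\<dots> \<le> K / 2 + K * (1 / 2)"
      unfolding \<epsilon>(2) using K mB2 by (intro add_left_mono mult_left_mono) auto
    finally show ?thesis by simp
  qed
  have "exists_globally p \<sigma> w u0" if w: "w \<in> C0" and u0: "u0 \<in> C0" and L: "Lq_le d \<epsilon> u0" "Lq_le k \<epsilon> w"
    for w u0 :: "(real ^ 'n) \<Rightarrow>\<^sub>C real"
  proof (rule exists_globally_if_bounded[OF \<sigma>(1) p w u0])
    fix T :: real assume T: "0 < T"
    define C where "C = norm u0 + T powr (\<sigma> + 1) / (\<sigma> + 1) * norm w"
    let ?G = "forcing \<sigma> w u0"
    have G: "?G t \<in> C0 \<and> norm (?G t) \<le> C" if t: "t \<in> {0..T}" for t
    proof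
      show "?G t \<in> C0" by (rule C0_forcing[OF \<sigma>(1) p w u0])
      have "norm (source_flow \<sigma> w t) \<le> t powr (\<sigma> + 1) / (\<sigma> + 1) * norm w"
        using t by (intro norm_source_flow_le \<sigma> w) auto
      also have "\<dots> \<le> T powr (\<sigma> + 1) / (\<sigma> + 1) * norm w"
        using t \<sigma> by (intro mult_right_mono divide_right_mono powr_mono2) auto
      finally show "norm (?G t) \<le> C"
        unfolding forcing_def C_def
        by (intro order_trans[OF norm_triangle_ineq] add_mono norm_heat_flow_le)
    qed
    have Lq: "Lq_le q (K * s powr (- \<beta>)) (picard p ?G n s)" if "0 < s" for n s
      using that small x k1
      by (intro picard_Lq_bound[OF \<sigma>(1) p w u0, where x = x and d = d and k = k and \<epsilon> = \<epsilon>] L K \<epsilon>)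
        (simp_all add: N_def[symmetric] d k q_def \<beta>_def[symmetric] B1_def B2_def \<theta>_def)
    have "norm (u r) \<le> 2 * C" if r: "0 < r" "r \<le> T" and u: "solves p ?G r u" for r u
    proof (rule picard_limit_bound[OF p u])
      show "norm (picard p ?G n t) \<le> 2 * C" if t: "t \<in> {0..r}" for n t
      proof (rule picard_sup_bound[OF p _ _ _ _ \<theta>(2) \<beta>\<theta> Lq K(1) _ t])
        show "continuous_on {0..r} ?G" by (rule continuous_on_forcing[OF \<sigma>(1) p w u0])
        show "K powr (p - 1) * Beta \<theta> (1 - \<theta>) \<le> 1 / 2" using mB3 by (simp add: K B3_def)
        show "\<theta> = real CARD('n) / 2 * ((p - 1) / q)" using \<theta>q by (simp add: N_def)
      qed (use G r pq in auto)
      show "continuous_on {0..r} ?G" by (rule continuous_on_forcing[OF \<sigma>(1) p w u0])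
    qed (use G r in auto)
    then show "\<exists>C. \<forall>r u. 0 < r \<and> r \<le> T \<and> solves p ?G r u \<longrightarrow> norm (u r) \<le> C" by blast
  qed
  then show ?thesis using \<epsilon>(1) by blast
qed

lemma Lp_norm_imp_Lq_le:
  assumes "f \<in> Lp q" "Lp_norm q f \<le> c" "0 < q"
  shows "Lq_le q c f"
  unfolding Lq_le_def
proof
  show "f \<in> borel_measurable borel" using assms(1) by (simp add: Lp_def)
  let ?I = "\<integral>x. \<bar>f x\<bar> powr q \<partial>lborel"
  have I: "0 \<le> ?I" by simp
  have "(\<integral>\<^sup>+ x. ennreal (\<bar>f x\<bar> powr q) \<partial>lborel) = ennreal ?I"
    using assms(1) by (intro nn_integral_eq_integral) (auto simp: Lp_def)
  also have "?I = (?I powr (1 / q)) powr q" using I assms(3) by (simp add: powr_powr)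
  also have "\<dots> \<le> c powr q"
    using assms(2,3) by (intro powr_mono2) (auto simp: Lp_norm_def)
  finally show "(\<integral>\<^sup>+ x. ennreal (\<bar>f x\<bar> powr q) \<partial>lborel) \<le> ennreal (c powr q)"
    by (simp add: ennreal_leI)
qed

text \<open>
  Without this, \<open>Lp_norm k w\<close> could be 0 for lack of integrability, and its smallness would say
  nothing.
\<close>

lemma integrable_bcontfun_Lp:
  fixes w :: "(real ^ 'n::finite) \<Rightarrow>\<^sub>C real"
  assumes w: "integrable lborel w" and k: "1 \<le> k"
  shows "apply_bcontfun w \<in> Lp k"
  unfolding Lp_def
proof (intro CollectI conjI)
    show "integrable lborel (\<lambda>x. \<bar>w x\<bar> powr k)"
    proof (rule Bochner_Integration.integrable_bound[OF integrable_mult_right[OF w, of "norm w powr (k - 1)"]])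
      have "\<bar>w x\<bar> powr k \<le> norm w powr (k - 1) * \<bar>w x\<bar>" for x
      proof -
        have "\<bar>w x\<bar> powr k = \<bar>w x\<bar> powr (k - 1) * \<bar>w x\<bar>"
          using powr_mult_base[of "\<bar>w x\<bar>" "k - 1"] by (simp add: mult.commute)
        also have "\<dots> \<le> norm w powr (k - 1) * \<bar>w x\<bar>"
          using k norm_bounded[of w x] by (intro mult_right_mono powr_mono2) auto
        finally show ?thesis .
      qed
      then show "AE x in lborel. norm (\<bar>w x\<bar> powr k) \<le> norm (norm w powr (k - 1) * w x)"
        by (simp add: abs_mult)
    qed measurable
qed simp

theorem theorem1p1:
  fixes N :: nat and p \<sigma> :: real
  assumes "N = CARD('n::finite)" and "2 \<le> N" and "1 < p" and "-1 < \<sigma>" and "\<sigma> < 0"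
  shows
    "(p < (real N - 2 * \<sigma>) / (real N - 2 - 2 * \<sigma>) \<longrightarrow>
       (\<forall>\<alpha> (w :: (real ^ 'n) \<Rightarrow>\<^sub>C real) u0.
          0 < \<alpha> \<and> \<alpha> < 1 \<and> w \<in> C0_holder \<alpha> \<and> integrable lborel w \<and> w \<noteq> 0 \<and>
          0 < (\<integral>x. w x \<partial>lborel) \<and> u0 \<in> C0 \<longrightarrow>
          blows_up_in_finite_time p \<sigma> w u0)) \<and>
     (p \<ge> (real N - 2 * \<sigma>) / (real N - 2 - 2 * \<sigma>) \<longrightarrow>
       (let d = real N * (p - 1) / 2; k = d / (p * (\<sigma> + 1) - \<sigma>) in
        \<exists>\<epsilon>>0. \<forall>\<alpha> (w :: (real ^ 'n) \<Rightarrow>\<^sub>C real) u0.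
          0 < \<alpha> \<and> \<alpha> < 1 \<and> w \<in> C0_holder \<alpha> \<and> integrable lborel w \<and> w \<noteq> 0 \<and>
          u0 \<in> C0 \<and> apply_bcontfun u0 \<in> Lp d \<and>
          Lp_norm d u0 + Lp_norm k w < \<epsilon> \<longrightarrow>
          exists_globally p \<sigma> w u0))"
proof (intro conjI impI allI)
  have N: "real N = real CARD('n)" using assms(1) by simp
  have den: "0 < real N - 2 - 2 * \<sigma>" using assms by auto
  {
    fix \<alpha> and w u0 :: "(real ^ 'n) \<Rightarrow>\<^sub>C real"
    assume sub: "p < (real N - 2 * \<sigma>) / (real N - 2 - 2 * \<sigma>)"
      and *: "0 < \<alpha> \<and> \<alpha> < 1 \<and> w \<in> C0_holder \<alpha> \<and> integrable lborel w \<and> w \<noteq> 0 \<and>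
          0 < (\<integral>x. w x \<partial>lborel) \<and> u0 \<in> C0"
    have "p * (real CARD('n) - 2 - 2 * \<sigma>) < real CARD('n) - 2 * \<sigma>"
      using sub den by (simp add: N[symmetric] pos_less_divide_eq)
    then show "blows_up_in_finite_time p \<sigma> w u0"
      using * assms(3-5) by (intro finite_time_blow_up) (auto simp: C0_holder_def)
  }
  assume sup: "(real N - 2 * \<sigma>) / (real N - 2 - 2 * \<sigma>) \<le> p"
  define d where "d = real N * (p - 1) / 2"
  define k where "k = d / (p * (\<sigma> + 1) - \<sigma>)"
  have crit: "real N - 2 * \<sigma> \<le> p * (real N - 2 - 2 * \<sigma>)"
    using sup den by (simp add: pos_divide_le_eq)
  obtain \<epsilon> where \<epsilon>: "0 < \<epsilon>" "\<And>w u0 :: (real ^ 'n) \<Rightarrow>\<^sub>C real.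
      w \<in> C0 \<Longrightarrow> u0 \<in> C0 \<Longrightarrow> Lq_le d \<epsilon> u0 \<Longrightarrow> Lq_le k \<epsilon> w \<Longrightarrow> exists_globally p \<sigma> w u0"
    using global_existence_small_data[where 'n = 'n, OF assms(4,5,3) crit[unfolded N] d_def[unfolded N] k_def] by blast
  have D: "p * (\<sigma> + 1) - \<sigma> = (p - 1) * (\<sigma> + 1) + 1" by (simp add: algebra_simps)
  have D0: "0 < p * (\<sigma> + 1) - \<sigma>" unfolding D using assms by (simp add: add_pos_pos)
  \<comment> \<open>The inequality \<open>k \<ge> 1\<close> is equivalent to \<open>p\<close> being at least the critical exponent.\<close>
  have "p * (\<sigma> + 1) - \<sigma> \<le> d" using crit unfolding D d_def by (simp add: field_simps)
  then have k1: "1 \<le> k" using D0 by (simp add: k_def pos_le_divide_eq)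
  have d0: "0 < d" using assms by (simp add: d_def)
  have nn: "0 \<le> Lp_norm r f" for r and f :: "real ^ 'n \<Rightarrow> real" by (simp add: Lp_norm_def)
  have "exists_globally p \<sigma> w u0"
    if "w \<in> C0_holder \<alpha>" "integrable lborel w" "u0 \<in> C0" "apply_bcontfun u0 \<in> Lp d"
      "Lp_norm d u0 + Lp_norm k w < \<epsilon>" for \<alpha> and w u0 :: "(real ^ 'n) \<Rightarrow>\<^sub>C real"
  proof (rule \<epsilon>(2))
    show "w \<in> C0" using that(1) by (simp add: C0_holder_def)
    show "Lq_le d \<epsilon> u0"
      using that(5) nn[of k w] by (intro Lp_norm_imp_Lq_le that(4) d0) linarith
    show "Lq_le k \<epsilon> w"
      using that(5) nn[of d u0] k1 by (intro Lp_norm_imp_Lq_le integrable_bcontfun_Lp that(2)) linarith+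
  qed (rule that(3))
  then show "let d = real N * (p - 1) / 2; k = d / (p * (\<sigma> + 1) - \<sigma>) in
        \<exists>\<epsilon>>0. \<forall>\<alpha> (w :: (real ^ 'n) \<Rightarrow>\<^sub>C real) u0.
          0 < \<alpha> \<and> \<alpha> < 1 \<and> w \<in> C0_holder \<alpha> \<and> integrable lborel w \<and> w \<noteq> 0 \<and>
          u0 \<in> C0 \<and> apply_bcontfun u0 \<in> Lp d \<and>
          Lp_norm d u0 + Lp_norm k w < \<epsilon> \<longrightarrow>
          exists_globally p \<sigma> w u0"
    unfolding Let_def d_def[symmetric] k_def[symmetric] using \<epsilon>(1) by blast
qed

end
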